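(* Let $B_0\subset B_1\subset B_2\subset\cdots\subset B_\infty$ be the Jones tower, with Jones projections $e_i$ ($i\ge 2$), of a connected inclusion $B_0\subset B_1$ of finite-dimensional von Neumann algebras with its Markov trace. If $\alpha$ is a compatible automorphism of $B_\infty$, then $\alpha$ is inner if and only if $\alpha|_{B_1}=\mathrm{Ad}\,u|_{B_1}$ for some unitary $u\in B_0$.
   Context: An inclusion $B_0\subset B_1$ of finite-dimensional von Neumann algebras (with common unit) is connected if $B_0\cap B_1'=\mathbb{C}$. The Jones tower is obtained by iterating the basic construction: for $i\ge 2$, $e_i$ is the orthogonal projection of $L^2(B_{i-1},\mathrm{tr})$ onto $L^2(B_{i-2},\mathrm{tr})$ and $B_i=\{B_{i-1},e_i\}''\subset\mathcal{B}(L^2(B_{i-1}))$. The Markov trace $\mathrm{tr}$ (of modulus $\tau$) is the unique normalized faithful trace on $B_1$ that extends to a trace on the whole tower; it satisfies $\mathrm{tr}(e_i)=\tau$, $e_ixe_i=E_{B_{i-2}}(x)e_i$ and $\mathrm{tr}(xe_i)=\tau\,\mathrm{tr}(x)$ for $x\in B_{i-1}$. $B_\infty$ is the strong closure of $\bigcup_iB_i$ in the GNS representation of the trace; it is the hyperfinite $II_1$ factor (whenever $B_0\neq B_1$). All automorphisms are trace-preserving $*$-automorphisms. An automorphism $\alpha$ of $B_\infty$ is compatible if $\alpha(e_i)=e_i$ for all $i\ge 2$ and $\alpha(B_i)=B_i$ for all $i$. $\mathrm{Ad}\,u(x)=uxu^*$; an automorphism of $B_\infty$ is inner if it equals $\mathrm{Ad}\,u$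 for some unitary $u\in B_\infty$. *)

theory Defs
  imports "HOL-Analysis.Analysis"
begin

section \<open>Complex Hilbert spaces\<close>

text \<open>The complex inner product is linear in its first argument. Norm, topology and positivity
  are inherited from \<^class>\<open>real_inner\<close> through the last axiom.\<close>

class complex_inner_product = real_inner +
  fixes scaleC :: "complex \<Rightarrow> 'a \<Rightarrow> 'a" (infixr "*\<^sub>C" 75)
    and cinner :: "'a \<Rightarrow> 'a \<Rightarrow> complex"
  assumes scaleC_add_right: "c *\<^sub>C (x + y) = c *\<^sub>C x + c *\<^sub>C y"
    and scaleC_add_left: "(c + d) *\<^sub>C x = c *\<^sub>C x + d *\<^sub>C x"
    and scaleC_scaleC: "c *\<^sub>C (d *\<^sub>C x) = (c * d) *\<^sub>C x"
    and scaleC_of_real: "complex_of_real r *\<^sub>C x = r *\<^sub>R x"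
    and cinner_commute: "cinner x y = cnj (cinner y x)"
    and cinner_add_left: "cinner (x + y) z = cinner x z + cinner y z"
    and cinner_scaleC_left: "cinner (c *\<^sub>C x) y = c * cinner x y"
    and inner_eq_Re_cinner: "inner x y = Re (cinner x y)"

class complex_hilbert_space = complex_inner_product + complete_space


section \<open>Operators and von Neumann algebras\<close>

text \<open>Elements of \<open>'h \<Rightarrow>\<^sub>L 'h\<close> are only real linear; the bounded operators of the complex Hilbert
  space are singled out by \<open>clinear_ops\<close>.\<close>

type_synonym 'h operator = "'h \<Rightarrow>\<^sub>L 'h"

definition scalar_op :: "complex \<Rightarrow> 'h::complex_hilbert_space operator" where
  "scalar_op c = Blinfun (\<lambda>v. c *\<^sub>C v)"

definition clinear_ops :: "'h::complex_hilbert_space operator set" where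
  "clinear_ops = {T. \<forall>c v. blinfun_apply T (c *\<^sub>C v) = c *\<^sub>C blinfun_apply T v}"

text \<open>For \<open>T \<in> clinear_ops\<close> the adjoint exists (Riesz) and is unique.\<close>

definition adj :: "'h::complex_hilbert_space operator \<Rightarrow> 'h operator" where
  "adj T = (THE S. \<forall>v w. cinner (blinfun_apply S v) w = cinner v (blinfun_apply T w))"

definition unitary_op :: "'h::complex_hilbert_space operator \<Rightarrow> bool" where
  "unitary_op u \<longleftrightarrow> u \<in> clinear_ops \<and> adj u o\<^sub>L u = id_blinfun \<and> u o\<^sub>L adj u = id_blinfun"

definition Ad :: "'h::complex_hilbert_space operator \<Rightarrow> 'h operator \<Rightarrow> 'h operator" where
  "Ad u x = u o\<^sub>L x o\<^sub>L adj u"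

definition commutant :: "'h::complex_hilbert_space operator set \<Rightarrow> 'h operator set" where
  "commutant S = {T \<in> clinear_ops. \<forall>s\<in>S. T o\<^sub>L s = s o\<^sub>L T}"

definition star_subalgebra :: "'h::complex_hilbert_space operator set \<Rightarrow> bool" where
  "star_subalgebra A \<longleftrightarrow> A \<subseteq> clinear_ops \<and> id_blinfun \<in> A \<and>
     (\<forall>x\<in>A. \<forall>y\<in>A. x + y \<in> A \<and> x o\<^sub>L y \<in> A) \<and>
     (\<forall>x\<in>A. adj x \<in> A \<and> (\<forall>c. scalar_op c o\<^sub>L x \<in> A))"

definition von_neumann_algebra :: "'h::complex_hilbert_space operator set \<Rightarrow> bool" where
  "von_neumann_algebra A \<longleftrightarrow> star_subalgebra A \<and> commutant (commutant A) = A"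

definition finite_dim :: "'h::complex_hilbert_space operator set \<Rightarrow> bool" where
  "finite_dim A \<longleftrightarrow> (\<exists>F. finite F \<and> F \<subseteq> A \<and> (\<forall>x\<in>A. \<exists>c. x = (\<Sum>f\<in>F. scalar_op (c f) o\<^sub>L f)))"

definition connected_inclusion ::
    "'h::complex_hilbert_space operator set \<Rightarrow> 'h operator set \<Rightarrow> bool" where
  "connected_inclusion N M \<longleftrightarrow> N \<subseteq> M \<and> N \<inter> commutant M = range scalar_op"

definition tracial_state ::
    "'h::complex_hilbert_space operator set \<Rightarrow> ('h operator \<Rightarrow> complex) \<Rightarrow> bool" where
  "tracial_state A tr \<longleftrightarrow> tr id_blinfun = 1 \<and>
     (\<forall>x\<in>A. \<forall>y\<in>A. tr (x + y) = tr x + tr y \<and> tr (x o\<^sub>L y) = tr (y o\<^sub>L x)) \<and>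
     (\<forall>x\<in>A. tr (adj x o\<^sub>L x) \<in> \<real>\<^sub>\<ge>\<^sub>0 \<and> (\<forall>c. tr (scalar_op c o\<^sub>L x) = c * tr x))"

definition faithful_on ::
    "'h::complex_hilbert_space operator set \<Rightarrow> ('h operator \<Rightarrow> complex) \<Rightarrow> bool" where
  "faithful_on A tr \<longleftrightarrow> (\<forall>x\<in>A. tr (adj x o\<^sub>L x) = 0 \<longrightarrow> x = 0)"


section \<open>The basic construction\<close>

text \<open>Let \<open>M\<close> be a finite-dimensional von Neumann algebra with faithful trace \<open>tr\<close>. Then the Hilbert
  space \<open>L\<^sup>2(M, tr)\<close> is \<open>M\<close> itself with the inner product below, and its bounded operators are all
  complex-linear maps from \<open>M\<close> to \<open>M\<close>, represented by extensional functions.\<close>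

definition L2_inner ::
    "('h::complex_hilbert_space operator \<Rightarrow> complex) \<Rightarrow> 'h operator \<Rightarrow> 'h operator \<Rightarrow> complex" where
  "L2_inner tr x y = tr (adj y o\<^sub>L x)"

definition L2_ops ::
    "'h::complex_hilbert_space operator set \<Rightarrow> ('h operator \<Rightarrow> 'h operator) set" where
  "L2_ops M = {T \<in> M \<rightarrow>\<^sub>E M. (\<forall>x\<in>M. \<forall>y\<in>M. T (x + y) = T x + T y) \<and>
                             (\<forall>c. \<forall>x\<in>M. T (scalar_op c o\<^sub>L x) = scalar_op c o\<^sub>L T x)}"

definition L2_commutant ::
    "'h::complex_hilbert_space operator set \<Rightarrow> ('h operator \<Rightarrow> 'h operator) set
      \<Rightarrow> ('h operator \<Rightarrow> 'h operator) set" where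
  "L2_commutant M S = {T \<in> L2_ops M. \<forall>s\<in>S. compose M T s = compose M s T}"

definition left_mult ::
    "'h::complex_hilbert_space operator set \<Rightarrow> 'h operator \<Rightarrow> 'h operator \<Rightarrow> 'h operator" where
  "left_mult M x = (\<lambda>y\<in>M. x o\<^sub>L y)"

definition L2_projection ::
    "('h::complex_hilbert_space operator \<Rightarrow> complex) \<Rightarrow> 'h operator set \<Rightarrow> 'h operator set
      \<Rightarrow> 'h operator \<Rightarrow> 'h operator" where
  "L2_projection tr N M = (\<lambda>x\<in>M. THE y. y \<in> N \<and> (\<forall>n\<in>N. L2_inner tr (x - y) n = 0))"

definition basic_construction ::
    "('h::complex_hilbert_space operator \<Rightarrow> complex) \<Rightarrow> 'h operator set \<Rightarrow> 'h operator set
      \<Rightarrow> ('h operator \<Rightarrow> 'h operator) set" where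
  "basic_construction tr N M =
     L2_commutant M (L2_commutant M (left_mult M ` M \<union> {L2_projection tr N M}))"

text \<open>\<open>P\<close> with the projection \<open>e\<close> is a copy of the basic construction of \<open>N \<subseteq> M\<close>: a \<open>*\<close>-isomorphism
  onto the concrete algebra on \<open>L\<^sup>2(M, tr)\<close> identifies \<open>M \<subseteq> P\<close> with the left multiplications and \<open>e\<close>
  with the orthogonal projection onto \<open>L\<^sup>2(N, tr)\<close>.\<close>

definition is_basic_construction ::
    "('h::complex_hilbert_space operator \<Rightarrow> complex) \<Rightarrow> 'h operator set \<Rightarrow> 'h operator set
      \<Rightarrow> 'h operator set \<Rightarrow> 'h operator \<Rightarrow> bool" where
  "is_basic_construction tr N M P e \<longleftrightarrow> N \<subseteq> M \<and> M \<subseteq> P \<and> e \<in> P \<and>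
     (\<exists>\<Phi>. bij_betw \<Phi> P (basic_construction tr N M) \<and>
        (\<forall>x\<in>P. \<forall>y\<in>P. \<forall>a\<in>M. \<Phi> (x + y) a = \<Phi> x a + \<Phi> y a) \<and>
        (\<forall>c. \<forall>x\<in>P. \<forall>a\<in>M. \<Phi> (scalar_op c o\<^sub>L x) a = scalar_op c o\<^sub>L \<Phi> x a) \<and>
        (\<forall>x\<in>P. \<forall>y\<in>P. \<Phi> (x o\<^sub>L y) = compose M (\<Phi> x) (\<Phi> y)) \<and>
        (\<forall>x\<in>P. \<forall>a\<in>M. \<forall>b\<in>M. L2_inner tr (\<Phi> x a) b = L2_inner tr a (\<Phi> (adj x) b)) \<and>
        (\<forall>x\<in>M. \<Phi> x = left_mult M x) \<and>
        \<Phi> e = L2_projection tr N M)"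


section \<open>The Jones tower and its closure\<close>

definition jones_tower ::
    "('h::complex_hilbert_space operator \<Rightarrow> complex) \<Rightarrow> (nat \<Rightarrow> 'h operator set)
      \<Rightarrow> (nat \<Rightarrow> 'h operator) \<Rightarrow> bool" where
  "jones_tower tr B e \<longleftrightarrow>
     (\<forall>i. von_neumann_algebra (B i) \<and> finite_dim (B i) \<and> B i \<subseteq> B (Suc i)) \<and>
     (\<forall>i\<ge>2. is_basic_construction tr (B (i - 2)) (B (i - 1)) (B i) (e i))"

definition markov_trace ::
    "real \<Rightarrow> ('h::complex_hilbert_space operator \<Rightarrow> complex) \<Rightarrow> (nat \<Rightarrow> 'h operator set)
      \<Rightarrow> (nat \<Rightarrow> 'h operator) \<Rightarrow> bool" where
  "markov_trace \<tau> tr B e \<longleftrightarrow> faithful_on (B 1) tr \<and> (\<forall>i. tracial_state (B i) tr) \<and>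
     (\<forall>i\<ge>2. \<forall>x\<in>B (i - 1). tr (x o\<^sub>L e i) = complex_of_real \<tau> * tr x)"

definition vector_state ::
    "'h::complex_hilbert_space \<Rightarrow> 'h operator \<Rightarrow> complex" where
  "vector_state \<Omega> x = cinner (blinfun_apply x \<Omega>) \<Omega>"

definition cyclic_vector ::
    "'h::complex_hilbert_space operator set \<Rightarrow> 'h \<Rightarrow> bool" where
  "cyclic_vector A \<Omega> \<longleftrightarrow> closure ((\<lambda>x. blinfun_apply x \<Omega>) ` A) = UNIV"

text \<open>An algebra \<open>A\<close> on a Hilbert space with a cyclic vector \<open>\<Omega>\<close> is in the GNS representation of the
  state \<open>vector_state \<Omega>\<close>, and every GNS representation is of this form. If the state is a trace on
  \<open>A\<close>, the same formula is its extension to the strong closure.\<close>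

definition tower_closure :: "(nat \<Rightarrow> 'h::complex_hilbert_space operator set) \<Rightarrow> 'h operator set" where
  "tower_closure B = strong_operator_topology closure_of (\<Union>i. B i)"

definition trace_automorphism ::
    "('h::complex_hilbert_space operator \<Rightarrow> complex) \<Rightarrow> 'h operator set
      \<Rightarrow> ('h operator \<Rightarrow> 'h operator) \<Rightarrow> bool" where
  "trace_automorphism tr A \<alpha> \<longleftrightarrow> bij_betw \<alpha> A A \<and>
     (\<forall>x\<in>A. \<forall>y\<in>A. \<alpha> (x + y) = \<alpha> x + \<alpha> y \<and> \<alpha> (x o\<^sub>L y) = \<alpha> x o\<^sub>L \<alpha> y) \<and>
     (\<forall>x\<in>A. \<alpha> (adj x) = adj (\<alpha> x) \<and> tr (\<alpha> x) = tr x \<and>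
        (\<forall>c. \<alpha> (scalar_op c o\<^sub>L x) = scalar_op c o\<^sub>L \<alpha> x))"

definition compatible_automorphism ::
    "('h::complex_hilbert_space operator \<Rightarrow> complex) \<Rightarrow> (nat \<Rightarrow> 'h operator set)
      \<Rightarrow> (nat \<Rightarrow> 'h operator) \<Rightarrow> ('h operator \<Rightarrow> 'h operator) \<Rightarrow> bool" where
  "compatible_automorphism tr B e \<alpha> \<longleftrightarrow> trace_automorphism tr (tower_closure B) \<alpha> \<and>
     (\<forall>i\<ge>2. \<alpha> (e i) = e i) \<and> (\<forall>i. \<alpha> ` B i = B i)"

definition inner_automorphism ::
    "'h::complex_hilbert_space operator set \<Rightarrow> ('h operator \<Rightarrow> 'h operator) \<Rightarrow> bool" where
  "inner_automorphism A \<alpha> \<longleftrightarrow> (\<exists>u\<in>A. unitary_op u \<and> (\<forall>x\<in>A. \<alpha> x = Ad u x))"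

end

theory Submission
  imports Defs
begin

text \<open>Write \<open>E\<^sub>k\<close> for the trace preserving conditional expectation onto \<open>B k\<close>.

  If \<open>\<alpha>\<close> equals \<open>Ad u\<close> on \<open>B 1\<close> for a unitary \<open>u \<in> B 0\<close>, then \<open>Ad u\<close> fixes the Jones projections, because they
  commute with \<open>B 0\<close>. As \<open>B (k + 2)\<close> is spanned by \<open>B (k + 1) e B (k + 1)\<close> (\<open>generated\<close>), the two automorphisms agree
  on the tower (\<open>implemented_climbs\<close>), and then on its closure since both preserve the trace
  (\<open>implemented_on_closure\<close>).

  Conversely let \<open>\<alpha> = Ad w\<close> for a unitary \<open>w\<close> of the closure. The elements \<open>w\<^sub>k = E\<^sub>k w\<close> are intertwiners:
  \<open>w\<^sub>k y = \<alpha>(y) w\<^sub>k\<close> for \<open>y \<in> B k\<close>. Let \<open>V k \<subseteq> B k\<close> be the space of all intertwiners of level \<open>k\<close>. The basic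
  construction identifies \<open>V k\<close> with \<open>V (k + 2)\<close>: an intertwiner \<open>x\<close> and its lift \<open>y\<close> determine each other by
  \<open>y e = x e\<close>. Lifting commutes with the conditional expectations (\<open>E_lift\<close>). Hence all \<open>w\<^sub>2\<^sub>j\<close> can be read as
  elements \<open>c\<^sub>j\<close> of the single finite-dimensional space \<open>V 0\<close>, and the relation \<open>E\<^sub>2\<^sub>j w\<^sub>2\<^sub>j\<^sub>+\<^sub>2 = w\<^sub>2\<^sub>j\<close> becomes
  \<open>T c\<^sub>j\<^sub>+\<^sub>1 = c\<^sub>j\<close> for one operator \<open>T\<close> on \<open>V 0\<close>, lift followed by \<open>E\<^sub>0\<close>.

  For the identity automorphism the intertwiners form the centre \<open>Z 0\<close> of \<open>B 0\<close>, and \<open>T\<close> is the transition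
  operator of two steps of the random walk on the Bratteli diagram. Connectedness makes this walk irreducible:
  there is a faithful \<open>T\<close>-invariant state \<open>\<psi>\<close> on \<open>Z 0\<close> (\<open>limit_state_invariant\<close>, \<open>limit_state_faithful\<close>). By the
  Kadison-Schwarz inequality the energy \<open>\<psi>(v\<^sup>* v)\<close> of \<open>v \<in> V 0\<close> does not increase under \<open>T\<close>. It therefore
  increases along the bounded sequence \<open>c\<^sub>j\<close>, and a limit point \<open>v\<close> of this sequence loses no energy under \<open>T\<close>
  (\<open>bounded_backward_orbit\<close>). As \<open>\<psi>\<close> is faithful, equality in the Kadison-Schwarz inequality forces the lift of
  \<open>v\<close> to be \<open>T v\<close> itself (\<open>lift_fixed\<close>). So \<open>T v\<close> lies in \<open>B 0\<close> and intertwines \<open>\<alpha>\<close> on \<open>B 2\<close>, in particular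
  on \<open>B 1\<close>. Connectedness makes it a multiple of a unitary \<open>u\<close> (\<open>unitary_from_fixed\<close>), and \<open>\<alpha> = Ad u\<close> on \<open>B 1\<close>.\<close>

section \<open>Adjoints of bounded operators\<close>

lemma cinner_add_right: "cinner x (y + z) = cinner x y + cinner x z"
  by (metis cinner_commute cinner_add_left complex_cnj_add)

lemma cinner_scaleC_right: "cinner x (c *\<^sub>C y) = cnj c * cinner x y"
  by (metis cinner_commute cinner_scaleC_left complex_cnj_mult)

lemma additive_cinner_left: "Modules.additive (\<lambda>x. cinner x y)"
  by (simp add: Modules.additive_def cinner_add_left)

lemma additive_cinner_right: "Modules.additive (cinner x)"
  by (simp add: Modules.additive_def cinner_add_right)

lemmas cinner_zero_left [simp] = additive.zero [OF additive_cinner_left]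
lemmas cinner_zero_right [simp] = additive.zero [OF additive_cinner_right]
lemmas cinner_diff_left = additive.diff [OF additive_cinner_left]
lemmas cinner_diff_right = additive.diff [OF additive_cinner_right]
lemmas cinner_sum_left = additive.sum [OF additive_cinner_left]
lemmas cinner_sum_right = additive.sum [OF additive_cinner_right]

lemma cinner_self: "cinner x x = complex_of_real ((norm x)\<^sup>2)"
proof (rule complex_eqI)
  show "Re (cinner x x) = Re (complex_of_real ((norm x)\<^sup>2))"
    by (metis Re_complex_of_real inner_eq_Re_cinner power2_norm_eq_inner)
  have "Im (cinner x x) = - Im (cinner x x)"
    by (metis cinner_commute cnj.sel(2))
  then show "Im (cinner x x) = Im (complex_of_real ((norm x)\<^sup>2))" by simp
qed

lemma cinner_self_eq_0 [simp]: "cinner x x = 0 \<longleftrightarrow> x = 0"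
  by (simp add: cinner_self)

lemma Im_cinner: "Im (cinner x y) = inner x (\<i> *\<^sub>C y)"
  by (simp add: inner_eq_Re_cinner cinner_scaleC_right)

lemma norm_scaleC: "norm (c *\<^sub>C x) = cmod c * norm (x :: 'a::complex_inner_product)"
proof -
  have "complex_of_real ((norm (c *\<^sub>C x))\<^sup>2) = (c * cnj c) * complex_of_real ((norm x)\<^sup>2)"
    by (metis cinner_self cinner_scaleC_left cinner_scaleC_right mult.assoc)
  then have "(norm (c *\<^sub>C x))\<^sup>2 = (cmod c * norm x)\<^sup>2"
    unfolding complex_norm_square [symmetric] of_real_mult [symmetric] of_real_eq_iff power_mult_distrib .
  then show ?thesis by (simp add: power2_eq_iff_nonneg)
qed

lemma cinner_eqI: "(\<And>z. cinner x z = cinner y z) \<Longrightarrow> x = y"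
  by (metis cinner_diff_left cinner_self_eq_0 right_minus_eq)

lemma norm_cinner_le: "cmod (cinner x y) \<le> norm x * norm y"
proof (cases "cinner x y = 0")
  case False
  define c where "c = cnj (sgn (cinner x y))"
  have "cmod c = 1" using False by (simp add: c_def norm_sgn)
  have "sgn (cinner x y) * cmod (cinner x y) = cinner x y"
    using False by (simp add: sgn_eq)
  then have "c * cinner x y = complex_of_real (cmod (cinner x y)) * (sgn (cinner x y) * cnj (sgn (cinner x y)))"
    unfolding c_def by (metis mult.commute mult.left_commute)
  also have "\<dots> = complex_of_real (cmod (cinner x y))"
    using \<open>cmod c = 1\<close> complex_norm_square [of "sgn (cinner x y)"] by (simp add: c_def)
  finally have "cmod (cinner x y) = inner (c *\<^sub>C x) y"
    by (simp add: inner_eq_Re_cinner cinner_scaleC_left)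
  also have "\<dots> \<le> norm (c *\<^sub>C x) * norm y" by (rule norm_cauchy_schwarz)
  finally show ?thesis using \<open>cmod c = 1\<close> by (simp add: norm_scaleC)
qed simp

lemma bounded_linear_scaleC: "bounded_linear (\<lambda>x. c *\<^sub>C (x :: 'a::complex_inner_product))"
proof (rule bounded_linear_intro)
  show "c *\<^sub>C (r *\<^sub>R x) = r *\<^sub>R (c *\<^sub>C x)" for r and x :: 'a
    by (metis scaleC_of_real scaleC_scaleC mult.commute)
  show "norm (c *\<^sub>C x) \<le> norm x * cmod c" for x :: 'a
    by (simp add: norm_scaleC)
qed (rule scaleC_add_right)

lemma scalar_op_apply [simp]: "blinfun_apply (scalar_op c) v = c *\<^sub>C v"
  by (simp add: scalar_op_def bounded_linear_Blinfun_apply bounded_linear_scaleC)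

lemma scaleC_one [simp]: "1 *\<^sub>C (x :: 'a::complex_inner_product) = x"
  by (metis of_real_1 scaleC_of_real scaleR_one)

lemma scaleC_zero [simp]: "0 *\<^sub>C (x :: 'a::complex_inner_product) = 0"
  by (metis of_real_0 scaleC_of_real scaleR_zero_left)

text \<open>The functional is represented by the minimiser of \<open>w \<mapsto> \<parallel>w\<parallel>\<^sup>2 - 2 f w\<close>: a minimising sequence
  is Cauchy by the parallelogram law.\<close>

lemma Riesz_representation:
  fixes f :: "'a::{real_inner, complete_space} \<Rightarrow> real"
  assumes "bounded_linear f"
  obtains v where "\<And>w. f w = inner v w"
proof -
  interpret f: bounded_linear f by fact
  define J where "J w = (norm w)\<^sup>2 - 2 * f w" for w
  obtain K where K: "\<And>w. norm (f w) \<le> norm w * K" using f.bounded by blast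
  have lower: "- K\<^sup>2 \<le> J w" for w
  proof -
    have "f w \<le> norm w * K" using K [of w] by simp
    moreover have "0 \<le> (norm w - K)\<^sup>2" by simp
    ultimately show ?thesis by (simp add: J_def power2_diff)
  qed
  have bdd: "bdd_below (range J)" using lower by (auto intro!: bdd_belowI)
  define m where "m = Inf (range J)"
  have m_le: "m \<le> J w" for w unfolding m_def by (rule cInf_lower [OF _ bdd]) simp
  have "\<exists>w. J w < m + 1 / Suc n" for n
    using cInf_lessD [of "range J" "m + 1 / Suc n"] by (auto simp: m_def)
  then obtain w where w: "\<And>n. J (w n) < m + 1 / Suc n" by metis
  have par: "(norm (x - y))\<^sup>2 = 2 * J x + 2 * J y - 4 * J ((1/2) *\<^sub>R (x + y))" for x y
    by (simp add: J_def f.scaleR f.add power2_norm_eq_inner algebra_simps inner_add_left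
        inner_add_right inner_diff_left inner_diff_right inner_commute)
  have close: "(norm (w i - w j))\<^sup>2 < 4 / Suc n" if "n \<le> i" "n \<le> j" for i j n
  proof -
    have "J (w i) < m + 1 / Suc n" "J (w j) < m + 1 / Suc n"
      using w [of i] w [of j] that frac_le [of 1 1 "real (Suc n)" "real (Suc i)"]
        frac_le [of 1 1 "real (Suc n)" "real (Suc j)"] by auto
    then show ?thesis using par [of "w i" "w j"] m_le [of "(1/2) *\<^sub>R (w i + w j)"] by simp
  qed
  have "Cauchy w"
  proof (rule metric_CauchyI)
    fix e :: real assume "0 < e"
    then obtain n where n: "4 / e\<^sup>2 < real (Suc n)"
      by (metis lessI less_trans reals_Archimedean2 of_nat_less_iff)
    then have "4 / Suc n < e\<^sup>2" using \<open>0 < e\<close> by (simp add: field_simps)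
    then have "dist (w i) (w j) < e" if "n \<le> i" "n \<le> j" for i j
      using close [OF that] \<open>0 < e\<close>
      by (metis dist_norm less_trans less_eq_real_def power2_less_imp_less)
    then show "\<exists>M. \<forall>i\<ge>M. \<forall>j\<ge>M. dist (w i) (w j) < e" by blast
  qed
  then obtain v where v: "w \<longlonglongrightarrow> v" using Cauchy_convergent convergent_def by blast
  have "(\<lambda>n. J (w n)) \<longlonglongrightarrow> J v"
    unfolding J_def using v f.tendsto by (intro tendsto_intros) auto
  moreover have "(\<lambda>n. m + 1 / Suc n) \<longlonglongrightarrow> m + 0"
    by (intro tendsto_intros LIMSEQ_Suc [OF lim_const_over_n])
  ultimately have "J v \<le> m"
    using LIMSEQ_le [of "\<lambda>n. J (w n)" "J v" "\<lambda>n. m + 1 / Suc n" "m + 0"] w by (force intro: less_imp_le)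
  then have min: "J v \<le> J x" for x using m_le [of x] by linarith
  have "f h = inner v h" for h
  proof (rule ccontr)
    define d where "d = f h - inner v h"
    assume "f h \<noteq> inner v h"
    then have d: "d \<noteq> 0" by (simp add: d_def)
    \<comment> \<open>a step in the direction \<open>h\<close>, small enough that the linear term \<open>- 2 t d\<close> of \<open>J\<close> outweighs the quadratic one\<close>
    define t where "t = d / ((norm h)\<^sup>2 + 1)"
    have pos: "(norm h)\<^sup>2 + 1 > 0" by (simp add: add_nonneg_pos)
    have "J (v + t *\<^sub>R h) = J v + t\<^sup>2 * (norm h)\<^sup>2 - 2 * t * d"
      unfolding J_def d_def f.add f.scaleR power2_norm_eq_inner
      by (simp add: inner_commute [of h v] algebra_simps power2_eq_square)
    then have "2 * t * d \<le> t\<^sup>2 * (norm h)\<^sup>2" using min [of "v + t *\<^sub>R h"] by simp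
    also have "\<dots> \<le> t\<^sup>2 * ((norm h)\<^sup>2 + 1)" by (simp add: algebra_simps)
    also have "\<dots> = t * d" using pos by (simp add: t_def power2_eq_square)
    finally have "t * d \<le> 0" by linarith
    moreover have "t * d > 0"
      using d pos unfolding t_def times_divide_eq_left power2_eq_square [symmetric]
      by (intro divide_pos_pos) auto
    ultimately show False by simp
  qed
  then show thesis using that by blast
qed

lemma clinear_opsD: "T \<in> clinear_ops \<Longrightarrow> blinfun_apply T (c *\<^sub>C v) = c *\<^sub>C blinfun_apply T v"
  by (simp add: clinear_ops_def)

lemma adjoint_exists:
  fixes T :: "'h::complex_hilbert_space operator"
  assumes T: "T \<in> clinear_ops"
  obtains S where "\<And>v w. cinner (blinfun_apply S v) w = cinner v (blinfun_apply T w)"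
proof -
  have "\<exists>s. \<forall>w. inner v (T w) = inner s w" for v
  proof -
    have "bounded_linear (\<lambda>w. inner v (blinfun_apply T w))"
      by (intro bounded_linear_compose [OF bounded_linear_inner_right] blinfun.bounded_linear_right)
    from Riesz_representation [OF this] show ?thesis by metis
  qed
  then obtain s where s: "\<And>v w. inner v (T w) = inner (s v) w" by metis
  have "bounded_linear s"
  proof (rule bounded_linear_intro)
    show "s (x + y) = s x + s y" for x y
      by (rule vector_eq_ldot [THEN iffD1], rule allI)
        (metis inner_add_left inner_commute s)
    show "s (r *\<^sub>R x) = r *\<^sub>R s x" for r x
      by (rule vector_eq_ldot [THEN iffD1], rule allI)
        (metis inner_scaleR_left inner_commute s)
    show "norm (s x) \<le> norm x * norm T" for x
    proof -
      have "(norm (s x))\<^sup>2 = inner x (T (s x))" by (simp add: s power2_norm_eq_inner)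
      also have "\<dots> \<le> norm x * norm (T (s x))" by (rule norm_cauchy_schwarz)
      also have "\<dots> \<le> norm x * (norm T * norm (s x))"
        by (intro mult_left_mono norm_blinfun) simp
      finally have "norm (s x) * norm (s x) \<le> (norm x * norm T) * norm (s x)"
        by (simp add: power2_eq_square mult.assoc)
      then show ?thesis
        by (cases "s x = 0") auto
    qed
  qed
  then have sapp: "blinfun_apply (Blinfun s) = s" by (rule bounded_linear_Blinfun_apply)
  have "cinner (s v) w = cinner v (T w)" for v w
  proof (rule complex_eqI)
    show "Re (cinner (s v) w) = Re (cinner v (T w))"
      using s [of v w] by (simp add: inner_eq_Re_cinner)
    show "Im (cinner (s v) w) = Im (cinner v (T w))"
      by (simp add: Im_cinner s [symmetric] clinear_opsD [OF T])
  qed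
  then show thesis using that [of "Blinfun s"] sapp by simp
qed

lemma adj_unique:
  assumes "\<And>v w. cinner (blinfun_apply S v) w = cinner v (blinfun_apply T w)"
  shows "adj T = S"
  unfolding adj_def
proof (rule the_equality)
  fix S' assume "\<forall>v w. cinner (blinfun_apply S' v) w = cinner v (blinfun_apply T w)"
  then have "\<And>v. blinfun_apply S' v = blinfun_apply S v"
    using assms by (intro cinner_eqI) simp
  then show "S' = S" by (rule blinfun_eqI)
qed (use assms in blast)

lemma cinner_adj_left:
  "T \<in> clinear_ops \<Longrightarrow> cinner (blinfun_apply (adj T) v) w = cinner v (blinfun_apply T w)"
  by (metis adjoint_exists adj_unique)

lemma cinner_adj_right:
  "T \<in> clinear_ops \<Longrightarrow> cinner v (blinfun_apply (adj T) w) = cinner (blinfun_apply T v) w"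
  by (metis cinner_adj_left cinner_commute)

lemma clinear_ops_id [simp]: "id_blinfun \<in> clinear_ops"
  and clinear_ops_compose: "S \<in> clinear_ops \<Longrightarrow> T \<in> clinear_ops \<Longrightarrow> S o\<^sub>L T \<in> clinear_ops"
  by (auto simp: clinear_ops_def blinfun.add_left scaleC_add_right scaleC_scaleC mult.commute)

lemma clinear_ops_adj: "T \<in> clinear_ops \<Longrightarrow> adj T \<in> clinear_ops"
proof -
  assume T: "T \<in> clinear_ops"
  have "adj T (c *\<^sub>C v) = c *\<^sub>C adj T v" for c v
    by (rule cinner_eqI) (simp add: cinner_adj_left [OF T] cinner_scaleC_left)
  then show ?thesis by (simp add: clinear_ops_def)
qed

lemma adj_adj [simp]: "T \<in> clinear_ops \<Longrightarrow> adj (adj T) = T"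
  by (rule adj_unique) (simp add: cinner_adj_right)

lemma adj_compose:
  "S \<in> clinear_ops \<Longrightarrow> T \<in> clinear_ops \<Longrightarrow> adj (S o\<^sub>L T) = adj T o\<^sub>L adj S"
  by (rule adj_unique) (simp add: cinner_adj_left)

lemma adj_add: "S \<in> clinear_ops \<Longrightarrow> T \<in> clinear_ops \<Longrightarrow> adj (S + T) = adj S + adj T"
  by (rule adj_unique) (simp add: cinner_adj_left blinfun.add_left cinner_add_left cinner_add_right)

lemma adj_diff: "S \<in> clinear_ops \<Longrightarrow> T \<in> clinear_ops \<Longrightarrow> adj (S - T) = adj S - adj T"
  by (rule adj_unique) (simp add: cinner_adj_left blinfun.diff_left cinner_diff_left cinner_diff_right)

lemma adj_id [simp]: "adj id_blinfun = id_blinfun"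
  by (rule adj_unique) simp

lemma adj_scale: "T \<in> clinear_ops \<Longrightarrow> adj (scalar_op c o\<^sub>L T) = scalar_op (cnj c) o\<^sub>L adj T"
  by (rule adj_unique) (simp add: cinner_adj_left cinner_scaleC_left cinner_scaleC_right)

lemma scalar_op_commute: "T \<in> clinear_ops \<Longrightarrow> T o\<^sub>L scalar_op c = scalar_op c o\<^sub>L T"
  by (rule blinfun_eqI) (simp add: clinear_opsD)

lemma norm_adj_le: "T \<in> clinear_ops \<Longrightarrow> norm (adj T) \<le> norm T"
proof (rule norm_blinfun_bound)
  fix v assume T: "T \<in> clinear_ops"
  have "(norm (adj T v))\<^sup>2 = cmod (cinner v (T (adj T v)))"
    by (simp add: cinner_adj_left [OF T, symmetric] cinner_self norm_power)
  also have "\<dots> \<le> norm v * norm (T (adj T v))" by (rule norm_cinner_le)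
  also have "\<dots> \<le> norm v * (norm T * norm (adj T v))"
    by (intro mult_left_mono norm_blinfun) simp
  finally have "norm (adj T v) * norm (adj T v) \<le> (norm T * norm v) * norm (adj T v)"
    by (simp add: power2_eq_square mult_ac)
  then show "norm (adj T v) \<le> norm T * norm v" by (cases "adj T v = 0") auto
qed simp

section \<open>Orthonormal bases of finite-dimensional spaces of operators\<close>

interpretation blinfun_compose: bounded_bilinear "(o\<^sub>L)"
  by (rule bounded_bilinear_blinfun_compose)

lemma compose_assoc: "(a o\<^sub>L b) o\<^sub>L c = a o\<^sub>L (b o\<^sub>L c)"
  by (rule blinfun_eqI) simp

lemma id_compose [simp]: "id_blinfun o\<^sub>L a = a" "a o\<^sub>L id_blinfun = a"
  by (rule blinfun_eqI, simp)+

lemmas compose_simps =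
  compose_assoc blinfun_compose.add_left blinfun_compose.add_right
  blinfun_compose.diff_left blinfun_compose.diff_right
  blinfun_compose.zero_left blinfun_compose.zero_right

text \<open>Composition with a scalar operator from the left is a complex scalar multiplication on all real linear
  operators. On \<open>clinear_ops\<close> the side does not matter.\<close>

interpretation op: vector_space "\<lambda>c (x :: 'h::complex_hilbert_space operator). scalar_op c o\<^sub>L x"
  by unfold_locales
    (rule blinfun_eqI; simp add: blinfun.add_left scaleC_add_right scaleC_add_left scaleC_scaleC)+

lemma op_scale_right:
  "x \<in> clinear_ops \<Longrightarrow> x o\<^sub>L (scalar_op c o\<^sub>L y) = scalar_op c o\<^sub>L (x o\<^sub>L y)"
  by (rule blinfun_eqI) (simp add: clinear_opsD)

lemma op_scale_left: "(scalar_op c o\<^sub>L x) o\<^sub>L y = scalar_op c o\<^sub>L (x o\<^sub>L y)"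
  by (rule blinfun_eqI) simp

definition orthonormal_basis ::
    "('h::complex_hilbert_space operator \<Rightarrow> 'h operator \<Rightarrow> complex) \<Rightarrow> 'h operator set
      \<Rightarrow> 'h operator set \<Rightarrow> bool" where
  "orthonormal_basis f W G \<longleftrightarrow> finite G \<and> G \<subseteq> W \<and>
     (\<forall>g\<in>G. \<forall>h\<in>G. f g h = (if g = h then 1 else 0)) \<and>
     (\<forall>x\<in>W. x = (\<Sum>g\<in>G. scalar_op (f x g) o\<^sub>L g))"

lemma orthonormal_basisD:
  assumes "orthonormal_basis f W G"
  shows "finite G" "G \<subseteq> W" "\<And>g. g \<in> G \<Longrightarrow> g \<in> W"
    and "\<And>g h. \<lbrakk>g \<in> G; h \<in> G\<rbrakk> \<Longrightarrow> f g h = (if g = h then 1 else 0)"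
    and "\<And>x. x \<in> W \<Longrightarrow> x = (\<Sum>g\<in>G. scalar_op (f x g) o\<^sub>L g)"
  using assms by (auto simp: orthonormal_basis_def)

locale positive_form =
  fixes W :: "'h::complex_hilbert_space operator set"
    and f :: "'h operator \<Rightarrow> 'h operator \<Rightarrow> complex"
  assumes subspace: "op.subspace W"
    and add_left: "\<lbrakk>x \<in> W; y \<in> W; z \<in> W\<rbrakk> \<Longrightarrow> f (x + y) z = f x z + f y z"
    and scale_left: "\<lbrakk>x \<in> W; z \<in> W\<rbrakk> \<Longrightarrow> f (scalar_op c o\<^sub>L x) z = c * f x z"
    and hermitian: "\<lbrakk>x \<in> W; y \<in> W\<rbrakk> \<Longrightarrow> f y x = cnj (f x y)"
    and positive: "x \<in> W \<Longrightarrow> 0 \<le> Re (f x x)"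
begin

lemma add_right: "\<lbrakk>x \<in> W; y \<in> W; z \<in> W\<rbrakk> \<Longrightarrow> f z (x + y) = f z x + f z y"
  by (metis add_left hermitian complex_cnj_add op.subspace_add subspace)

lemma scale_right: "\<lbrakk>x \<in> W; z \<in> W\<rbrakk> \<Longrightarrow> f z (scalar_op c o\<^sub>L x) = cnj c * f z x"
  by (metis scale_left hermitian complex_cnj_mult op.subspace_scale subspace)

lemma zero_left: "z \<in> W \<Longrightarrow> f 0 z = 0"
  using scale_left [of 0 z 0] op.subspace_0 [OF subspace] by simp

lemma diff_left: "\<lbrakk>x \<in> W; y \<in> W; z \<in> W\<rbrakk> \<Longrightarrow> f (x - y) z = f x z - f y z"
  using add_left [of "x - y" y z] op.subspace_diff [OF subspace] by simp

lemma sum_left: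
  assumes "z \<in> W" "\<And>i. i \<in> I \<Longrightarrow> g i \<in> W"
  shows "f (\<Sum>i\<in>I. g i) z = (\<Sum>i\<in>I. f (g i) z)"
  using assms(2)
proof (induction I rule: infinite_finite_induct)
  case (insert i I)
  then show ?case
    using assms(1) by (simp add: add_left op.subspace_sum [OF subspace])
qed (simp_all add: zero_left assms)

lemma self_real: "x \<in> W \<Longrightarrow> f x x = complex_of_real (Re (f x x))"
  using hermitian [of x x] by (simp add: complex_eq_iff)

text \<open>For null \<open>x\<close> the form at \<open>y + c x\<close> is affine in \<open>c\<close>, hence negative for a suitable \<open>c\<close> unless it is constant.\<close>

lemma null_right:
  assumes x: "x \<in> W" and y: "y \<in> W" and null: "f x x = 0"
  shows "f y x = 0"
proof (rule ccontr)
  assume ne: "f y x \<noteq> 0"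
  define a where "a = (cmod (f y x))\<^sup>2"
  have a: "a > 0" using ne by (simp add: a_def)
  \<comment> \<open>chosen so that the form at \<open>y + c x\<close> has the value \<open>-1\<close>\<close>
  define t where "t = - (Re (f y y) + 1) / (2 * a)"
  define c where "c = complex_of_real t * f y x"
  have cx: "scalar_op c o\<^sub>L x \<in> W" using x by (rule op.subspace_scale [OF subspace])
  have yc: "y + (scalar_op c o\<^sub>L x) \<in> W" using y cx by (rule op.subspace_add [OF subspace])
  have "f (y + (scalar_op c o\<^sub>L x)) (y + (scalar_op c o\<^sub>L x)) = f y y + (cnj c * f y x + c * cnj (f y x))"
    using x y cx yc
    by (simp add: add_left add_right scale_left scale_right null hermitian [of y x])
  also have "cnj c * f y x + c * cnj (f y x) = complex_of_real (2 * t * a)"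
    using complex_norm_square [of "f y x"] by (simp add: c_def a_def mult_ac)
  finally have "Re (f (y + (scalar_op c o\<^sub>L x)) (y + (scalar_op c o\<^sub>L x))) = Re (f y y) + 2 * t * a"
    by simp
  then have "0 \<le> Re (f y y) + 2 * t * a" using positive [OF yc] by simp
  moreover have "2 * t * a = - (Re (f y y) + 1)" using a by (simp add: t_def)
  ultimately show False by simp
qed

text \<open>Gram-Schmidt. The expansion formula doubles as the statement that the basis spans and as the
  formula for the orthogonal projection.\<close>

lemma exists_orthonormal_basis:
  assumes fin: "finite F" and span: "W \<subseteq> op.span F"
    and definite: "\<And>x. x \<in> W \<Longrightarrow> f x x = 0 \<Longrightarrow> x = 0"
  obtains G where "orthonormal_basis f W G"
proof -
  let ?exp = "\<lambda>G x. (\<Sum>g\<in>G. scalar_op (f x g) o\<^sub>L g)"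
  let ?on = "\<lambda>G. finite G \<and> G \<subseteq> W \<and> (\<forall>g\<in>G. \<forall>h\<in>G. f g h = (if g = h then 1 else 0))"
  have ex_on: "\<exists>G. ?on G \<and> (\<forall>x\<in>S. x = ?exp G x)" if "finite S" "S \<subseteq> W" for S
    using that
  proof (induction S)
    case empty
    show ?case by (rule exI [of _ "{}"]) simp
  next
    case (insert s S)
    then obtain G where on: "?on G" and ex: "\<forall>x\<in>S. x = ?exp G x" by auto
    have s: "s \<in> W" and S: "S \<subseteq> W" using insert.prems by auto
    have term_W: "scalar_op c o\<^sub>L g \<in> W" if "g \<in> G" for c g
      using on that by (intro op.subspace_scale [OF subspace]) auto
    have exp_W: "?exp G x \<in> W" for x
      by (rule op.subspace_sum [OF subspace]) (rule term_W)
    define y where "y = s - ?exp G s"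
    have y: "y \<in> W" unfolding y_def by (intro op.subspace_diff [OF subspace] s exp_W)
    have yG: "f y h = 0" if h: "h \<in> G" for h
    proof -
      have "h \<in> W" using on h by auto
      then have "f (?exp G s) h = (\<Sum>g\<in>G. f (scalar_op (f s g) o\<^sub>L g) h)"
        by (intro sum_left term_W)
      also have "\<dots> = (\<Sum>g\<in>G. if g = h then f s h else 0)"
        using on h \<open>h \<in> W\<close> by (intro sum.cong) (auto simp: scale_left subset_iff)
      also have "\<dots> = f s h" using on h by simp
      finally show ?thesis unfolding y_def using s exp_W \<open>h \<in> W\<close> by (simp add: diff_left)
    qed
    show ?case
    proof (cases "y = 0")
      case True
      then have "s = ?exp G s" by (simp add: y_def)
      then show ?thesis using on ex by blast
    next
      case False
      define r where "r = Re (f y y)"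
      have r: "f y y = complex_of_real r" using self_real [OF y] by (simp add: r_def)
      have "r > 0"
        using False definite [OF y] positive [OF y] r unfolding r_def [symmetric] by force
      define k where "k = scalar_op (complex_of_real (1 / sqrt r)) o\<^sub>L y"
      have k: "k \<in> W" unfolding k_def by (intro op.subspace_scale [OF subspace] y)
      have kk: "f k k = 1"
      proof -
        have "f k k = complex_of_real (1 / sqrt r) * (complex_of_real (1 / sqrt r) * complex_of_real r)"
          unfolding k_def scale_left [OF y k [unfolded k_def]] scale_right [OF y y] r by simp
        also have "\<dots> = complex_of_real (1 / sqrt r * (1 / sqrt r * r))"
          by (simp only: of_real_mult)
        also have "1 / sqrt r * (1 / sqrt r * r) = 1"
          using \<open>r > 0\<close> by (simp add: real_div_sqrt)
        finally show ?thesis by simp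
      qed
      have kG: "f k h = 0" if "h \<in> G" for h
        using yG [OF that] on that y by (auto simp: k_def scale_left)
      have Gk: "f h k = 0" if "h \<in> G" for h
        using kG [OF that] on that k hermitian [of k h] by auto
      have "k \<notin> G" using kk kG by force
      have on': "?on (insert k G)"
        using on k kk kG Gk \<open>k \<notin> G\<close> by auto
      have exk: "f x k = 0" if "x = ?exp G x" for x
      proof -
        have "f (?exp G x) k = (\<Sum>g\<in>G. f (scalar_op (f x g) o\<^sub>L g) k)"
          by (intro sum_left term_W k)
        also have "\<dots> = 0"
          using on k Gk by (intro sum.neutral) (auto simp: scale_left subset_iff)
        finally show ?thesis using that by simp
      qed
      have "x = ?exp (insert k G) x" if "x \<in> S" for x
        using ex that exk [of x] on \<open>k \<notin> G\<close> by simp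
      moreover have "s = ?exp (insert k G) s"
      proof -
        have expk: "f (?exp G s) k = 0"
        proof -
          have "f (?exp G s) k = (\<Sum>g\<in>G. f (scalar_op (f s g) o\<^sub>L g) k)"
            by (intro sum_left term_W k)
          also have "\<dots> = 0"
            using on k Gk by (intro sum.neutral) (auto simp: scale_left subset_iff)
          finally show ?thesis .
        qed
        have "f s k = f y k"
          using s exp_W k expk by (simp add: y_def diff_left)
        also have "\<dots> = complex_of_real (1 / sqrt r * r)"
          using y by (simp add: k_def scale_right r)
        also have "1 / sqrt r * r = sqrt r" using \<open>r > 0\<close> by (simp add: real_div_sqrt)
        finally have "scalar_op (f s k) o\<^sub>L k = y"
          using \<open>r > 0\<close> unfolding k_def op.scale_scale of_real_mult [symmetric] by simp
        then show ?thesis using on \<open>k \<notin> G\<close> by (simp add: y_def)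
      qed
      ultimately show ?thesis using on' by (intro exI [of _ "insert k G"]) blast
    qed
  qed
  obtain S where S: "S \<subseteq> W" "op.independent S" "W \<subseteq> op.span S"
    by (rule op.maximal_independent_subset)
  have "finite S"
    using op.independent_span_bound [OF fin S(2)] S(1) span by blast
  from ex_on [OF this S(1)] obtain G where on: "?on G" and ex: "\<forall>x\<in>S. x = ?exp G x"
    by (elim exE conjE) (rule that, intro conjI; assumption)
  have "op.subspace {x \<in> W. x = ?exp G x}"
  proof (rule op.subspaceI)
    show "0 \<in> {x \<in> W. x = ?exp G x}"
      using on op.subspace_0 [OF subspace] by (auto simp: zero_left subset_iff intro!: sum.neutral [symmetric])
  next
    fix x y assume x: "x \<in> {x \<in> W. x = ?exp G x}" and y: "y \<in> {x \<in> W. x = ?exp G x}"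
    have "?exp G (x + y) = ?exp G x + ?exp G y"
      unfolding sum.distrib [symmetric]
      using on x y by (intro sum.cong) (auto simp: add_left op.scale_left_distrib subset_iff)
    then show "x + y \<in> {x \<in> W. x = ?exp G x}"
      using x y op.subspace_add [OF subspace] by auto
  next
    fix c x assume x: "x \<in> {x \<in> W. x = ?exp G x}"
    have "?exp G (scalar_op c o\<^sub>L x) = scalar_op c o\<^sub>L ?exp G x"
      unfolding op.scale_sum_right
      using on x by (intro sum.cong) (auto simp: scale_left op.scale_scale subset_iff)
    then show "scalar_op c o\<^sub>L x \<in> {x \<in> W. x = ?exp G x}"
      using x op.subspace_scale [OF subspace] by auto
  qed
  moreover have "S \<subseteq> {x \<in> W. x = ?exp G x}" using S(1) ex by blast
  ultimately have "op.span S \<subseteq> {x \<in> W. x = ?exp G x}" by (rule op.span_minimal [rotated])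
  then have "\<forall>x\<in>W. x = ?exp G x" using S(3) by blast
  then show thesis using on that [of G] unfolding orthonormal_basis_def by blast
qed

end

text \<open>An ideal of a finite-dimensional \<open>*\<close>-algebra is generated by a central projection: the
  orthogonal projection of the identity onto the ideal.\<close>

lemma ideal_unit:
  fixes P I :: "'h::complex_hilbert_space operator set"
  assumes P: "star_subalgebra P" and form: "positive_form P f"
    and definite: "\<And>x. x \<in> P \<Longrightarrow> f x x = 0 \<Longrightarrow> x = 0"
    and fin: "finite F" "P \<subseteq> op.span F"
    and adjoint: "\<And>a x y. \<lbrakk>a \<in> P; x \<in> P; y \<in> P\<rbrakk> \<Longrightarrow> f (a o\<^sub>L x) y = f x (adj a o\<^sub>L y)"
    and I: "I \<subseteq> P" "op.subspace I"
    and left: "\<And>a x. \<lbrakk>a \<in> P; x \<in> I\<rbrakk> \<Longrightarrow> a o\<^sub>L x \<in> I"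
    and star: "\<And>x. x \<in> I \<Longrightarrow> adj x \<in> I"
  obtains p where "p \<in> I" "\<forall>x\<in>I. x o\<^sub>L p = x" "adj p = p" "p o\<^sub>L p = p"
proof -
  interpret positive_form P f by fact
  have cl: "x \<in> clinear_ops" if "x \<in> P" for x using P that by (auto simp: star_subalgebra_def)
  have id: "id_blinfun \<in> P" using P by (simp add: star_subalgebra_def)
  have adjP: "adj x \<in> P" if "x \<in> P" for x using P that by (simp add: star_subalgebra_def)
  have right: "x o\<^sub>L a \<in> I" if "a \<in> P" "x \<in> I" for a x
  proof -
    have "adj a o\<^sub>L adj x \<in> I" using that by (intro left star adjP)
    then have "adj (adj a o\<^sub>L adj x) \<in> I" by (rule star)
    then show ?thesis
      using that I(1) by (simp add: adj_compose cl adjP subset_iff clinear_ops_adj)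
  qed
  have "positive_form I f"
    using I by unfold_locales
      (auto simp: add_left scale_left subset_iff intro: hermitian positive)
  then interpret I: positive_form I f .
  have "I \<subseteq> op.span F" using I(1) fin(2) by blast
  moreover have "x = 0" if "x \<in> I" "f x x = 0" for x using definite [of x] that I(1) by blast
  ultimately obtain G where "orthonormal_basis f I G"
    by (rule I.exists_orthonormal_basis [OF fin(1)])
  note G = orthonormal_basisD(1,2) [OF this] and on = orthonormal_basisD(4) [OF this]
    and ex = orthonormal_basisD(5) [OF this]
  define p where "p = (\<Sum>g\<in>G. scalar_op (f id_blinfun g) o\<^sub>L g)"
  have termI: "scalar_op c o\<^sub>L g \<in> I" if "g \<in> G" for c g
    using G(2) that by (intro op.subspace_scale [OF I(2)]) auto
  have p: "p \<in> I" unfolding p_def by (intro op.subspace_sum [OF I(2)] termI)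
  have GI: "g \<in> P" if "g \<in> G" for g using that G I by auto
  have fpG: "f p h = f id_blinfun h" if h: "h \<in> G" for h
  proof -
    have "f p h = (\<Sum>g\<in>G. f (scalar_op (f id_blinfun g) o\<^sub>L g) h)"
      unfolding p_def using h G I termI by (intro sum_left) auto
    also have "\<dots> = (\<Sum>g\<in>G. if g = h then f id_blinfun h else 0)"
      using on h GI by (intro sum.cong) (auto simp: scale_left)
    also have "\<dots> = f id_blinfun h" using G h by simp
    finally show ?thesis .
  qed
  have orth: "f (id_blinfun - p) y = 0" if y: "y \<in> I" for y
  proof -
    have dP: "id_blinfun - p \<in> P" using id p I by (intro op.subspace_diff [OF subspace]) auto
    have "f y (id_blinfun - p) = (\<Sum>g\<in>G. f (scalar_op (f y g) o\<^sub>L g) (id_blinfun - p))"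
      by (subst ex [OF y], rule sum_left) (use dP termI I in auto)
    also have "\<dots> = 0"
    proof (rule sum.neutral, rule ballI)
      fix g assume g: "g \<in> G"
      have "f g (id_blinfun - p) = cnj (f (id_blinfun - p) g)"
        using dP GI [OF g] by (intro hermitian)
      also have "f (id_blinfun - p) g = 0"
        using id p I GI [OF g] fpG [OF g] by (subst diff_left) auto
      finally show "f (scalar_op (f y g) o\<^sub>L g) (id_blinfun - p) = 0"
        using dP GI [OF g] by (simp add: scale_left)
    qed
    finally have "f y (id_blinfun - p) = 0" .
    then show ?thesis using hermitian [of y "id_blinfun - p"] y I dP by auto
  qed
  have unit: "y o\<^sub>L p = y" if y: "y \<in> I" for y
  proof -
    have dP: "id_blinfun - p \<in> P" using id p I by (intro op.subspace_diff [OF subspace]) auto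
    have yP: "y \<in> P" using y I by auto
    have z: "y o\<^sub>L (id_blinfun - p) \<in> I" by (rule right [OF dP y])
    then have zP: "y o\<^sub>L (id_blinfun - p) \<in> P" using I by auto
    have "f (y o\<^sub>L (id_blinfun - p)) (y o\<^sub>L (id_blinfun - p))
        = f (id_blinfun - p) (adj y o\<^sub>L (y o\<^sub>L (id_blinfun - p)))"
      by (rule adjoint [OF yP dP zP])
    also have "\<dots> = 0" by (intro orth left adjP yP z)
    finally have "y o\<^sub>L (id_blinfun - p) = 0" using definite zP by blast
    then show ?thesis by (simp add: blinfun_compose.diff_right)
  qed
  have clp: "p \<in> clinear_ops" using p I cl by auto
  have "adj p o\<^sub>L p = adj p" using unit [OF star [OF p]] .
  moreover have "adj (adj p o\<^sub>L p) = adj p o\<^sub>L p"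
    using clp by (simp add: adj_compose clinear_ops_adj)
  ultimately have "adj p = p" using clp by (metis adj_adj)
  then show thesis using that [OF p] unit p by blast
qed

section \<open>Conditional expectations onto finite-dimensional algebras\<close>

lemma scalar_op_zero [simp]: "scalar_op 0 = 0"
  by (rule blinfun_eqI) simp

lemma adj_zero [simp]: "adj 0 = 0"
  by (rule adj_unique) simp

lemma scalar_op_one [simp]: "scalar_op 1 = id_blinfun"
  by (rule blinfun_eqI) simp

lemma star_subalgebraD:
  assumes "star_subalgebra A"
  shows alg_clinear: "x \<in> A \<Longrightarrow> x \<in> clinear_ops"
    and alg_id: "id_blinfun \<in> A"
    and alg_add: "x \<in> A \<Longrightarrow> y \<in> A \<Longrightarrow> x + y \<in> A"
    and alg_mult: "x \<in> A \<Longrightarrow> y \<in> A \<Longrightarrow> x o\<^sub>L y \<in> A"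
    and alg_adj: "x \<in> A \<Longrightarrow> adj x \<in> A"
    and alg_scale: "x \<in> A \<Longrightarrow> scalar_op c o\<^sub>L x \<in> A"
    and alg_zero: "0 \<in> A"
proof -
  have "scalar_op 0 o\<^sub>L id_blinfun \<in> A" using assms unfolding star_subalgebra_def by blast
  then show "0 \<in> A" by simp
qed (use assms in \<open>auto simp: star_subalgebra_def\<close>)

lemma alg_subspace: "star_subalgebra A \<Longrightarrow> op.subspace A"
  by (rule op.subspaceI) (auto intro: star_subalgebraD)

lemma alg_diff: "star_subalgebra A \<Longrightarrow> x \<in> A \<Longrightarrow> y \<in> A \<Longrightarrow> x - y \<in> A"
  by (intro op.subspace_diff alg_subspace)

lemma finite_dim_span:
  assumes "finite_dim A"
  obtains F where "finite F" "A \<subseteq> op.span F"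
proof -
  obtain F where F: "finite F" "\<forall>x\<in>A. \<exists>c. x = (\<Sum>f\<in>F. scalar_op (c f) o\<^sub>L f)"
    using assms by (auto simp: finite_dim_def)
  have "x \<in> op.span F" if xA: "x \<in> A" for x
  proof -
    from bspec [OF F(2) xA] obtain c where x: "x = (\<Sum>f\<in>F. scalar_op (c f) o\<^sub>L f)"
      by (rule exE)
    have "(\<Sum>f\<in>F. scalar_op (c f) o\<^sub>L f) \<in> op.span F"
    proof (rule op.span_sum)
      fix f assume "f \<in> F"
      then show "scalar_op (c f) o\<^sub>L f \<in> op.span F" using op.span_base op.span_scale by blast
    qed
    then show ?thesis using x by argo
  qed
  then show thesis using F(1) that by blast
qed

definition cexp :: "'h::complex_hilbert_space \<Rightarrow> 'h operator set \<Rightarrow> 'h operator \<Rightarrow> 'h operator" where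
  "cexp \<Omega> A T = (THE y. y \<in> A \<and>
     (\<forall>a\<in>A. cinner (blinfun_apply T \<Omega>) (blinfun_apply a \<Omega>)
           = cinner (blinfun_apply y \<Omega>) (blinfun_apply a \<Omega>)))"

text \<open>A finite-dimensional algebra with separating vector \<open>\<Omega>\<close> is identified with the subspace \<open>A \<Omega>\<close> of the Hilbert
  space, so that the orthogonal projection of \<open>T \<Omega>\<close> onto \<open>A \<Omega>\<close> has the form \<open>cexp \<Omega> A T \<Omega>\<close>.\<close>

locale separated_algebra =
  fixes A :: "'h::complex_hilbert_space operator set" and \<Omega> :: 'h
  assumes alg: "star_subalgebra A" and fd: "finite_dim A"
    and separating: "\<And>x. \<lbrakk>x \<in> A; blinfun_apply x \<Omega> = 0\<rbrakk> \<Longrightarrow> x = 0"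
begin

abbreviation L2 :: "'h operator \<Rightarrow> 'h operator \<Rightarrow> complex" where
  "L2 x y \<equiv> cinner (blinfun_apply x \<Omega>) (blinfun_apply y \<Omega>)"

lemmas clinear = alg_clinear [OF alg] and id_in = alg_id [OF alg] and add_in = alg_add [OF alg]
  and mult_in = alg_mult [OF alg] and adj_in = alg_adj [OF alg] and scale_in = alg_scale [OF alg]
  and zero_in = alg_zero [OF alg] and diff_in = alg_diff [OF alg]

lemma L2_form: "positive_form A L2"
  by unfold_locales
    (auto simp: alg_subspace [OF alg] blinfun.add_left cinner_add_left cinner_scaleC_left cinner_self
      intro: cinner_commute)

lemma L2_basis:
  obtains G where "orthonormal_basis L2 A G"
proof -
  obtain F where "finite F" "A \<subseteq> op.span F" using finite_dim_span [OF fd] .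
  moreover have "x = 0" if "x \<in> A" "L2 x x = 0" for x using that by (intro separating) auto
  ultimately show thesis
    using that by (rule positive_form.exists_orthonormal_basis [OF L2_form])
qed

lemma inner_eqI:
  assumes "x \<in> A" "y \<in> A"
    and "\<And>a. a \<in> A \<Longrightarrow> L2 x a
                       = L2 y a"
  shows "x = y"
proof -
  have "L2 (x - y) (x - y) = 0"
    using assms(3) [OF diff_in [OF assms(1,2)]] by (simp add: blinfun.diff_left cinner_diff_left)
  then have "blinfun_apply (x - y) \<Omega> = 0" by simp
  then show ?thesis using separating [OF diff_in [OF assms(1,2)]] by simp
qed

lemma cexp_exists:
  obtains y where "y \<in> A" "\<forall>a\<in>A. L2 T a
    = L2 y a"
proof -
  obtain G where "orthonormal_basis L2 A G" by (rule L2_basis)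
  note G = orthonormal_basisD(1,2) [OF this] and on = orthonormal_basisD(4) [OF this]
    and ex = orthonormal_basisD(5) [OF this]
  define y where "y = (\<Sum>g\<in>G. scalar_op (L2 T g) o\<^sub>L g)"
  have "y \<in> A" unfolding y_def
    using G by (intro op.subspace_sum [OF alg_subspace [OF alg]] scale_in) auto
  moreover have yG: "L2 y h = L2 T h"
    if "h \<in> G" for h
  proof -
    have "L2 y h
        = (\<Sum>g\<in>G. if g = h then L2 T g else 0)"
      unfolding y_def blinfun.sum_left cinner_sum_left using on that
      by (intro sum.cong) (auto simp: cinner_scaleC_left)
    then show ?thesis using G that by simp
  qed
  moreover have "L2 T a = L2 y a"
    if a: "a \<in> A" for a
  proof -
    define c where "c = L2 a"
    have "a = (\<Sum>g\<in>G. scalar_op (c g) o\<^sub>L g)" unfolding c_def by (rule ex [OF a])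
    then show ?thesis by (simp add: blinfun.sum_left cinner_sum_right cinner_scaleC_right yG)
  qed
  ultimately show thesis using that by blast
qed

lemma cexp_unique:
  assumes "y \<in> A" "\<And>a. a \<in> A \<Longrightarrow> L2 T a
    = L2 y a"
  shows "cexp \<Omega> A T = y"
  unfolding cexp_def
  by (rule the_equality) (use assms in \<open>auto intro: inner_eqI\<close>)

lemma cexp_in [simp]: "cexp \<Omega> A T \<in> A"
  and cexp_inner: "a \<in> A \<Longrightarrow> L2 (cexp \<Omega> A T) a
    = L2 T a"
proof -
  obtain y where y: "y \<in> A" "\<forall>a\<in>A. cinner (T \<Omega>) (a \<Omega>) = cinner (y \<Omega>) (a \<Omega>)"
    by (rule cexp_exists)
  then have "cexp \<Omega> A T = y" by (intro cexp_unique) auto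
  with y show "cexp \<Omega> A T \<in> A"
    and "a \<in> A \<Longrightarrow> cinner (cexp \<Omega> A T \<Omega>) (a \<Omega>) = cinner (T \<Omega>) (a \<Omega>)" by simp_all
qed

lemma cexp_id: "x \<in> A \<Longrightarrow> cexp \<Omega> A x = x"
  by (rule cexp_unique) auto

lemma cexp_add: "cexp \<Omega> A (S + T) = cexp \<Omega> A S + cexp \<Omega> A T"
  by (rule cexp_unique) (auto simp: blinfun.add_left cinner_add_left cexp_inner add_in)

lemma cexp_diff: "cexp \<Omega> A (S - T) = cexp \<Omega> A S - cexp \<Omega> A T"
  by (rule cexp_unique) (auto simp: blinfun.diff_left cinner_diff_left cexp_inner diff_in)

lemma cexp_scale: "cexp \<Omega> A (scalar_op c o\<^sub>L T) = scalar_op c o\<^sub>L cexp \<Omega> A T"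
  by (rule cexp_unique) (auto simp: cinner_scaleC_left cexp_inner scale_in)

lemma cexp_trace: "cinner (blinfun_apply (cexp \<Omega> A T) \<Omega>) \<Omega> = cinner (blinfun_apply T \<Omega>) \<Omega>"
  using cexp_inner [OF id_in] by simp

lemma cexp_left: "a \<in> A \<Longrightarrow> cexp \<Omega> A (a o\<^sub>L T) = a o\<^sub>L cexp \<Omega> A T"
proof (rule cexp_unique)
  fix b assume a: "a \<in> A" and b: "b \<in> A"
  have "cinner (a (T \<Omega>)) (b \<Omega>) = cinner (T \<Omega>) ((adj a o\<^sub>L b) \<Omega>)"
    using clinear [OF a] by (simp add: cinner_adj_right)
  also have "\<dots> = cinner (cexp \<Omega> A T \<Omega>) ((adj a o\<^sub>L b) \<Omega>)"
    using a b by (intro cexp_inner [symmetric] mult_in adj_in)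
  also have "\<dots> = cinner (a (cexp \<Omega> A T \<Omega>)) (b \<Omega>)"
    using clinear [OF a] by (simp add: cinner_adj_right)
  finally show "cinner ((a o\<^sub>L T) \<Omega>) (b \<Omega>) = cinner ((a o\<^sub>L cexp \<Omega> A T) \<Omega>) (b \<Omega>)" by simp
qed (auto intro: mult_in)

lemma norm_cexp_le: "norm (blinfun_apply (cexp \<Omega> A T) \<Omega>) \<le> norm (blinfun_apply T \<Omega>)"
proof -
  let ?y = "blinfun_apply (cexp \<Omega> A T) \<Omega>"
  have "complex_of_real (norm ?y * norm ?y) = cinner (T \<Omega>) ?y"
    using cexp_inner [of "cexp \<Omega> A T" T] by (simp add: cinner_self power2_eq_square)
  then have "norm ?y * norm ?y = cmod (cinner (T \<Omega>) ?y)"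
    by (metis abs_of_nonneg norm_of_real zero_le_square)
  also have "\<dots> \<le> norm (T \<Omega>) * norm ?y" by (rule norm_cinner_le)
  finally show ?thesis by (cases "?y = 0") auto
qed

end

locale tracial_algebra = separated_algebra A \<Omega>
  for A :: "'h::complex_hilbert_space operator set" and \<Omega> :: 'h +
  assumes trace: "\<lbrakk>x \<in> A; y \<in> A\<rbrakk> \<Longrightarrow>
    cinner (blinfun_apply x (blinfun_apply y \<Omega>)) \<Omega> = cinner (blinfun_apply y (blinfun_apply x \<Omega>)) \<Omega>"
begin

lemma trace_inner:
  assumes "x \<in> A" "b \<in> A" "y \<in> A"
  shows "cinner (x (b \<Omega>)) (y \<Omega>) = cinner (x \<Omega>) (y (adj b \<Omega>))"
proof -
  have "cinner (x (b \<Omega>)) (y \<Omega>) = cinner ((adj y o\<^sub>L x) (b \<Omega>)) \<Omega>"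
    using assms clinear by (simp add: cinner_adj_left)
  also have "\<dots> = cinner (b ((adj y o\<^sub>L x) \<Omega>)) \<Omega>"
    using assms by (intro trace mult_in adj_in)
  also have "\<dots> = cinner (x \<Omega>) (y (adj b \<Omega>))"
    using cinner_adj_right [OF clinear [OF assms(2)], symmetric] cinner_adj_left [OF clinear [OF assms(3)]]
    by simp
  finally show ?thesis .
qed

text \<open>The second assumption is what the trace property gives for \<open>T\<close>. It is assumed separately because the lemma is
  used for operators \<open>T\<close> outside \<open>A\<close>.\<close>

lemma cexp_right:
  fixes T :: "'h operator"
  assumes b: "b \<in> A"
    and T: "\<And>y. y \<in> A \<Longrightarrow> cinner (T (b \<Omega>)) (y \<Omega>) = cinner (T \<Omega>) (y (adj b \<Omega>))"
  shows "cexp \<Omega> A (T o\<^sub>L b) = cexp \<Omega> A T o\<^sub>L b"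
proof (rule cexp_unique)
  fix a assume a: "a \<in> A"
  have "cinner ((T o\<^sub>L b) \<Omega>) (a \<Omega>) = cinner (T \<Omega>) ((a o\<^sub>L adj b) \<Omega>)" using T [OF a] by simp
  also have "\<dots> = cinner (cexp \<Omega> A T \<Omega>) ((a o\<^sub>L adj b) \<Omega>)"
    using a b by (intro cexp_inner [symmetric] mult_in adj_in)
  also have "\<dots> = cinner ((cexp \<Omega> A T o\<^sub>L b) \<Omega>) (a \<Omega>)"
    using trace_inner [OF cexp_in b a] by simp
  finally show "cinner ((T o\<^sub>L b) \<Omega>) (a \<Omega>) = cinner ((cexp \<Omega> A T o\<^sub>L b) \<Omega>) (a \<Omega>)" .
qed (intro mult_in cexp_in b)

lemma inner_adj: "\<lbrakk>x \<in> A; y \<in> A\<rbrakk> \<Longrightarrow> cinner (x \<Omega>) (y \<Omega>) = cinner (adj y \<Omega>) (adj x \<Omega>)"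
  using trace_inner [OF id_in, of x y] clinear by (simp add: cinner_adj_left)

end

section \<open>One step of the basic construction\<close>

text \<open>Here \<open>P\<close> is the basic construction of \<open>N \<subseteq> M\<close>, represented on \<open>L\<^sup>2(M)\<close> by \<open>\<Phi>\<close>. The trace is assumed faithful
  on \<open>M\<close> only: its faithfulness on \<open>P\<close> is a consequence of the Markov property.\<close>

locale basic_step = M: tracial_algebra M \<Omega> + N: separated_algebra N \<Omega>
  for N M P :: "'h::complex_hilbert_space operator set" and e :: "'h operator" and \<Omega> :: 'h
    and \<Phi> :: "'h operator \<Rightarrow> 'h operator \<Rightarrow> 'h operator" +
  assumes P: "star_subalgebra P" and fdP: "finite_dim P"
    and NM: "N \<subseteq> M" and MP: "M \<subseteq> P" and eP: "e \<in> P"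
    and bij: "bij_betw \<Phi> P (basic_construction (vector_state \<Omega>) N M)"
    and \<Phi>_add: "\<lbrakk>x \<in> P; y \<in> P; a \<in> M\<rbrakk> \<Longrightarrow> \<Phi> (x + y) a = \<Phi> x a + \<Phi> y a"
    and \<Phi>_scale: "\<lbrakk>x \<in> P; a \<in> M\<rbrakk> \<Longrightarrow> \<Phi> (scalar_op c o\<^sub>L x) a = scalar_op c o\<^sub>L \<Phi> x a"
    and \<Phi>_compose: "\<lbrakk>x \<in> P; y \<in> P\<rbrakk> \<Longrightarrow> \<Phi> (x o\<^sub>L y) = compose M (\<Phi> x) (\<Phi> y)"
    and \<Phi>_adj: "\<lbrakk>x \<in> P; a \<in> M; b \<in> M\<rbrakk> \<Longrightarrow>
      L2_inner (vector_state \<Omega>) (\<Phi> x a) b = L2_inner (vector_state \<Omega>) a (\<Phi> (adj x) b)"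
    and \<Phi>_left: "x \<in> M \<Longrightarrow> \<Phi> x = left_mult M x"
    and \<Phi>_proj: "\<Phi> e = L2_projection (vector_state \<Omega>) N M"
begin

sublocale N: tracial_algebra N \<Omega>
  by unfold_locales (use NM M.trace in auto)

abbreviation "E \<equiv> cexp \<Omega> N"

lemmas P_clinear = alg_clinear [OF P] and P_id = alg_id [OF P] and P_add = alg_add [OF P]
  and P_mult = alg_mult [OF P] and P_adj = alg_adj [OF P] and P_scale = alg_scale [OF P]
  and P_diff = alg_diff [OF P] and P_zero = alg_zero [OF P]

lemma MP': "x \<in> M \<Longrightarrow> x \<in> P" and NM': "x \<in> N \<Longrightarrow> x \<in> M"
  using MP NM by auto

lemma E_in_M [simp]: "E T \<in> M"
  using NM N.cexp_in by blast

lemma L2_inner_eq: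
  "b \<in> clinear_ops \<Longrightarrow> L2_inner (vector_state \<Omega>) a b = M.L2 a b"
  by (simp add: L2_inner_def vector_state_def cinner_adj_left)

lemma projection_eq: "a \<in> M \<Longrightarrow> L2_projection (vector_state \<Omega>) N M a = E a"
  unfolding L2_projection_def cexp_def
  by (auto intro!: arg_cong [where f = The] simp: fun_eq_iff L2_inner_eq N.clinear blinfun.diff_left
      cinner_diff_left)

lemma \<Phi>_e: "a \<in> M \<Longrightarrow> \<Phi> e a = E a"
  by (simp add: \<Phi>_proj projection_eq)

lemma \<Phi>_M: "\<lbrakk>x \<in> M; a \<in> M\<rbrakk> \<Longrightarrow> \<Phi> x a = x o\<^sub>L a"
  by (simp add: \<Phi>_left left_mult_def)

lemma \<Phi>_basic: "x \<in> P \<Longrightarrow> \<Phi> x \<in> basic_construction (vector_state \<Omega>) N M"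
  using bij by (auto simp: bij_betw_def)

lemma \<Phi>_L2_ops: "x \<in> P \<Longrightarrow> \<Phi> x \<in> L2_ops M"
  using \<Phi>_basic by (auto simp: basic_construction_def L2_commutant_def)

lemma \<Phi>_in: "\<lbrakk>x \<in> P; a \<in> M\<rbrakk> \<Longrightarrow> \<Phi> x a \<in> M"
  using \<Phi>_L2_ops [of x] PiE_mem [of "\<Phi> x" M "\<lambda>_. M" a] by (simp add: L2_ops_def)

lemma \<Phi>_sum_right:
  assumes "x \<in> P" "\<And>i. i \<in> I \<Longrightarrow> g i \<in> M"
  shows "\<Phi> x (\<Sum>i\<in>I. scalar_op (c i) o\<^sub>L g i) = (\<Sum>i\<in>I. scalar_op (c i) o\<^sub>L \<Phi> x (g i))"
proof -
  have add: "\<Phi> x (a + b) = \<Phi> x a + \<Phi> x b" if "a \<in> M" "b \<in> M" for a b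
    using \<Phi>_L2_ops [OF assms(1)] that by (simp add: L2_ops_def)
  have scale: "\<Phi> x (scalar_op d o\<^sub>L a) = scalar_op d o\<^sub>L \<Phi> x a" if "a \<in> M" for a d
    using \<Phi>_L2_ops [OF assms(1)] that by (simp add: L2_ops_def)
  have zero: "\<Phi> x 0 = 0"
    using add [of 0 0] M.zero_in by simp
  show ?thesis using assms(2)
  proof (induction I rule: infinite_finite_induct)
    case (insert i I)
    have "(\<Sum>i\<in>I. scalar_op (c i) o\<^sub>L g i) \<in> M"
      using insert by (intro op.subspace_sum [OF alg_subspace [OF M.alg]] M.scale_in) auto
    then show ?case using insert by (simp add: add scale M.scale_in)
  qed (simp_all add: zero)
qed

lemma \<Phi>_mult: "\<lbrakk>x \<in> P; y \<in> P; a \<in> M\<rbrakk> \<Longrightarrow> \<Phi> (x o\<^sub>L y) a = \<Phi> x (\<Phi> y a)"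
  by (simp add: \<Phi>_compose compose_def)

lemma \<Phi>_diff: "\<lbrakk>x \<in> P; y \<in> P; a \<in> M\<rbrakk> \<Longrightarrow> \<Phi> (x - y) a = \<Phi> x a - \<Phi> y a"
  using \<Phi>_add [of "x - y" y a] P_diff by simp

lemma \<Phi>_zero: "a \<in> M \<Longrightarrow> \<Phi> 0 a = 0"
  using \<Phi>_diff [of 0 0 a] P_zero by simp

lemma \<Phi>_eqI:
  assumes "x \<in> P" "y \<in> P" "\<And>a. a \<in> M \<Longrightarrow> \<Phi> x a = \<Phi> y a"
  shows "x = y"
proof -
  have "\<Phi> x = \<Phi> y"
    by (rule PiE_ext [of _ M "\<lambda>_. M" _ ]) (use assms \<Phi>_L2_ops in \<open>auto simp: L2_ops_def\<close>)
  then show ?thesis using bij assms by (auto simp: bij_betw_def dest: inj_onD)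
qed

lemma \<Phi>_inner: "\<lbrakk>x \<in> P; a \<in> M; b \<in> M\<rbrakk> \<Longrightarrow>
   M.L2 (\<Phi> x a) b
     = cinner (blinfun_apply a \<Omega>) (blinfun_apply (\<Phi> (adj x) b) \<Omega>)"
  using \<Phi>_adj [of x a b] M.clinear \<Phi>_in P_adj by (simp add: L2_inner_eq)

text \<open>An operator on \<open>L\<^sup>2(M)\<close> that commutes with all left multiplications is the right multiplication by
  its value at the identity; commuting with the projection onto \<open>L\<^sup>2(N)\<close> forces that value into \<open>N\<close>.\<close>

lemma commutant_right_mult:
  assumes S: "S \<in> L2_commutant M (left_mult M ` M \<union> {L2_projection (vector_state \<Omega>) N M})"
  obtains s where "s \<in> N" "\<And>a. a \<in> M \<Longrightarrow> S a = a o\<^sub>L s"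
proof -
  have SM: "S a \<in> M" if "a \<in> M" for a using S that by (auto simp: L2_commutant_def L2_ops_def)
  have "S a = a o\<^sub>L S id_blinfun" if a: "a \<in> M" for a
  proof -
    have "compose M S (left_mult M a) id_blinfun = compose M (left_mult M a) S id_blinfun"
      using S a by (simp add: L2_commutant_def)
    then show ?thesis using M.id_in SM by (simp add: compose_def left_mult_def)
  qed
  moreover have "S id_blinfun \<in> N"
  proof -
    have "compose M S (L2_projection (vector_state \<Omega>) N M) id_blinfun
        = compose M (L2_projection (vector_state \<Omega>) N M) S id_blinfun"
      using S by (simp add: L2_commutant_def)
    then have "S (E id_blinfun) = E (S id_blinfun)"
      using M.id_in SM by (simp add: compose_def projection_eq)
    moreover have "E id_blinfun = id_blinfun" by (intro N.cexp_id N.id_in)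
    ultimately show ?thesis using N.cexp_in by metis
  qed
  ultimately show thesis using that by blast
qed

lemma E_right: "\<lbrakk>a \<in> M; n \<in> N\<rbrakk> \<Longrightarrow> E (a o\<^sub>L n) = E a o\<^sub>L n"
  by (rule N.cexp_right) (auto intro!: M.trace_inner NM')

lemma \<Phi>_right:
  assumes x: "x \<in> P" and a: "a \<in> M" and n: "n \<in> N"
  shows "\<Phi> x (a o\<^sub>L n) = \<Phi> x a o\<^sub>L n"
proof -
  let ?R = "\<lambda>a\<in>M. a o\<^sub>L n"
  have "?R \<in> L2_commutant M (left_mult M ` M \<union> {L2_projection (vector_state \<Omega>) N M})"
    using n NM' [OF n]
    by (auto simp: L2_commutant_def L2_ops_def left_mult_def compose_def fun_eq_iff compose_simps
        projection_eq E_right M.mult_in M.add_in M.scale_in)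
  then have "compose M (\<Phi> x) ?R = compose M ?R (\<Phi> x)"
    using \<Phi>_basic [OF x] by (simp add: basic_construction_def L2_commutant_def)
  then have "compose M (\<Phi> x) ?R a = compose M ?R (\<Phi> x) a" by simp
  then show ?thesis using a \<Phi>_in [OF x a] by (simp add: compose_def)
qed

text \<open>An operator commuting with the right action of \<open>N\<close> commutes with the commutant of \<open>M\<close> and the projection, which
  consists of right multiplications by \<open>N\<close>.\<close>

lemma \<Phi>_surj:
  assumes T: "T \<in> L2_ops M" and right: "\<And>a n. \<lbrakk>a \<in> M; n \<in> N\<rbrakk> \<Longrightarrow> T (a o\<^sub>L n) = T a o\<^sub>L n"
  obtains y where "y \<in> P" "\<Phi> y = T"
proof -
  have "T \<in> basic_construction (vector_state \<Omega>) N M"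
    unfolding basic_construction_def L2_commutant_def [of M "L2_commutant _ _"]
  proof (intro CollectI conjI ballI T)
    fix S assume S: "S \<in> L2_commutant M (left_mult M ` M \<union> {L2_projection (vector_state \<Omega>) N M})"
    then obtain s where s: "s \<in> N" "\<And>a. a \<in> M \<Longrightarrow> S a = a o\<^sub>L s" by (rule commutant_right_mult) blast
    have "T a \<in> M" if "a \<in> M" for a using T that by (auto simp: L2_ops_def)
    then show "compose M T S = compose M S T"
      using s right by (auto simp: compose_def fun_eq_iff)
  qed
  then have "T \<in> \<Phi> ` P" using bij by (simp add: bij_betw_def)
  then show thesis using that by blast
qed

lemma e_adj: "adj e = e"
proof (rule \<Phi>_eqI)
  fix a assume a: "a \<in> M"
  show "\<Phi> (adj e) a = \<Phi> e a"
  proof (rule M.inner_eqI)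
    fix b assume b: "b \<in> M"
    have "cinner (\<Phi> (adj e) a \<Omega>) (b \<Omega>) = cinner (a \<Omega>) (\<Phi> (adj (adj e)) b \<Omega>)"
      using a b by (intro \<Phi>_inner P_adj eP)
    also have "\<dots> = cinner (a \<Omega>) (E b \<Omega>)" using b eP P_clinear by (simp add: \<Phi>_e)
    also have "\<dots> = cinner (E a \<Omega>) (E b \<Omega>)" by (simp add: N.cexp_inner)
    also have "\<dots> = cinner (E a \<Omega>) (b \<Omega>)"
      by (metis N.cexp_in N.cexp_inner cinner_commute)
    finally show "cinner (\<Phi> (adj e) a \<Omega>) (b \<Omega>) = cinner (\<Phi> e a \<Omega>) (b \<Omega>)"
      using a by (simp add: \<Phi>_e)
  qed (use a eP in \<open>auto intro: \<Phi>_in P_adj\<close>)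
qed (use eP in \<open>auto intro: P_adj\<close>)

lemma e_idem: "e o\<^sub>L e = e"
  by (rule \<Phi>_eqI) (auto simp: \<Phi>_mult \<Phi>_e N.cexp_id eP intro: P_mult eP)

lemma e_commute: "n \<in> N \<Longrightarrow> n o\<^sub>L e = e o\<^sub>L n"
  by (rule \<Phi>_eqI)
    (auto simp: \<Phi>_mult \<Phi>_e \<Phi>_M N.cexp_left NM' MP' M.mult_in eP intro!: P_mult)

text \<open>Evaluating at \<open>b\<close>, both sides are \<open>\<Phi> x (a E b)\<close>, by right linearity of \<open>\<Phi> x\<close> over \<open>N\<close>.\<close>

lemma compose_e: "\<lbrakk>x \<in> P; a \<in> M\<rbrakk> \<Longrightarrow> x o\<^sub>L a o\<^sub>L e = \<Phi> x a o\<^sub>L e"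
proof (rule \<Phi>_eqI)
  fix b assume "x \<in> P" "a \<in> M" "b \<in> M"
  then show "\<Phi> (x o\<^sub>L a o\<^sub>L e) b = \<Phi> (\<Phi> x a o\<^sub>L e) b"
    by (simp add: \<Phi>_mult \<Phi>_e \<Phi>_M \<Phi>_right \<Phi>_in eP P_mult MP')
qed (auto intro: P_mult eP MP' \<Phi>_in)

lemma e_compress: "x \<in> M \<Longrightarrow> e o\<^sub>L x o\<^sub>L e = E x o\<^sub>L e"
  using compose_e [of e x] by (simp add: eP \<Phi>_e)

lemma compose_e_eq_0: "\<lbrakk>y \<in> M; y o\<^sub>L e = 0\<rbrakk> \<Longrightarrow> y = 0"
proof -
  assume y: "y \<in> M" and 0: "y o\<^sub>L e = 0"
  have "\<Phi> (y o\<^sub>L e) id_blinfun = y o\<^sub>L E id_blinfun"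
    using y by (simp add: \<Phi>_mult \<Phi>_e \<Phi>_M eP MP' M.id_in)
  then show "y = 0" using 0 by (simp add: N.cexp_id N.id_in \<Phi>_zero M.id_in)
qed

lemma e_compose_eq_0: "\<lbrakk>y \<in> M; e o\<^sub>L y = 0\<rbrakk> \<Longrightarrow> y = 0"
proof -
  assume y: "y \<in> M" and "e o\<^sub>L y = 0"
  then have "adj (e o\<^sub>L y) = 0" by simp
  then have "adj y o\<^sub>L e = 0" using y eP P_clinear M.clinear by (simp add: adj_compose e_adj)
  then have "adj y = 0" using y by (rule compose_e_eq_0 [OF M.adj_in, rotated])
  then show "y = 0" using adj_adj [OF M.clinear [OF y]] by simp
qed

text \<open>The translate by \<open>b = m\<^sup>*\<close> already gives \<open>tr (m\<^sup>* m) = 0\<close>.\<close>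

lemma E_left_mult_eq_0:
  assumes m: "m \<in> M" and "\<And>b. b \<in> M \<Longrightarrow> E (b o\<^sub>L m) = 0"
  shows "m = 0"
proof -
  have "E (adj m o\<^sub>L m) = 0" using m by (intro assms M.adj_in)
  then have "cinner ((adj m o\<^sub>L m) \<Omega>) \<Omega> = 0"
    using N.cexp_trace [of "adj m o\<^sub>L m"] by simp
  then have "m \<Omega> = 0" using m M.clinear by (simp add: cinner_adj_left)
  then show ?thesis using m by (intro M.separating)
qed

text \<open>The span \<open>M e M\<close> is a two-sided ideal of \<open>P\<close>, because \<open>x a e = \<Phi> x a e\<close>. An ideal has a unit, and
  the complement of the unit annihilates every vector of \<open>L\<^sup>2(M)\<close>. The ideal therefore is all of \<open>P\<close>.\<close>

lemma generated:
  assumes x: "x \<in> P"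
  shows "x \<in> op.span {a o\<^sub>L e o\<^sub>L b |a b. a \<in> M \<and> b \<in> M}"
proof -
  let ?S = "{a o\<^sub>L e o\<^sub>L b |a b. a \<in> M \<and> b \<in> M}"
  define I where "I = op.span ?S"
  have SP: "?S \<subseteq> P" by (auto intro: P_mult eP MP')
  then have IP: "I \<subseteq> P" unfolding I_def by (intro op.span_minimal alg_subspace P)
  have subI: "op.subspace I" by (simp add: I_def)
  obtain G where "orthonormal_basis M.L2 M G" by (rule M.L2_basis)
  note G = orthonormal_basisD(1,2) [OF this] and ex = orthonormal_basisD(5) [OF this]
  have GM: "g \<in> M" if "g \<in> G" for g using G that by auto
  define f where "f x y = (\<Sum>g\<in>G. M.L2 (\<Phi> x g) (\<Phi> y g))" for x y
  have form: "positive_form P f"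
  proof
    show "op.subspace P" by (rule alg_subspace [OF P])
    show "f (x + y) z = f x z + f y z" if "x \<in> P" "y \<in> P" "z \<in> P" for x y z
      using that GM by (simp add: f_def \<Phi>_add blinfun.add_left cinner_add_left sum.distrib)
    show "f (scalar_op c o\<^sub>L x) z = c * f x z" if "x \<in> P" "z \<in> P" for x z c
      using that GM by (simp add: f_def \<Phi>_scale cinner_scaleC_left sum_distrib_left)
    show "f y x = cnj (f x y)" for x y
      unfolding f_def cnj_sum by (intro sum.cong refl cinner_commute)
    show "0 \<le> Re (f x x)" for x
      by (simp add: f_def cinner_self sum_nonneg)
  qed
  have definite: "x = 0" if x: "x \<in> P" and "f x x = 0" for x
  proof -
    have "complex_of_real (\<Sum>g\<in>G. (norm (\<Phi> x g \<Omega>))\<^sup>2) = 0"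
      using that(2) by (simp add: f_def cinner_self)
    then have "\<Phi> x g \<Omega> = 0" if "g \<in> G" for g
      unfolding of_real_eq_0_iff using that G(1) by (simp add: sum_nonneg_eq_0_iff)
    then have 0: "\<Phi> x g = 0" if "g \<in> G" for g
      using that x by (intro M.separating \<Phi>_in GM) auto
    show ?thesis
    proof (rule \<Phi>_eqI)
      fix a assume a: "a \<in> M"
      have "\<Phi> x a = (\<Sum>g\<in>G. scalar_op (M.L2 a g) o\<^sub>L \<Phi> x g)"
        by (subst ex [OF a], rule \<Phi>_sum_right) (use x GM in auto)
      then show "\<Phi> x a = \<Phi> 0 a" using a 0 by (simp add: \<Phi>_zero)
    qed (use x P_zero in auto)
  qed
  have adjoint: "f (a o\<^sub>L x) y = f x (adj a o\<^sub>L y)" if "a \<in> P" "x \<in> P" "y \<in> P" for a x y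
    unfolding f_def using that GM
    by (intro sum.cong) (auto simp: \<Phi>_mult P_adj \<Phi>_in \<Phi>_inner)
  have left: "y o\<^sub>L z \<in> I" if y: "y \<in> P" and z: "z \<in> I" for y z
  proof -
    have "op.span ?S \<subseteq> {z. y o\<^sub>L z \<in> I}"
    proof (rule op.span_minimal)
      show "?S \<subseteq> {z. y o\<^sub>L z \<in> I}"
      proof clarify
        fix a b assume ab: "a \<in> M" "b \<in> M"
        have "y o\<^sub>L (a o\<^sub>L e o\<^sub>L b) = \<Phi> y a o\<^sub>L e o\<^sub>L b"
          using compose_e [OF y ab(1)] by (metis compose_assoc)
        then show "y o\<^sub>L (a o\<^sub>L e o\<^sub>L b) \<in> I"
          unfolding I_def using ab y \<Phi>_in by (intro op.span_base) blast
      qed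
      show "op.subspace {z. y o\<^sub>L z \<in> I}"
        using subI P_clinear [OF y]
        by (intro op.subspaceI)
          (auto simp: blinfun_compose.add_right op_scale_right
            intro: op.subspace_0 op.subspace_add op.subspace_scale)
    qed
    then show ?thesis using z unfolding I_def by blast
  qed
  have star: "adj z \<in> I" if z: "z \<in> I" for z
  proof -
    have "op.span ?S \<subseteq> {z \<in> P. adj z \<in> I}"
    proof (rule op.span_minimal)
      show "?S \<subseteq> {z \<in> P. adj z \<in> I}"
      proof clarify
        fix a b assume ab: "a \<in> M" "b \<in> M"
        have "adj (a o\<^sub>L e o\<^sub>L b) = adj b o\<^sub>L e o\<^sub>L adj a"
          using ab M.clinear P_clinear [OF eP]
          by (simp add: adj_compose clinear_ops_compose e_adj compose_assoc)
        moreover have "adj b o\<^sub>L e o\<^sub>L adj a \<in> I"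
          unfolding I_def using ab M.adj_in by (intro op.span_base) blast
        ultimately show "a o\<^sub>L e o\<^sub>L b \<in> P \<and> adj (a o\<^sub>L e o\<^sub>L b) \<in> I"
          using ab by (auto intro: P_mult eP MP')
      qed
      show "op.subspace {z \<in> P. adj z \<in> I}"
        using subI
        by (intro op.subspaceI)
          (auto simp: adj_add adj_scale P_clinear
            intro: op.subspace_0 op.subspace_add op.subspace_scale P_add P_scale P_zero)
    qed
    then show ?thesis using z unfolding I_def by blast
  qed
  obtain F where F: "finite F" "P \<subseteq> op.span F" by (rule finite_dim_span [OF fdP])
  obtain p where p: "p \<in> I" "\<forall>x\<in>I. x o\<^sub>L p = x" "adj p = p" "p o\<^sub>L p = p"
    by (rule ideal_unit [OF P form definite F adjoint IP subI left star])
  define q where "q = id_blinfun - p"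
  have qP: "q \<in> P" unfolding q_def using p IP by (intro P_diff P_id) auto
  have "q = 0"
  proof (rule \<Phi>_eqI [OF qP P_zero])
    fix c assume c: "c \<in> M"
    have m: "\<Phi> q c \<in> M" by (rule \<Phi>_in [OF qP c])
    have "\<Phi> q c = 0"
    proof (rule E_left_mult_eq_0 [OF m])
      fix b assume b: "b \<in> M"
      have "id_blinfun o\<^sub>L e o\<^sub>L b \<in> I"
        unfolding I_def using b M.id_in by (intro op.span_base) blast
      then have "(e o\<^sub>L b) o\<^sub>L q = 0"
        using p(2) by (simp add: q_def blinfun_compose.diff_right)
      then have "\<Phi> ((e o\<^sub>L b) o\<^sub>L q) c = 0" using c by (simp add: \<Phi>_zero)
      then show "E (b o\<^sub>L \<Phi> q c) = 0"
        using b c m qP by (simp add: \<Phi>_mult \<Phi>_e \<Phi>_M eP MP' P_mult M.mult_in)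
    qed
    then show "\<Phi> q c = \<Phi> 0 c" using c by (simp add: \<Phi>_zero)
  qed
  then have "x = x o\<^sub>L p" by (simp add: q_def)
  then show ?thesis using left [OF x p(1)] by (simp add: I_def)
qed

lemma generated_subset:
  assumes sub: "op.subspace W" and W: "\<And>a b. \<lbrakk>a \<in> M; b \<in> M\<rbrakk> \<Longrightarrow> a o\<^sub>L e o\<^sub>L b \<in> W"
  shows "P \<subseteq> W"
proof
  fix x assume "x \<in> P"
  then have "x \<in> op.span {a o\<^sub>L e o\<^sub>L b |a b. a \<in> M \<and> b \<in> M}" by (rule generated)
  also have "\<dots> \<subseteq> W" using W by (intro op.span_minimal sub) auto
  finally show "x \<in> W" .
qed

end

lemma is_basic_constructionE:
  assumes "is_basic_construction (vector_state \<Omega>) N M P e"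
    and "tracial_algebra M \<Omega>" "separated_algebra N \<Omega>" "star_subalgebra P" "finite_dim P"
  obtains \<Phi> where "basic_step N M P e \<Omega> \<Phi>"
proof -
  from assms(1) obtain \<Phi> where
    "bij_betw \<Phi> P (basic_construction (vector_state \<Omega>) N M)"
    "\<forall>x\<in>P. \<forall>y\<in>P. \<forall>a\<in>M. \<Phi> (x + y) a = \<Phi> x a + \<Phi> y a"
    "\<forall>c. \<forall>x\<in>P. \<forall>a\<in>M. \<Phi> (scalar_op c o\<^sub>L x) a = scalar_op c o\<^sub>L \<Phi> x a"
    "\<forall>x\<in>P. \<forall>y\<in>P. \<Phi> (x o\<^sub>L y) = compose M (\<Phi> x) (\<Phi> y)"
    "\<forall>x\<in>P. \<forall>a\<in>M. \<forall>b\<in>M. L2_inner (vector_state \<Omega>) (\<Phi> x a) b = L2_inner (vector_state \<Omega>) a (\<Phi> (adj x) b)"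
    "\<forall>x\<in>M. \<Phi> x = left_mult M x" "\<Phi> e = L2_projection (vector_state \<Omega>) N M"
    unfolding is_basic_construction_def by blast
  moreover have "N \<subseteq> M" "M \<subseteq> P" "e \<in> P"
    using assms(1) by (auto simp: is_basic_construction_def)
  ultimately have "basic_step N M P e \<Omega> \<Phi>"
    using assms(2-5)
    by (intro basic_step.intro basic_step_axioms.intro) (auto simp: tracial_algebra_def)
  then show thesis by (rule that)
qed

locale markov_step = basic_step +
  fixes \<tau> :: real
  assumes P_trace: "tracial_state P (vector_state \<Omega>)"
    and markov: "x \<in> M \<Longrightarrow>
      cinner (blinfun_apply x (blinfun_apply e \<Omega>)) \<Omega> = complex_of_real \<tau> * cinner (blinfun_apply x \<Omega>) \<Omega>"
begin

lemma trace_P: "\<lbrakk>x \<in> P; y \<in> P\<rbrakk> \<Longrightarrow> cinner (x (y \<Omega>)) \<Omega> = cinner (y (x \<Omega>)) \<Omega>"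
  using P_trace by (simp add: tracial_state_def vector_state_def)

lemma norm_\<Omega>: "norm \<Omega> = 1"
proof -
  have "complex_of_real ((norm \<Omega>)\<^sup>2) = complex_of_real 1"
    using P_trace by (simp add: tracial_state_def vector_state_def cinner_self)
  then show ?thesis unfolding of_real_eq_iff using norm_ge_zero [of \<Omega>] by (auto simp: power2_eq_1_iff)
qed

text \<open>With \<open>\<tau> = 0\<close> the trace would vanish on \<open>M e M\<close>, which spans \<open>P\<close>.\<close>

lemma \<tau>_pos: "\<tau> > 0"
proof -
  have "cinner (e \<Omega>) \<Omega> = complex_of_real \<tau>"
    using markov [OF M.id_in] by (simp add: cinner_self norm_\<Omega>)
  moreover have "cinner (e \<Omega>) \<Omega> = cinner (e \<Omega>) (e \<Omega>)"
  proof -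
    have "cinner (adj e (e \<Omega>)) \<Omega> = cinner (e \<Omega>) (e \<Omega>)" using P_clinear [OF eP] by (rule cinner_adj_left)
    moreover have "adj e (e \<Omega>) = e \<Omega>" using e_idem by (metis e_adj blinfun_apply_blinfun_compose)
    ultimately show ?thesis by simp
  qed
  ultimately have "complex_of_real \<tau> = complex_of_real ((norm (e \<Omega>))\<^sup>2)" by (simp add: cinner_self)
  then have "\<tau> \<ge> 0" unfolding of_real_eq_iff by simp
  moreover have "\<tau> \<noteq> 0"
  proof
    assume "\<tau> = 0"
    have "P \<subseteq> {x. cinner (blinfun_apply x \<Omega>) \<Omega> = 0}"
    proof (rule generated_subset)
      show "op.subspace {x. cinner (blinfun_apply x \<Omega>) \<Omega> = 0}"
        by (rule op.subspaceI) (auto simp: blinfun.add_left cinner_add_left cinner_scaleC_left)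
      fix a b assume ab: "a \<in> M" "b \<in> M"
      have "cinner ((a o\<^sub>L e) (b \<Omega>)) \<Omega> = cinner (b ((a o\<^sub>L e) \<Omega>)) \<Omega>"
        using ab by (intro trace_P P_mult MP' eP)
      also have "\<dots> = 0"
        using markov [OF M.mult_in [OF ab(2,1)]] \<open>\<tau> = 0\<close> by simp
      finally show "a o\<^sub>L e o\<^sub>L b \<in> {x. cinner (blinfun_apply x \<Omega>) \<Omega> = 0}" by simp
    qed
    then have "cinner (id_blinfun \<Omega>) \<Omega> = 0" using P_id by blast
    then show False using norm_\<Omega> by (auto simp: cinner_self)
  qed
  ultimately show ?thesis by simp
qed

lemma inner_e: "\<lbrakk>x \<in> M; y \<in> M\<rbrakk> \<Longrightarrow> cinner (x (e \<Omega>)) (y \<Omega>) = complex_of_real \<tau> * cinner (x \<Omega>) (y \<Omega>)"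
  using markov [of "adj y o\<^sub>L x"] M.mult_in M.adj_in M.clinear by (simp add: cinner_adj_left)

lemma inner_e_e:
  assumes "x \<in> M" "y \<in> M"
  shows "cinner (x (e \<Omega>)) (y (e \<Omega>)) = complex_of_real \<tau> * cinner (x \<Omega>) (y \<Omega>)"
proof -
  have "cinner (x (e \<Omega>)) (y (e \<Omega>)) = cinner ((e o\<^sub>L (adj y o\<^sub>L x o\<^sub>L e)) \<Omega>) \<Omega>"
    using assms M.clinear cinner_adj_left [OF P_clinear [OF eP]] e_adj by (simp add: cinner_adj_left)
  also have "\<dots> = cinner ((adj y o\<^sub>L x o\<^sub>L e) (e \<Omega>)) \<Omega>"
    unfolding blinfun_apply_blinfun_compose [of e]
    using assms by (intro trace_P P_mult MP' eP M.adj_in)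
  also have "(adj y o\<^sub>L x o\<^sub>L e) (e \<Omega>) = (adj y o\<^sub>L x) (e \<Omega>)"
    using e_idem by (metis blinfun_apply_blinfun_compose)
  also have "cinner \<dots> \<Omega> = complex_of_real \<tau> * cinner (x \<Omega>) (y \<Omega>)"
    using inner_e [OF assms] assms M.clinear by (simp add: cinner_adj_left)
  finally show ?thesis .
qed

text \<open>A nonzero null ideal of the trace would contain a nonzero element of \<open>e P e = N e\<close>. However,
  \<open>tr ((n e)\<^sup>* n e) = \<tau> tr (n\<^sup>* n)\<close> for \<open>n \<in> N\<close>.\<close>

lemma separating_P:
  assumes x: "x \<in> P" and x0: "x \<Omega> = 0"
  shows "x = 0"
proof -
  have star: "cinner (adj y \<Omega>) (adj y \<Omega>) = cinner (y \<Omega>) (y \<Omega>)" if y: "y \<in> P" for y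
  proof -
    have "cinner (adj y \<Omega>) (adj y \<Omega>) = cinner (y (adj y \<Omega>)) \<Omega>"
      using P_clinear [OF y] by (simp add: cinner_adj_right)
    also have "\<dots> = cinner (adj y (y \<Omega>)) \<Omega>" using y by (intro trace_P P_adj)
    also have "\<dots> = cinner (y \<Omega>) (y \<Omega>)" using P_clinear [OF y] by (rule cinner_adj_left)
    finally show ?thesis .
  qed
  have null: "x (z \<Omega>) = 0" if z: "z \<in> P" for z
  proof -
    have "adj x \<Omega> = 0" using star [OF x] x0 by simp
    then have "adj (x o\<^sub>L z) \<Omega> = 0" using x z P_clinear by (simp add: adj_compose)
    then show ?thesis using star [OF P_mult [OF x z]] by simp
  qed
  show ?thesis
  proof (rule \<Phi>_eqI [OF x P_zero])
    fix c assume c: "c \<in> M"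
    have m: "\<Phi> x c \<in> M" by (rule \<Phi>_in [OF x c])
    have "\<Phi> x c = 0"
    proof (rule E_left_mult_eq_0 [OF m])
      fix b assume b: "b \<in> M"
      let ?n = "E (b o\<^sub>L \<Phi> x c)"
      have "?n o\<^sub>L e = e o\<^sub>L b o\<^sub>L (x o\<^sub>L c o\<^sub>L e)"
        using compose_e [OF x c] e_compress [OF M.mult_in [OF b m]] by (simp add: compose_assoc)
      moreover have "x ((c o\<^sub>L e) \<Omega>) = 0" using c by (intro null P_mult MP' eP)
      moreover have "?n (e \<Omega>) = (?n o\<^sub>L e) \<Omega>" by simp
      ultimately have "?n (e \<Omega>) = 0" by simp
      then have "cinner (?n \<Omega>) (?n \<Omega>) = 0"
        using inner_e_e [of ?n ?n] \<tau>_pos by simp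
      then show "?n = 0" using N.separating [OF N.cexp_in] by simp
    qed
    then show "\<Phi> x c = \<Phi> 0 c" using c by (simp add: \<Phi>_zero)
  qed
qed

lemma tracial_P: "tracial_algebra P \<Omega>"
  by unfold_locales (use P fdP separating_P trace_P in auto)

end

section \<open>The Jones tower and its strong closure\<close>

lemma bounded_linear_cinner_right: "bounded_linear (cinner v)"
proof (rule bounded_linear_intro)
  show "cinner v (r *\<^sub>R x) = r *\<^sub>R cinner v x" for r x
    by (simp add: scaleC_of_real [symmetric] cinner_scaleC_right scaleR_conv_of_real)
  show "norm (cinner v x) \<le> norm x * norm v" for x
    using norm_cinner_le [of v x] by (simp add: mult.commute)
qed (rule cinner_add_right)

lemma bounded_linear_cinner_left: "bounded_linear (\<lambda>v. cinner v w)"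
proof (rule bounded_linear_intro)
  show "cinner (r *\<^sub>R x) w = r *\<^sub>R cinner x w" for r x
    by (simp add: scaleC_of_real [symmetric] cinner_scaleC_left scaleR_conv_of_real)
  show "norm (cinner x w) \<le> norm x * norm w" for x
    by (rule norm_cinner_le)
qed (rule cinner_add_left)


lemmas scaleC_diff_right = linear_diff [OF bounded_linear.linear [OF bounded_linear_scaleC]]

locale markov_tower =
  fixes B :: "nat \<Rightarrow> 'h::complex_hilbert_space operator set"
    and e :: "nat \<Rightarrow> 'h operator" and \<Omega> :: 'h and \<tau> :: real
  assumes jones: "jones_tower (vector_state \<Omega>) B e"
    and markov_tr: "markov_trace \<tau> (vector_state \<Omega>) B e"
    and cyclic: "cyclic_vector (\<Union>i. B i) \<Omega>"
begin

text \<open>Indexed so that \<open>jp i\<close> implements the expectation onto \<open>B i\<close>.\<close>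

abbreviation jp :: "nat \<Rightarrow> 'h operator" where
  "jp i \<equiv> e (Suc (Suc i))"

lemma B_alg: "star_subalgebra (B i)" and B_fd: "finite_dim (B i)" and B_Suc: "B i \<subseteq> B (Suc i)"
  using jones by (auto simp: jones_tower_def von_neumann_algebra_def)

lemma B_mono: "\<lbrakk>x \<in> B i; i \<le> j\<rbrakk> \<Longrightarrow> x \<in> B j"
  using lift_Suc_mono_le [of B i j] B_Suc by blast

lemma B_basic: "is_basic_construction (vector_state \<Omega>) (B i) (B (Suc i)) (B (Suc (Suc i))) (jp i)"
proof -
  have "\<forall>i\<ge>2. is_basic_construction (vector_state \<Omega>) (B (i - 2)) (B (i - 1)) (B i) (e i)"
    using jones by (simp add: jones_tower_def)
  from spec [OF this, of "Suc (Suc i)"] show ?thesis by simp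
qed

lemma B_state: "tracial_state (B i) (vector_state \<Omega>)"
  using markov_tr by (simp add: markov_trace_def)

lemma B_trace: "\<lbrakk>x \<in> B i; y \<in> B i\<rbrakk> \<Longrightarrow> cinner (x (y \<Omega>)) \<Omega> = cinner (y (x \<Omega>)) \<Omega>"
  using B_state [of i] by (simp add: tracial_state_def vector_state_def)

lemma B_markov: "x \<in> B (Suc i) \<Longrightarrow> cinner (x (jp i \<Omega>)) \<Omega> = complex_of_real \<tau> * cinner (x \<Omega>) \<Omega>"
proof -
  assume x: "x \<in> B (Suc i)"
  have "\<forall>i\<ge>2. \<forall>x\<in>B (i - 1). vector_state \<Omega> (x o\<^sub>L e i) = complex_of_real \<tau> * vector_state \<Omega> x"
    using markov_tr by (simp add: markov_trace_def)
  from spec [OF this, of "Suc (Suc i)"] show ?thesis using x by (simp add: vector_state_def)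
qed

lemma markov_step_exists:
  assumes "tracial_algebra (B (Suc i)) \<Omega>" "separated_algebra (B i) \<Omega>"
  shows "\<exists>\<Phi>. markov_step (B i) (B (Suc i)) (B (Suc (Suc i))) (jp i) \<Omega> \<Phi> \<tau>"
proof -
  obtain \<Phi> where "basic_step (B i) (B (Suc i)) (B (Suc (Suc i))) (jp i) \<Omega> \<Phi>"
    using is_basic_constructionE [OF B_basic assms B_alg B_fd] by blast
  then have "markov_step (B i) (B (Suc i)) (B (Suc (Suc i))) (jp i) \<Omega> \<Phi> \<tau>"
    by (intro markov_step.intro markov_step_axioms.intro B_state B_markov)
  then show ?thesis by blast
qed

text \<open>Two consecutive levels are carried through the induction because the basic construction needs both.\<close>

lemma B_tracial_pair: "tracial_algebra (B i) \<Omega> \<and> tracial_algebra (B (Suc i)) \<Omega>"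
proof (induction i)
  case 0
  have sep1: "x = 0" if x: "x \<in> B 1" and "x \<Omega> = 0" for x
  proof -
    have "vector_state \<Omega> (adj x o\<^sub>L x) = cinner (x \<Omega>) (x \<Omega>)"
      using alg_clinear [OF B_alg x] by (simp add: vector_state_def cinner_adj_left)
    then show ?thesis
      using that markov_tr by (auto simp: markov_trace_def faithful_on_def)
  qed
  have "tracial_algebra (B 1) \<Omega>" "tracial_algebra (B 0) \<Omega>"
    using sep1 B_mono [of _ 0 1] by unfold_locales (auto intro: B_alg B_fd B_trace)
  then show ?case by simp
next
  case (Suc i)
  then obtain \<Phi> where "markov_step (B i) (B (Suc i)) (B (Suc (Suc i))) (jp i) \<Omega> \<Phi> \<tau>"
    using markov_step_exists tracial_algebra.axioms(1) by blast
  then have "tracial_algebra (B (Suc (Suc i))) \<Omega>" by (rule markov_step.tracial_P)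
  then show ?case using Suc by blast
qed

sublocale A: tracial_algebra "B i" \<Omega> for i
  using B_tracial_pair by blast

definition rep :: "nat \<Rightarrow> 'h operator \<Rightarrow> 'h operator \<Rightarrow> 'h operator" where
  "rep i = (SOME \<Phi>. markov_step (B i) (B (Suc i)) (B (Suc (Suc i))) (jp i) \<Omega> \<Phi> \<tau>)"

lemma rep: "markov_step (B i) (B (Suc i)) (B (Suc (Suc i))) (jp i) \<Omega> (rep i) \<tau>"
  unfolding rep_def
  by (rule someI_ex [OF markov_step_exists [OF A.tracial_algebra_axioms A.separated_algebra_axioms]])

sublocale step: markov_step "B i" "B (Suc i)" "B (Suc (Suc i))" "jp i" \<Omega> "rep i" \<tau> for i
  by (rule rep)

abbreviation E :: "nat \<Rightarrow> 'h operator \<Rightarrow> 'h operator" where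
  "E i \<equiv> cexp \<Omega> (B i)"

abbreviation trace :: "'h operator \<Rightarrow> complex" where
  "trace x \<equiv> cinner (blinfun_apply x \<Omega>) \<Omega>"

lemma jp_in: "jp i \<in> B (Suc (Suc i))"
  by (rule step.eP)

lemma E_E: "i \<le> j \<Longrightarrow> E i (E j T) = E i T"
  by (rule A.cexp_unique) (auto simp: A.cexp_inner B_mono)

lemma E_jp: "E (Suc i) (jp i) = scalar_op (complex_of_real \<tau>)"
proof (rule A.cexp_unique)
  let ?t = "complex_of_real \<tau>"
  show "scalar_op ?t \<in> B (Suc i)" using A.scale_in [OF A.id_in, of ?t] by simp
  fix a assume a: "a \<in> B (Suc i)"
  have "cinner (id_blinfun (jp i \<Omega>)) (a \<Omega>) = ?t * cinner (id_blinfun \<Omega>) (a \<Omega>)"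
    using a by (intro step.inner_e A.id_in)
  then show "cinner (jp i \<Omega>) (a \<Omega>) = cinner (scalar_op ?t \<Omega>) (a \<Omega>)"
    by (simp add: cinner_scaleC_left)
qed

text \<open>The companion relation \<open>q p q = \<tau> q\<close>, for \<open>p = jp i\<close> and \<open>q = jp (i + 1)\<close>, is the compression formula for \<open>q\<close>.
  It makes \<open>p q p / \<tau>\<close> a projection under \<open>p\<close>. Both have trace \<open>\<tau>\<close>, and the trace is faithful.\<close>

lemma jp_braid: "jp i o\<^sub>L jp (Suc i) o\<^sub>L jp i = scalar_op (complex_of_real \<tau>) o\<^sub>L jp i"
proof -
  let ?p = "jp i" and ?q = "jp (Suc i)" and ?t = "complex_of_real \<tau>"
  let ?k = "Suc (Suc (Suc i))"
  have \<tau>: "\<tau> > 0" by (rule step.\<tau>_pos)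
  have p: "?p \<in> B ?k" and q: "?q \<in> B ?k" using jp_in [of i] jp_in [of "Suc i"] B_Suc by auto
  have cl: "?p \<in> clinear_ops" "?q \<in> clinear_ops" using p q A.clinear by auto
  have qpq: "?q o\<^sub>L ?p o\<^sub>L ?q = scalar_op ?t o\<^sub>L ?q"
    using step.e_compress [OF jp_in] by (simp add: E_jp)
  define x where "x = (scalar_op ?t o\<^sub>L ?p) - (?p o\<^sub>L ?q o\<^sub>L ?p)"
  have x: "x \<in> B ?k" unfolding x_def using p q by (intro A.diff_in A.scale_in A.mult_in)
  have pp: "?p (?p v) = ?p v" for v using step.e_idem [of i] by (metis blinfun_apply_blinfun_compose)
  have qq: "?q (?q v) = ?q v" for v using step.e_idem [of "Suc i"] by (metis blinfun_apply_blinfun_compose)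
  have qpq': "?q (?p (?q v)) = ?t *\<^sub>C ?q v" for v
    using arg_cong [OF qpq, of "\<lambda>T. blinfun_apply T v"] by simp
  have pqpqp: "?p (?q (?p (?q (?p v)))) = ?t *\<^sub>C ?p (?q (?p v))" for v
    by (simp add: qpq' clinear_opsD [OF cl(1)])
  have adjp: "cinner (?p v) w = cinner v (?p w)" for v w
    using cinner_adj_left [OF cl(1), of v w] by (simp add: step.e_adj)
  have adjq: "cinner (?q v) w = cinner v (?q w)" for v w
    using cinner_adj_left [OF cl(2), of v w] by (simp add: step.e_adj)
  have tp: "cinner (?p \<Omega>) \<Omega> = ?t"
    using B_markov [OF A.id_in, of i] step.norm_\<Omega> by (simp add: cinner_self)
  have tpqp: "cinner (?p (?q (?p \<Omega>))) \<Omega> = ?t * ?t"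
  proof -
    have "cinner (?p ((?q o\<^sub>L ?p) \<Omega>)) \<Omega> = cinner ((?q o\<^sub>L ?p) (?p \<Omega>)) \<Omega>"
      using p q by (intro B_trace A.mult_in)
    also have "\<dots> = cinner (?q (?p \<Omega>)) \<Omega>" by (simp add: pp)
    also have "\<dots> = cinner (?p (?q \<Omega>)) \<Omega>" by (rule B_trace [OF q p])
    also have "\<dots> = ?t * ?t"
      using B_markov [OF jp_in, of i] tp by simp
    finally show ?thesis by simp
  qed
  have "cinner (x \<Omega>) (x \<Omega>) = 0"
  proof -
    have "cinner (x v) w = cinner v (x w)" for v w
      by (simp add: x_def blinfun.diff_left cinner_diff_left cinner_diff_right
          cinner_scaleC_left cinner_scaleC_right adjp adjq)
    then have "cinner (x \<Omega>) (x \<Omega>) = cinner (x (x \<Omega>)) \<Omega>" by simp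
    also have "x (x \<Omega>) = ?t *\<^sub>C x \<Omega>"
      by (simp add: x_def blinfun.diff_left blinfun.diff_right pp pqpqp clinear_opsD [OF cl(1)]
          clinear_opsD [OF cl(2)] scaleC_scaleC scaleC_diff_right)
    also have "cinner (?t *\<^sub>C x \<Omega>) \<Omega> = 0"
      by (simp add: x_def cinner_scaleC_left blinfun.diff_left cinner_diff_left tp tpqp)
    finally show ?thesis .
  qed
  then have "x = 0" using A.separating [OF x] by simp
  then show ?thesis by (simp add: x_def)
qed

subsection \<open>Operators in the strong closure\<close>

abbreviation U :: "'h operator set" where
  "U \<equiv> \<Union>i. B i"

abbreviation B_inf :: "'h operator set" where
  "B_inf \<equiv> tower_closure B"

lemma U_pair:
  assumes "x \<in> U" "y \<in> U"
  obtains i where "x \<in> B i" "y \<in> B i"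
  using assms B_mono by (metis UN_E nat_le_linear)

lemma U_clinear: "x \<in> U \<Longrightarrow> x \<in> clinear_ops"
  and U_adj: "x \<in> U \<Longrightarrow> adj x \<in> U"
  using A.clinear A.adj_in by blast+

lemma U_mult: "\<lbrakk>x \<in> U; y \<in> U\<rbrakk> \<Longrightarrow> x o\<^sub>L y \<in> U"
  and U_diff: "\<lbrakk>x \<in> U; y \<in> U\<rbrakk> \<Longrightarrow> x - y \<in> U"
  by (erule (1) U_pair, blast intro: A.mult_in A.diff_in)+

lemma U_B_inf: "x \<in> U \<Longrightarrow> x \<in> B_inf"
  unfolding tower_closure_def
  using closure_of_subset [of U strong_operator_topology] strong_operator_topology_topspace by blast

lemma evaluation_continuous: "continuous_map strong_operator_topology euclidean (\<lambda>T. blinfun_apply T v)"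
  by (rule strong_operator_topology_continuous_evaluation)

text \<open>Multiplication of operators is not jointly continuous in the strong topology. All that follows about the closure
  uses conditions and maps that are linear in one operator, the other factors being in the tower.\<close>

lemma B_inf_closed_condition:
  fixes h :: "'h operator \<Rightarrow> 'b::real_normed_vector"
  assumes h: "continuous_map strong_operator_topology euclidean h"
    and 0: "\<And>x. x \<in> U \<Longrightarrow> h x = 0" and T: "T \<in> B_inf"
  shows "h T = 0"
proof -
  have "closedin strong_operator_topology {x \<in> topspace strong_operator_topology. h x \<in> {0}}"
    by (rule closedin_continuous_map_preimage [OF h]) simp
  then have "closedin strong_operator_topology {x. h x = 0}"
    by (simp add: strong_operator_topology_topspace)
  then have "strong_operator_topology closure_of U \<subseteq> {x. h x = 0}"
    using 0 by (intro closure_of_minimal) auto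
  then show ?thesis using T unfolding tower_closure_def by auto
qed

lemma B_inf_image:
  assumes "continuous_map strong_operator_topology strong_operator_topology g"
    and "\<And>x. x \<in> U \<Longrightarrow> g x \<in> B_inf" and "T \<in> B_inf"
  shows "g T \<in> B_inf"
proof -
  have "g ` (strong_operator_topology closure_of U) \<subseteq> strong_operator_topology closure_of (g ` U)"
    using assms(1) by (intro continuous_map_image_closure_subset)
  also have "\<dots> \<subseteq> strong_operator_topology closure_of B_inf"
    using assms(2) by (intro closure_of_mono) auto
  also have "\<dots> = B_inf" by (simp add: tower_closure_def)
  finally show ?thesis using assms(3) by (auto simp: tower_closure_def)
qed

lemma continuous_map_bounded_linear:
  assumes "bounded_linear f"
  shows "continuous_map strong_operator_topology euclidean (\<lambda>T. f (blinfun_apply T v))"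
proof -
  have "continuous_map euclidean euclidean f"
    using assms linear_continuous_on by auto
  from continuous_map_compose [OF evaluation_continuous this] show ?thesis
    by (simp add: o_def)
qed

lemma B_inf_left: "\<lbrakk>y \<in> U; T \<in> B_inf\<rbrakk> \<Longrightarrow> y o\<^sub>L T \<in> B_inf"
  by (rule B_inf_image)
    (auto simp: continuous_on_strong_operator_topo_iff_coordinatewise
      intro: continuous_map_bounded_linear blinfun.bounded_linear_right U_B_inf U_mult)

lemma B_inf_right: "\<lbrakk>y \<in> U; T \<in> B_inf\<rbrakk> \<Longrightarrow> T o\<^sub>L y \<in> B_inf"
  by (rule B_inf_image)
    (auto simp: continuous_on_strong_operator_topo_iff_coordinatewise
      intro: evaluation_continuous U_B_inf U_mult)

lemma B_inf_diff: "\<lbrakk>S \<in> B_inf; T \<in> B_inf\<rbrakk> \<Longrightarrow> S - T \<in> B_inf"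
proof -
  assume S: "S \<in> B_inf" and T: "T \<in> B_inf"
  have cont_right: "continuous_map strong_operator_topology strong_operator_topology (\<lambda>X. Y - X)"
    and cont_left: "continuous_map strong_operator_topology strong_operator_topology (\<lambda>X. X - Y)"
    for Y :: "'h operator"
    unfolding continuous_on_strong_operator_topo_iff_coordinatewise blinfun.diff_left
    by (intro allI continuous_map_diff evaluation_continuous continuous_map_const [THEN iffD2], simp)+
  have "y - T \<in> B_inf" if "y \<in> U" for y
    by (rule B_inf_image [OF cont_right _ T]) (intro U_B_inf U_diff that)
  then show ?thesis
    by (rule B_inf_image [OF cont_left _ S])
qed

lemma B_inf_trace:
  assumes T: "T \<in> B_inf" and y: "y \<in> U"
  shows "cinner (T (y \<Omega>)) \<Omega> = cinner (y (T \<Omega>)) \<Omega>"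
proof -
  have "bounded_linear (\<lambda>w. cinner (blinfun_apply y w) \<Omega>)"
    by (rule bounded_linear_compose [OF bounded_linear_cinner_left blinfun.bounded_linear_right])
  then have "continuous_map strong_operator_topology euclidean
      (\<lambda>T. cinner (blinfun_apply T (y \<Omega>)) \<Omega> - cinner (blinfun_apply y (blinfun_apply T \<Omega>)) \<Omega>)"
    by (intro continuous_map_diff continuous_map_bounded_linear [OF bounded_linear_cinner_left]
        continuous_map_bounded_linear [of "\<lambda>w. cinner (blinfun_apply y w) \<Omega>"])
  moreover have "cinner (x (y \<Omega>)) \<Omega> - cinner (y (x \<Omega>)) \<Omega> = 0" if "x \<in> U" for x
    using U_pair [OF that y] B_trace by (metis right_minus_eq)
  ultimately have "cinner (T (y \<Omega>)) \<Omega> - cinner (y (T \<Omega>)) \<Omega> = 0"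
    by (rule B_inf_closed_condition [OF _ _ T])
  then show ?thesis by simp
qed

lemma B_inf_trace_inner:
  assumes T: "T \<in> B_inf" and b: "b \<in> U" and y: "y \<in> U"
  shows "cinner (T (b \<Omega>)) (y \<Omega>) = cinner (T \<Omega>) (y (adj b \<Omega>))"
proof -
  have "cinner (T (b \<Omega>)) (y \<Omega>) = cinner ((adj y o\<^sub>L T) (b \<Omega>)) \<Omega>"
    using cinner_adj_left [OF U_clinear [OF y]] by simp
  also have "\<dots> = cinner (b ((adj y o\<^sub>L T) \<Omega>)) \<Omega>"
    by (intro B_inf_trace B_inf_left U_adj y T b)
  also have "\<dots> = cinner (T \<Omega>) (y (adj b \<Omega>))"
    using cinner_adj_left [OF U_clinear [OF y]] cinner_adj_right [OF U_clinear [OF b], symmetric] by simp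
  finally show ?thesis .
qed

text \<open>The expectation onto \<open>B i\<close> is a bimodule map on the whole closure, because the trace property survives when
  one of the two factors is a limit.\<close>

lemma E_right: "\<lbrakk>T \<in> B_inf; b \<in> B i\<rbrakk> \<Longrightarrow> E i (T o\<^sub>L b) = E i T o\<^sub>L b"
  by (rule A.cexp_right) (auto intro!: B_inf_trace_inner)

text \<open>Cyclicity says that the vectors \<open>y \<Omega>\<close> with \<open>y\<close> in the tower are dense.\<close>

lemma orthogonal_U:
  assumes "\<And>y. y \<in> U \<Longrightarrow> cinner v (blinfun_apply y \<Omega>) = 0"
  shows "v = 0"
proof -
  have "closed {w. cinner v w = 0}"
    by (intro closed_Collect_eq continuous_on_const linear_continuous_on bounded_linear_cinner_right)
  then have "closure ((\<lambda>x. blinfun_apply x \<Omega>) ` U) \<subseteq> {w. cinner v w = 0}"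
    using assms by (intro closure_minimal) auto
  then have "v \<in> {w. cinner v w = 0}" using cyclic unfolding cyclic_vector_def by blast
  then show ?thesis by simp
qed

text \<open>By the trace property \<open>T y \<Omega>\<close> and \<open>z \<Omega>\<close> have the same inner product as \<open>T \<Omega>\<close> and \<open>z y\<^sup>* \<Omega>\<close>.\<close>

lemma separating_B_inf:
  assumes T: "T \<in> B_inf" and 0: "T \<Omega> = 0"
  shows "T = 0"
proof (rule blinfun_eqI)
  fix v
  have "T (y \<Omega>) = 0" if y: "y \<in> U" for y
  proof (rule orthogonal_U)
    fix z assume "z \<in> U"
    then show "cinner (T (y \<Omega>)) (z \<Omega>) = 0" using B_inf_trace_inner [OF T y] 0 by simp
  qed
  moreover have "closed {v. blinfun_apply T v = 0}"
    by (intro closed_Collect_eq continuous_intros)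
  ultimately have "closure ((\<lambda>x. blinfun_apply x \<Omega>) ` U) \<subseteq> {v. blinfun_apply T v = 0}"
    by (intro closure_minimal) auto
  then show "T v = blinfun_apply 0 v" using cyclic unfolding cyclic_vector_def by auto
qed

end

section \<open>Implementing elements of an automorphism of the tower\<close>

locale tower_automorphism = markov_tower B e \<Omega> \<tau>
  for B :: "nat \<Rightarrow> 'h::complex_hilbert_space operator set"
    and e :: "nat \<Rightarrow> 'h operator" and \<Omega> :: 'h and \<tau> :: real +
  fixes \<theta> :: "'h operator \<Rightarrow> 'h operator"
  assumes \<theta>_image: "\<theta> ` B i = B i"
    and \<theta>_add: "\<lbrakk>x \<in> B i; y \<in> B i\<rbrakk> \<Longrightarrow> \<theta> (x + y) = \<theta> x + \<theta> y"
    and \<theta>_mult: "\<lbrakk>x \<in> B i; y \<in> B i\<rbrakk> \<Longrightarrow> \<theta> (x o\<^sub>L y) = \<theta> x o\<^sub>L \<theta> y"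
    and \<theta>_scale: "x \<in> B i \<Longrightarrow> \<theta> (scalar_op c o\<^sub>L x) = scalar_op c o\<^sub>L \<theta> x"
    and \<theta>_adj: "x \<in> B i \<Longrightarrow> \<theta> (adj x) = adj (\<theta> x)"
    and \<theta>_trace: "x \<in> B i \<Longrightarrow> trace (\<theta> x) = trace x"
    and \<theta>_jp: "\<theta> (jp i) = jp i"
begin

lemma \<theta>_in [simp]: "x \<in> B i \<Longrightarrow> \<theta> x \<in> B i"
  using \<theta>_image by blast

lemma \<theta>_surj: assumes "y \<in> B i" obtains x where "x \<in> B i" "y = \<theta> x"
  using assms \<theta>_image by blast

lemma \<theta>_inner: "\<lbrakk>x \<in> B i; y \<in> B i\<rbrakk> \<Longrightarrow> cinner (\<theta> x \<Omega>) (\<theta> y \<Omega>) = cinner (x \<Omega>) (y \<Omega>)"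
proof -
  assume x: "x \<in> B i" and y: "y \<in> B i"
  have "cinner (\<theta> x \<Omega>) (\<theta> y \<Omega>) = trace (\<theta> (adj y o\<^sub>L x))"
    using cinner_adj_left [OF A.clinear [OF \<theta>_in [OF y]]]
    by (simp add: \<theta>_mult [OF A.adj_in [OF y] x] \<theta>_adj [OF y])
  also have "\<dots> = trace (adj y o\<^sub>L x)" using x y by (intro \<theta>_trace A.mult_in A.adj_in)
  also have "\<dots> = cinner (x \<Omega>) (y \<Omega>)" using A.clinear [OF y] by (simp add: cinner_adj_left)
  finally show ?thesis .
qed

text \<open>An automorphism that preserves the trace and the subalgebra preserves the orthogonal projection onto it.\<close>

lemma \<theta>_E: assumes x: "x \<in> B j" and "i \<le> j" shows "E i (\<theta> x) = \<theta> (E i x)"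
proof (rule A.cexp_unique)
  fix a assume "a \<in> B i"
  then obtain b where b: "b \<in> B i" "a = \<theta> b" by (rule \<theta>_surj)
  have bj: "b \<in> B j" and Ej: "E i x \<in> B j" using b(1) \<open>i \<le> j\<close> B_mono A.cexp_in by blast+
  have "cinner (\<theta> x \<Omega>) (a \<Omega>) = cinner (x \<Omega>) (b \<Omega>)" unfolding b by (rule \<theta>_inner [OF x bj])
  also have "\<dots> = cinner (E i x \<Omega>) (b \<Omega>)" by (rule A.cexp_inner [OF b(1), symmetric])
  also have "\<dots> = cinner (\<theta> (E i x) \<Omega>) (a \<Omega>)" unfolding b by (rule \<theta>_inner [OF Ej bj, symmetric])
  finally show "cinner (\<theta> x \<Omega>) (a \<Omega>) = cinner (\<theta> (E i x) \<Omega>) (a \<Omega>)" .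
qed simp

lemma \<theta>_jp_between:
  assumes "a \<in> B (Suc (Suc i))" "b \<in> B (Suc (Suc i))"
  shows "\<theta> (a o\<^sub>L jp i o\<^sub>L b) = \<theta> a o\<^sub>L jp i o\<^sub>L \<theta> b"
  using \<theta>_mult [OF A.mult_in [OF assms(1) jp_in] assms(2)] \<theta>_mult [OF assms(1) jp_in]
  by (simp add: \<theta>_jp)

text \<open>A unitary of \<open>B 0\<close> commutes with all Jones projections, so \<open>Ad u\<close> fixes them as \<open>\<theta>\<close> does.\<close>

lemma implemented_climbs:
  assumes u: "u \<in> B 0" "unitary_op u" and 1: "\<And>x. x \<in> B 1 \<Longrightarrow> \<theta> x = Ad u x"
  shows "x \<in> U \<Longrightarrow> \<theta> x = Ad u x"
proof -
  have uu: "adj u o\<^sub>L u = id_blinfun" and u_cl: "u \<in> clinear_ops"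
    using u(2) by (auto simp: unitary_op_def)
  have Ad_mult: "Ad u x o\<^sub>L Ad u y = Ad u (x o\<^sub>L y)" for x y
  proof -
    have "Ad u x o\<^sub>L Ad u y = u o\<^sub>L x o\<^sub>L (adj u o\<^sub>L u) o\<^sub>L y o\<^sub>L adj u"
      unfolding Ad_def compose_assoc ..
    then show ?thesis by (simp add: Ad_def uu compose_assoc)
  qed
  have Ad_scale: "Ad u (scalar_op c o\<^sub>L x) = scalar_op c o\<^sub>L Ad u x" for c x
    by (simp add: Ad_def op_scale_right [OF u_cl] compose_assoc)
  have "(\<forall>x\<in>B i. \<theta> x = Ad u x) \<and> (\<forall>x\<in>B (Suc i). \<theta> x = Ad u x)" for i
  proof (induction i)
    case 0
    then show ?case using 1 B_mono [of _ 0 1] by simp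
  next
    case (Suc i)
    have ui: "u \<in> B i" using u(1) B_mono by blast
    have jp: "Ad u (jp i) = jp i"
    proof -
      have "u o\<^sub>L jp i o\<^sub>L adj u = jp i o\<^sub>L (u o\<^sub>L adj u)"
        using step.e_commute [OF ui] by (metis compose_assoc)
      then show ?thesis using u(2) by (simp add: Ad_def unitary_op_def)
    qed
    have "B (Suc (Suc i)) \<subseteq> {x \<in> B (Suc (Suc i)). \<theta> x = Ad u x}"
    proof (rule step.generated_subset)
      have "\<theta> 0 = 0" using \<theta>_scale [OF A.id_in [of 0], of 0] by simp
      then show "op.subspace {x \<in> B (Suc (Suc i)). \<theta> x = Ad u x}"
        by (intro op.subspaceI)
          (auto simp: \<theta>_add \<theta>_scale Ad_scale A.zero_in A.add_in A.scale_in Ad_def op_scale_right [OF u_cl] compose_simps)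
      fix a b assume a: "a \<in> B (Suc i)" and b: "b \<in> B (Suc i)"
      have a': "a \<in> B (Suc (Suc i))" and b': "b \<in> B (Suc (Suc i))" using a b B_Suc by blast+
      have "\<theta> (a o\<^sub>L jp i o\<^sub>L b) = \<theta> a o\<^sub>L jp i o\<^sub>L \<theta> b"
        by (rule \<theta>_jp_between [OF a' b'])
      also have "\<dots> = Ad u (a o\<^sub>L jp i o\<^sub>L b)"
        using Suc a b by (simp add: jp flip: Ad_mult)
      finally show "a o\<^sub>L jp i o\<^sub>L b \<in> {x \<in> B (Suc (Suc i)). \<theta> x = Ad u x}"
        using a' b' jp_in by (simp add: A.mult_in)
    qed
    then show ?case using Suc by auto
  qed
  then show "x \<in> U \<Longrightarrow> \<theta> x = Ad u x" by blast
qed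

text \<open>The elements of \<open>B k\<close> that implement \<open>\<theta>\<close> on \<open>B k\<close>, apart from invertibility. For \<open>\<theta> = id\<close> this is the centre of
  \<open>B k\<close>.\<close>

definition V :: "nat \<Rightarrow> 'h operator set" where
  "V k = {v \<in> B k. \<forall>y\<in>B k. v o\<^sub>L y = \<theta> y o\<^sub>L v}"

lemma V_B: "v \<in> V k \<Longrightarrow> v \<in> B k"
  by (simp add: V_def)

lemma V_commute: "\<lbrakk>v \<in> V k; y \<in> B k\<rbrakk> \<Longrightarrow> v o\<^sub>L y = \<theta> y o\<^sub>L v"
  by (simp add: V_def)

lemma \<theta>_clinear: "x \<in> B i \<Longrightarrow> \<theta> x \<in> clinear_ops"
  by (rule A.clinear [OF \<theta>_in])

lemma V_subspace: "op.subspace (V k)"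
  unfolding V_def
  by (rule op.subspaceI)
    (auto simp: A.zero_in A.add_in A.scale_in blinfun_compose.add_left blinfun_compose.add_right
      op_scale_left op_scale_right [OF \<theta>_clinear])

lemma V_sum: "(\<And>i. i \<in> I \<Longrightarrow> g i \<in> V k) \<Longrightarrow> (\<Sum>i\<in>I. scalar_op (c i) o\<^sub>L g i) \<in> V k"
  by (intro op.subspace_sum [OF V_subspace] op.subspace_scale [OF V_subspace])

lemma V_E: "v \<in> V (Suc k) \<Longrightarrow> E k v \<in> V k"
proof -
  assume v: "v \<in> V (Suc k)"
  have "E k v o\<^sub>L y = \<theta> y o\<^sub>L E k v" if y: "y \<in> B k" for y
  proof -
    have y': "y \<in> B (Suc k)" using y B_Suc by blast
    have "E k v o\<^sub>L y = E k (v o\<^sub>L y)"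
      using y U_B_inf [of v] V_B [OF v] by (intro E_right [symmetric]) auto
    also have "\<dots> = \<theta> y o\<^sub>L E k v"
      unfolding V_commute [OF v y'] using y by (intro A.cexp_left) simp
    finally show ?thesis .
  qed
  then show ?thesis by (simp add: V_def)
qed

lemma V_E': assumes "v \<in> V j" "i \<le> j" shows "E i v \<in> V i"
  using assms(2,1)
proof (induction j arbitrary: v rule: dec_induct)
  case base
  then show ?case using A.cexp_id V_B by metis
next
  case (step j)
  then have "E i (E j v) \<in> V i" using V_E by blast
  then show ?case using step(1) by (simp add: E_E)
qed

lemma V_jp: "v \<in> V (Suc (Suc k)) \<Longrightarrow> v o\<^sub>L jp k = jp k o\<^sub>L v"
  using V_commute [OF _ jp_in] by (simp add: \<theta>_jp)

text \<open>An intertwiner \<open>x\<close> is determined by \<open>x e\<close>: it satisfies \<open>x (a e b) = \<theta>(a) (x e) b\<close>, and the products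
  \<open>a e b\<close> span the algebra.\<close>

lemma V_eqI:
  assumes x: "x \<in> V (Suc (Suc k))" and y: "y \<in> V (Suc (Suc k))"
    and eq: "x o\<^sub>L jp k = y o\<^sub>L jp k"
  shows "x = y"
proof -
  have "B (Suc (Suc k)) \<subseteq> {w. x o\<^sub>L w = y o\<^sub>L w}"
  proof (rule step.generated_subset)
    show "op.subspace {w. x o\<^sub>L w = y o\<^sub>L w}"
      using x y by (intro op.subspaceI)
        (auto simp: blinfun_compose.add_right op_scale_right A.clinear [OF V_B])
    fix a b assume a: "a \<in> B (Suc k)" "b \<in> B (Suc k)"
    then have a': "a \<in> B (Suc (Suc k))" using B_Suc by blast
    have "z o\<^sub>L (a o\<^sub>L jp k o\<^sub>L b) = \<theta> a o\<^sub>L (z o\<^sub>L jp k) o\<^sub>L b" if "z \<in> V (Suc (Suc k))" for z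
      using V_commute [OF that a'] by (metis compose_assoc)
    then show "a o\<^sub>L jp k o\<^sub>L b \<in> {w. x o\<^sub>L w = y o\<^sub>L w}" using x y eq by simp
  qed
  then have "x o\<^sub>L id_blinfun = y o\<^sub>L id_blinfun" using A.id_in by blast
  then show ?thesis by simp
qed

text \<open>On \<open>L\<^sup>2(B (k + 1))\<close> the lift of \<open>x\<close> is the operator \<open>a \<mapsto> \<theta> a x\<close>. It commutes with the right action of
  \<open>B k\<close> because \<open>x\<close> implements \<open>\<theta>\<close> there, so it lies in the basic construction.\<close>

lemma lift_exists:
  assumes x: "x \<in> V k"
  shows "\<exists>y\<in>V (Suc (Suc k)). y o\<^sub>L jp k = x o\<^sub>L jp k"
proof -
  let ?M = "B (Suc k)" and ?P = "B (Suc (Suc k))" and ?\<Phi> = "rep k"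
  have xN: "x \<in> B k" by (rule V_B [OF x])
  then have xM: "x \<in> ?M" and xP: "x \<in> ?P" using B_Suc by blast+
  define T where "T = (\<lambda>a\<in>?M. \<theta> a o\<^sub>L x)"
  have "T \<in> L2_ops ?M"
    unfolding L2_ops_def T_def using xM
    by (auto simp: \<theta>_add \<theta>_scale A.add_in A.scale_in A.mult_in blinfun_compose.add_left op_scale_left)
  moreover have "T (a o\<^sub>L n) = T a o\<^sub>L n" if a: "a \<in> ?M" and n: "n \<in> B k" for a n
  proof -
    have nM: "n \<in> ?M" using n B_Suc by blast
    have "\<theta> (a o\<^sub>L n) o\<^sub>L x = \<theta> a o\<^sub>L x o\<^sub>L n"
      using V_commute [OF x n] a nM by (simp add: \<theta>_mult compose_assoc)
    then show ?thesis using a nM by (simp add: T_def A.mult_in)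
  qed
  ultimately obtain y where y: "y \<in> ?P" "?\<Phi> y = T"
    by (rule step.\<Phi>_surj)
  have \<Phi>y: "?\<Phi> y a = \<theta> a o\<^sub>L x" if "a \<in> ?M" for a using that y by (simp add: T_def)
  have EM: "E k a \<in> ?M" for a by simp
  have left: "y o\<^sub>L a = \<theta> a o\<^sub>L y" if a: "a \<in> ?M" for a
  proof (rule step.\<Phi>_eqI)
    fix b assume b: "b \<in> ?M"
    show "?\<Phi> (y o\<^sub>L a) b = ?\<Phi> (\<theta> a o\<^sub>L y) b"
      using a b y(1) xM by (simp add: step.\<Phi>_mult step.\<Phi>_M step.MP' \<Phi>y A.mult_in \<theta>_mult compose_assoc)
  qed (use a y(1) B_Suc in \<open>blast intro: A.mult_in \<theta>_in\<close>)+
  have yx: "y o\<^sub>L jp k = x o\<^sub>L jp k"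
  proof (rule step.\<Phi>_eqI)
    fix b assume b: "b \<in> ?M"
    have "?\<Phi> (y o\<^sub>L jp k) b = \<theta> (E k b) o\<^sub>L x"
      using b y(1) by (simp add: step.\<Phi>_mult step.\<Phi>_e jp_in \<Phi>y)
    also have "\<dots> = x o\<^sub>L E k b" using V_commute [OF x, of "E k b"] by simp
    also have "\<dots> = ?\<Phi> (x o\<^sub>L jp k) b"
      using b xP xM by (simp add: step.\<Phi>_mult step.\<Phi>_e step.\<Phi>_M jp_in)
    finally show "?\<Phi> (y o\<^sub>L jp k) b = ?\<Phi> (x o\<^sub>L jp k) b" .
  qed (use xP y(1) in \<open>auto intro!: A.mult_in jp_in\<close>)
  have jy: "jp k o\<^sub>L y = y o\<^sub>L jp k"
  proof (rule step.\<Phi>_eqI)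
    fix b assume b: "b \<in> ?M"
    have "?\<Phi> (jp k o\<^sub>L y) b = E k (\<theta> b o\<^sub>L x)"
      using b y(1) xM by (simp add: step.\<Phi>_mult step.\<Phi>_e jp_in \<Phi>y A.mult_in)
    also have "\<dots> = E k (\<theta> b) o\<^sub>L x" using b xN by (intro step.E_right) simp
    also have "\<dots> = \<theta> (E k b) o\<^sub>L x" using b by (simp add: \<theta>_E)
    also have "\<dots> = ?\<Phi> (y o\<^sub>L jp k) b"
      using b y(1) by (simp add: step.\<Phi>_mult step.\<Phi>_e jp_in \<Phi>y)
    finally show "?\<Phi> (jp k o\<^sub>L y) b = ?\<Phi> (y o\<^sub>L jp k) b" .
  qed (use y(1) in \<open>auto intro!: A.mult_in jp_in\<close>)
  have "?P \<subseteq> {w \<in> ?P. y o\<^sub>L w = \<theta> w o\<^sub>L y}"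
  proof (rule step.generated_subset)
    have "\<theta> 0 = 0" using \<theta>_scale [OF A.id_in [of 0], of 0] by simp
    then show "op.subspace {w \<in> ?P. y o\<^sub>L w = \<theta> w o\<^sub>L y}"
      using A.clinear [OF y(1)]
      by (intro op.subspaceI)
        (auto simp: A.zero_in A.add_in A.scale_in \<theta>_add \<theta>_scale op_scale_left op_scale_right compose_simps)
    fix a b assume a: "a \<in> ?M" and b: "b \<in> ?M"
    have a': "a \<in> ?P" and b': "b \<in> ?P" using a b B_Suc by blast+
    have "y o\<^sub>L (a o\<^sub>L jp k o\<^sub>L b) = \<theta> a o\<^sub>L (y o\<^sub>L jp k) o\<^sub>L b"
      using left [OF a] by (metis compose_assoc)
    also have "\<dots> = \<theta> a o\<^sub>L jp k o\<^sub>L (y o\<^sub>L b)" unfolding jy [symmetric] by (simp only: compose_assoc)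
    also have "\<dots> = \<theta> (a o\<^sub>L jp k o\<^sub>L b) o\<^sub>L y"
      unfolding left [OF b] \<theta>_jp_between [OF a' b'] by (simp only: compose_assoc)
    finally show "a o\<^sub>L jp k o\<^sub>L b \<in> {w \<in> ?P. y o\<^sub>L w = \<theta> w o\<^sub>L y}"
      using a' b' jp_in by (simp add: A.mult_in)
  qed
  then have "y \<in> V (Suc (Suc k))" using y(1) by (auto simp: V_def)
  then show ?thesis using yx by blast
qed

text \<open>The value of \<open>y\<close> at the identity in \<open>L\<^sup>2(B (k + 1))\<close> lies in \<open>B k\<close> because \<open>y\<close> commutes with the projection
  onto \<open>L\<^sup>2(B k)\<close>.\<close>

lemma descend_exists:
  assumes y: "y \<in> V (Suc (Suc k))"
  shows "\<exists>x\<in>V k. y o\<^sub>L jp k = x o\<^sub>L jp k"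
proof -
  let ?M = "B (Suc k)" and ?P = "B (Suc (Suc k))" and ?\<Phi> = "rep k"
  have yP: "y \<in> ?P" by (rule V_B [OF y])
  define x where "x = ?\<Phi> y id_blinfun"
  have xM: "x \<in> ?M" unfolding x_def by (intro step.\<Phi>_in yP A.id_in)
  have yx: "y o\<^sub>L jp k = x o\<^sub>L jp k"
    using step.compose_e [OF yP A.id_in] by (simp add: x_def)
  have "E k id_blinfun = id_blinfun" by (intro A.cexp_id A.id_in)
  then have "?\<Phi> (y o\<^sub>L jp k) id_blinfun = x"
    using yP by (simp add: step.\<Phi>_mult step.\<Phi>_e jp_in A.id_in x_def)
  moreover have "?\<Phi> (jp k o\<^sub>L y) id_blinfun = E k x"
    using yP xM by (simp add: step.\<Phi>_mult step.\<Phi>_e jp_in A.id_in flip: x_def)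
  ultimately have "x = E k x" using V_jp [OF y] by simp
  then have xN: "x \<in> B k" using A.cexp_in by metis
  have "x o\<^sub>L n = \<theta> n o\<^sub>L x" if n: "n \<in> B k" for n
  proof -
    have nM: "n \<in> ?M" and nP: "n \<in> ?P" using n B_Suc by blast+
    have "x o\<^sub>L n o\<^sub>L jp k = y o\<^sub>L n o\<^sub>L jp k"
      using yx step.e_commute [OF n] by (metis compose_assoc)
    also have "\<dots> = \<theta> n o\<^sub>L x o\<^sub>L jp k"
      using yx V_commute [OF y nP] by (metis compose_assoc)
    finally have "((x o\<^sub>L n) - (\<theta> n o\<^sub>L x)) o\<^sub>L jp k = 0" by (simp add: blinfun_compose.diff_left)
    moreover have "(x o\<^sub>L n) - (\<theta> n o\<^sub>L x) \<in> ?M"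
      by (intro A.diff_in A.mult_in nM xM \<theta>_in)
    ultimately have "(x o\<^sub>L n) - (\<theta> n o\<^sub>L x) = 0" by (rule step.compose_e_eq_0 [rotated])
    then show ?thesis by simp
  qed
  then have "x \<in> V k" using xN by (simp add: V_def)
  then show ?thesis using yx by blast
qed

definition lift :: "nat \<Rightarrow> 'h operator \<Rightarrow> 'h operator" where
  "lift k x = (THE y. y \<in> V (Suc (Suc k)) \<and> y o\<^sub>L jp k = x o\<^sub>L jp k)"

lemma lift_unique: "\<lbrakk>y \<in> V (Suc (Suc k)); y o\<^sub>L jp k = x o\<^sub>L jp k\<rbrakk> \<Longrightarrow> lift k x = y"
  unfolding lift_def by (rule the_equality) (auto intro: V_eqI)

lemma lift_V: "x \<in> V k \<Longrightarrow> lift k x \<in> V (Suc (Suc k))"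
  and lift_jp: "x \<in> V k \<Longrightarrow> lift k x o\<^sub>L jp k = x o\<^sub>L jp k"
  using lift_exists [of x k] lift_unique [of _ k x] by auto

lemma lift_add: "\<lbrakk>x \<in> V k; y \<in> V k\<rbrakk> \<Longrightarrow> lift k (x + y) = lift k x + lift k y"
  by (rule lift_unique) (auto intro: op.subspace_add [OF V_subspace] simp: lift_V lift_jp blinfun_compose.add_left)

lemma lift_scale: "x \<in> V k \<Longrightarrow> lift k (scalar_op c o\<^sub>L x) = scalar_op c o\<^sub>L lift k x"
  by (rule lift_unique) (auto intro: op.subspace_scale [OF V_subspace] simp: lift_V lift_jp op_scale_left)

lemma lift_surj:
  assumes "y \<in> V (Suc (Suc k))" obtains x where "x \<in> V k" "lift k x = y"
  using descend_exists [OF assms] lift_unique [OF assms] by metis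

lemma lift_inj:
  assumes "x \<in> V k" "y \<in> V k" "lift k x = lift k y" shows "x = y"
proof -
  have "(x - y) o\<^sub>L jp k = 0"
    using lift_jp [OF assms(1)] lift_jp [OF assms(2)] assms(3) by (simp add: blinfun_compose.diff_left)
  moreover have "x - y \<in> B (Suc k)"
    using V_B [OF assms(1)] V_B [OF assms(2)] B_Suc by (intro A.diff_in) blast+
  ultimately have "x - y = 0" by (rule step.compose_e_eq_0 [rotated])
  then show ?thesis by simp
qed

text \<open>Let \<open>p\<close> and \<open>q\<close> be the consecutive Jones projections and \<open>v\<close> the lift, so that \<open>v\<close> commutes with \<open>p\<close> and
  \<open>v q = x q\<close>. From \<open>\<tau> v p = v p q p = p x q p\<close> and \<open>E(q) = \<tau>\<close> one gets \<open>E(v) p = p x p = E\<^sub>k(x) p\<close>, and this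
  characterises the lift of \<open>E\<^sub>k(x)\<close>.\<close>

lemma E_lift:
  assumes x: "x \<in> V (Suc k)"
  shows "E (Suc (Suc k)) (lift (Suc k) x) = lift k (E k x)"
proof (rule lift_unique [symmetric])
  let ?v = "lift (Suc k) x" and ?p = "jp k" and ?q = "jp (Suc k)" and ?E = "E (Suc (Suc k))"
  let ?t = "complex_of_real \<tau>"
  have v: "?v \<in> V (Suc (Suc (Suc k)))" by (rule lift_V [OF x])
  show Ev: "?E ?v \<in> V (Suc (Suc k))" by (rule V_E [OF v])
  have xB: "x \<in> B (Suc k)" by (rule V_B [OF x])
  have xB2: "x \<in> B (Suc (Suc k))" using xB B_Suc by blast
  have p: "?p \<in> B (Suc (Suc k))" by (rule jp_in)
  have p3: "?p \<in> B (Suc (Suc (Suc k)))" using p B_Suc by blast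
  have vp: "?v o\<^sub>L ?p = ?p o\<^sub>L ?v" using V_commute [OF v p3] by (simp add: \<theta>_jp)
  have Eq: "?E (scalar_op ?t o\<^sub>L w) = scalar_op ?t o\<^sub>L ?E w" for w by (rule A.cexp_scale)
  have inf: "w \<in> B_inf" if "w \<in> B i" for w i using that by (intro U_B_inf) auto
  have q: "?q \<in> B (Suc (Suc (Suc k)))" by (rule jp_in)
  have "scalar_op ?t o\<^sub>L (?E ?v o\<^sub>L ?p) = ?E (?v o\<^sub>L (scalar_op ?t o\<^sub>L ?p))"
    using E_right [OF inf [OF V_B [OF v]] p] A.clinear [OF V_B [OF v]]
    by (simp add: op_scale_right Eq)
  also have "?v o\<^sub>L (scalar_op ?t o\<^sub>L ?p) = ?p o\<^sub>L (x o\<^sub>L (?q o\<^sub>L ?p))"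
  proof -
    have "?v o\<^sub>L (?p o\<^sub>L ?q o\<^sub>L ?p) = (?v o\<^sub>L ?p) o\<^sub>L (?q o\<^sub>L ?p)" by (simp only: compose_assoc)
    also have "\<dots> = ?p o\<^sub>L ((?v o\<^sub>L ?q) o\<^sub>L ?p)" unfolding vp by (simp only: compose_assoc)
    also have "\<dots> = ?p o\<^sub>L (x o\<^sub>L (?q o\<^sub>L ?p))" unfolding lift_jp [OF x] by (simp only: compose_assoc)
    finally show ?thesis unfolding jp_braid .
  qed
  also have "?E \<dots> = ?p o\<^sub>L (x o\<^sub>L ?E (?q o\<^sub>L ?p))"
    using p xB2 by (simp add: A.cexp_left)
  also have "?E (?q o\<^sub>L ?p) = scalar_op ?t o\<^sub>L ?p"
    using E_right [OF inf [OF q] p] by (simp add: E_jp)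
  also have "?p o\<^sub>L (x o\<^sub>L (scalar_op ?t o\<^sub>L ?p)) = scalar_op ?t o\<^sub>L (?p o\<^sub>L x o\<^sub>L ?p)"
    using A.clinear [OF p] A.clinear [OF xB] by (simp add: op_scale_right compose_assoc)
  also have "?p o\<^sub>L x o\<^sub>L ?p = E k x o\<^sub>L ?p" by (rule step.e_compress [OF xB])
  finally show "?E ?v o\<^sub>L ?p = E k x o\<^sub>L ?p"
    using step.\<tau>_pos by (simp add: op.scale_cancel_left)
qed

text \<open>If the lift of \<open>x\<close> is a contraction for left multiplication, then so is \<open>x\<close>: test the lift on the vectors
  \<open>y e \<Omega>\<close>, whose square norm is \<open>\<tau>\<close> times that of \<open>y \<Omega>\<close>.\<close>

lemma contraction_descends:
  assumes x: "x \<in> V k"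
    and contr: "\<And>y. y \<in> B (Suc (Suc k)) \<Longrightarrow> norm (lift k x (y \<Omega>)) \<le> norm (y \<Omega>)"
    and y: "y \<in> B k"
  shows "norm (x (y \<Omega>)) \<le> norm (y \<Omega>)"
proof -
  have sq: "(norm (z (jp k \<Omega>)))\<^sup>2 = \<tau> * (norm (z \<Omega>))\<^sup>2" if "z \<in> B (Suc k)" for z
  proof -
    have "complex_of_real ((norm (z (jp k \<Omega>)))\<^sup>2) = complex_of_real (\<tau> * (norm (z \<Omega>))\<^sup>2)"
      using step.inner_e_e [OF that that] by (simp only: cinner_self of_real_mult)
    then show ?thesis unfolding of_real_eq_iff .
  qed
  have y1: "y \<in> B (Suc k)" and xy: "x o\<^sub>L y \<in> B (Suc k)"
    using y V_B [OF x] B_Suc A.mult_in by blast+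
  have yP: "y o\<^sub>L jp k \<in> B (Suc (Suc k))" using y1 B_Suc jp_in by (blast intro: A.mult_in)
  have "x o\<^sub>L y o\<^sub>L jp k = lift k x o\<^sub>L (y o\<^sub>L jp k)"
    using step.e_commute [OF y] lift_jp [OF x] by (metis compose_assoc)
  then have "(x o\<^sub>L y) (jp k \<Omega>) = lift k x ((y o\<^sub>L jp k) \<Omega>)"
    by (metis blinfun_apply_blinfun_compose)
  then have "norm ((x o\<^sub>L y) (jp k \<Omega>)) \<le> norm (y (jp k \<Omega>))" using contr [OF yP] by simp
  then have "(norm ((x o\<^sub>L y) (jp k \<Omega>)))\<^sup>2 \<le> (norm (y (jp k \<Omega>)))\<^sup>2" by (intro power_mono) auto
  then have "\<tau> * (norm ((x o\<^sub>L y) \<Omega>))\<^sup>2 \<le> \<tau> * (norm (y \<Omega>))\<^sup>2" unfolding sq [OF y1] sq [OF xy] .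
  then have "(norm (x (y \<Omega>)))\<^sup>2 \<le> (norm (y \<Omega>))\<^sup>2" using step.\<tau>_pos by simp
  then show ?thesis by (simp add: power2_le_iff_abs_le)
qed

fun lifts :: "nat \<Rightarrow> nat \<Rightarrow> 'h operator \<Rightarrow> 'h operator" where
  "lifts 0 k x = x"
| "lifts (Suc j) k x = lifts j (Suc (Suc k)) (lift k x)"

lemma lifts_V: "x \<in> V k \<Longrightarrow> lifts j k x \<in> V (k + 2 * j)"
proof (induction j arbitrary: k x)
  case (Suc j)
  show ?case using Suc.IH [OF lift_V [OF Suc.prems]] by simp
qed simp

lemma lifts_add: "\<lbrakk>x \<in> V k; y \<in> V k\<rbrakk> \<Longrightarrow> lifts j k (x + y) = lifts j k x + lifts j k y"
  by (induction j arbitrary: k x y) (auto simp: lift_add lift_V)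

lemma lifts_scale: "x \<in> V k \<Longrightarrow> lifts j k (scalar_op c o\<^sub>L x) = scalar_op c o\<^sub>L lifts j k x"
  by (induction j arbitrary: k x) (auto simp: lift_scale lift_V)

lemma lifts_surj:
  assumes "y \<in> V (k + 2 * j)"
  shows "\<exists>x\<in>V k. lifts j k x = y"
  using assms
proof (induction j arbitrary: k)
  case (Suc j)
  have "y \<in> V (Suc (Suc k) + 2 * j)" using Suc.prems by simp
  then obtain x where x: "x \<in> V (Suc (Suc k))" "lifts j (Suc (Suc k)) x = y"
    using Suc.IH by blast
  obtain z where "z \<in> V k" "lift k z = x" using x(1) by (rule lift_surj)
  then show ?case using x(2) by auto
qed simp

lemma lifts_inj: "\<lbrakk>x \<in> V k; y \<in> V k; lifts j k x = lifts j k y\<rbrakk> \<Longrightarrow> x = y"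
proof (induction j arbitrary: k x y)
  case (Suc j)
  have "lift k x = lift k y"
    by (rule Suc.IH [OF lift_V [OF Suc.prems(1)] lift_V [OF Suc.prems(2)]]) (use Suc.prems(3) in simp)
  then show ?case by (rule lift_inj [OF Suc.prems(1,2)])
qed simp

lemma E_lifts: "x \<in> V (Suc k) \<Longrightarrow> E (k + 2 * j) (lifts j (Suc k) x) = lifts j k (E k x)"
proof (induction j arbitrary: k x)
  case 0
  then show ?case by simp
next
  case (Suc j)
  have "E (Suc (Suc k) + 2 * j) (lifts j (Suc (Suc (Suc k))) (lift (Suc k) x))
      = lifts j (Suc (Suc k)) (E (Suc (Suc k)) (lift (Suc k) x))"
    by (intro Suc.IH lift_V Suc.prems)
  then show ?case using Suc.prems by (simp add: E_lift)
qed

lemma E_lifts2: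
  assumes x: "x \<in> V (Suc (Suc k))"
  shows "E (k + 2 * j) (lifts j (Suc (Suc k)) x) = lifts j k (E k x)"
proof -
  have "E (k + 2 * j) (lifts j (Suc (Suc k)) x) = E (k + 2 * j) (E (Suc k + 2 * j) (lifts j (Suc (Suc k)) x))"
    by (simp add: E_E)
  also have "\<dots> = E (k + 2 * j) (lifts j (Suc k) (E (Suc k) x))"
    using E_lifts [OF x] by simp
  also have "\<dots> = lifts j k (E k x)"
    using E_lifts [OF V_E [OF x]] by (simp add: E_E)
  finally show ?thesis .
qed

lemma contraction_lifts_descends:
  assumes "x \<in> V k"
    and "\<And>y. y \<in> B (k + 2 * j) \<Longrightarrow> norm (lifts j k x (y \<Omega>)) \<le> norm (y \<Omega>)"
    and "y \<in> B k"
  shows "norm (x (y \<Omega>)) \<le> norm (y \<Omega>)"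
  using assms
proof (induction j arbitrary: k x y)
  case (Suc j)
  have "norm (lift k x (z \<Omega>)) \<le> norm (z \<Omega>)" if "z \<in> B (Suc (Suc k))" for z
    by (rule Suc.IH [OF lift_V [OF Suc.prems(1)] _ that]) (use Suc.prems(2) in simp)
  then show ?case using contraction_descends Suc.prems(1,3) by blast
qed simp

end

section \<open>Compactness and limits of scalars\<close>

lemma common_convergent_subsequence:
  fixes a :: "'i \<Rightarrow> nat \<Rightarrow> complex"
  assumes "finite G" and "\<And>g n. g \<in> G \<Longrightarrow> cmod (a g n) \<le> K g"
  shows "\<exists>r. strict_mono r \<and> (\<forall>g\<in>G. convergent (\<lambda>n. a g (r n)))"
  using assms
proof (induction G)
  case empty
  show ?case by (rule exI [of _ id]) (simp add: strict_mono_def)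
next
  case (insert g G)
  then obtain r where r: "strict_mono r" "\<forall>g\<in>G. convergent (\<lambda>n. a g (r n))" by auto
  have "bounded (range (\<lambda>n. a g (r n)))"
    using insert.prems [of g] by (auto simp: bounded_iff)
  then obtain l s where s: "strict_mono s" "((\<lambda>n. a g (r n)) \<circ> s) \<longlonglongrightarrow> l"
    using bounded_imp_convergent_subsequence by blast
  have "convergent (\<lambda>n. a g' ((r \<circ> s) n))" if "g' \<in> G" for g'
    using convergent_subseq_convergent [OF r(2) [rule_format, OF that] s(1)] by (simp add: o_def)
  moreover have "convergent (\<lambda>n. a g ((r \<circ> s) n))"
    using s(2) by (auto simp: convergent_def o_def)
  moreover have "strict_mono (r \<circ> s)" using r(1) s(1) by (rule strict_mono_o)
  ultimately show ?case by blast
qed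

text \<open>The constant \<open>K\<close> disappears under high powers. This turns a bound with an unknown constant into the sharp one.\<close>

lemma le_of_power_le:
  fixes a b K :: real
  assumes "0 \<le> a" "0 \<le> b" and le: "\<And>n. a ^ (2 ^ n) \<le> K * b ^ (2 ^ n)"
  shows "a \<le> b"
proof (rule ccontr)
  assume "\<not> a \<le> b"
  then have "b < a" by simp
  show False
  proof (cases "b = 0")
    case True
    then show False using le [of 0] \<open>b < a\<close> by simp
  next
    case False
    then have b: "0 < b" using assms(2) by simp
    define q where "q = a / b"
    have q: "1 < q" using b \<open>b < a\<close> by (simp add: q_def)
    obtain n where n: "K < q ^ n" using real_arch_pow [OF q] by blast
    also have "q ^ n \<le> q ^ (2 ^ n)" using q by (intro power_increasing) (auto intro: less_imp_le less_exp)
    also have "\<dots> \<le> K" using le [of n] b by (simp add: q_def power_divide field_simps)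
    finally show False by simp
  qed
qed

lemma norm_scalar_op_le: "norm (scalar_op c :: 'h::complex_hilbert_space operator) \<le> cmod c"
  by (rule norm_blinfun_bound) (simp_all add: norm_scaleC)

lemma norm_op_scale_le:
  "norm (scalar_op c o\<^sub>L x) \<le> cmod c * norm (x :: 'h::complex_hilbert_space operator)"
  by (rule order_trans [OF norm_blinfun_compose])
    (intro mult_right_mono norm_scalar_op_le norm_ge_zero)

lemma tendsto_op_scale:
  fixes x :: "'h::complex_hilbert_space operator"
  assumes "(a \<longlongrightarrow> l) F"
  shows "((\<lambda>m. scalar_op (a m) o\<^sub>L x) \<longlongrightarrow> scalar_op l o\<^sub>L x) F"
proof -
  have "bounded_linear (\<lambda>c. scalar_op c o\<^sub>L x)"
  proof (rule bounded_linear_intro)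
    show "scalar_op (b + c) o\<^sub>L x = (scalar_op b o\<^sub>L x) + (scalar_op c o\<^sub>L x)" for b c
      by (rule op.scale_left_distrib)
    show "scalar_op (r *\<^sub>R c) o\<^sub>L x = r *\<^sub>R (scalar_op c o\<^sub>L x)" for r c
      by (rule blinfun_eqI) (simp add: scaleR_conv_of_real blinfun.scaleR_left flip: scaleC_of_real scaleC_scaleC)
    show "norm (scalar_op c o\<^sub>L x) \<le> norm c * norm x" for c by (rule norm_op_scale_le)
  qed
  then show ?thesis using assms by (rule bounded_linear.tendsto)
qed

section \<open>The transition operator and its Cesaro limit state\<close>

context tower_automorphism
begin

text \<open>Products \<open>x\<^sup>* y\<close> of intertwiners of \<open>\<theta>\<close> intertwine the identity, so both automorphisms are needed side by side.\<close>

sublocale I: tower_automorphism B e \<Omega> \<tau> "\<lambda>x. x"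
  by unfold_locales auto

abbreviation Z :: "nat \<Rightarrow> 'h operator set" where
  "Z \<equiv> I.V"

lemma V_adj_mult:
  assumes x: "x \<in> V k" and y: "y \<in> V k"
  shows "adj x o\<^sub>L y \<in> Z k"
proof -
  have xB: "x \<in> B k" and yB: "y \<in> B k" using x y V_B by auto
  have "adj x o\<^sub>L y o\<^sub>L w = w o\<^sub>L (adj x o\<^sub>L y)" if w: "w \<in> B k" for w
  proof -
    have "adj x o\<^sub>L \<theta> w = adj (\<theta> (adj w) o\<^sub>L x)"
      using adj_compose [OF \<theta>_clinear [OF A.adj_in [OF w]] A.clinear [OF xB]]
        \<theta>_adj [OF w] adj_adj [OF \<theta>_clinear [OF w]] by simp
    also have "\<dots> = adj (x o\<^sub>L adj w)" using V_commute [OF x A.adj_in [OF w]] by simp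
    also have "\<dots> = w o\<^sub>L adj x"
      using adj_compose [OF A.clinear [OF xB] A.clinear [OF A.adj_in [OF w]]] adj_adj [OF A.clinear [OF w]]
      by simp
    finally have "adj x o\<^sub>L \<theta> w = w o\<^sub>L adj x" .
    then show ?thesis using V_commute [OF y w] by (metis compose_assoc)
  qed
  then show ?thesis using xB yB by (simp add: I.V_def A.mult_in A.adj_in)
qed

lemma lift_adj_mult:
  assumes x: "x \<in> V k" and y: "y \<in> V k"
  shows "I.lift k (adj x o\<^sub>L y) = adj (lift k x) o\<^sub>L lift k y"
proof (rule I.lift_unique)
  let ?X = "lift k x" and ?Y = "lift k y"
  have X: "?X \<in> V (Suc (Suc k))" and Y: "?Y \<in> V (Suc (Suc k))" using x y lift_V by auto
  show "adj ?X o\<^sub>L ?Y \<in> Z (Suc (Suc k))" by (rule V_adj_mult [OF X Y])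
  have cl: "x \<in> clinear_ops" "?X \<in> clinear_ops" "jp k \<in> clinear_ops"
    using A.clinear [OF V_B [OF x]] A.clinear [OF V_B [OF X]] A.clinear [OF jp_in] by auto
  have "adj (?X o\<^sub>L jp k) = adj (x o\<^sub>L jp k)" using lift_jp [OF x] by simp
  then have jX: "jp k o\<^sub>L adj ?X = jp k o\<^sub>L adj x" using cl by (simp add: adj_compose step.e_adj)
  have "adj (jp k o\<^sub>L ?X) = adj (?X o\<^sub>L jp k)" using V_jp [OF X] by simp
  then have Xj: "adj ?X o\<^sub>L jp k = jp k o\<^sub>L adj ?X" using cl by (simp add: adj_compose step.e_adj)
  have yj: "y o\<^sub>L jp k = jp k o\<^sub>L y" and xj: "adj x o\<^sub>L jp k = jp k o\<^sub>L adj x"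
    using step.e_commute V_B [OF y] A.adj_in [OF V_B [OF x]] by blast+
  have "adj ?X o\<^sub>L ?Y o\<^sub>L jp k = adj ?X o\<^sub>L (y o\<^sub>L jp k)"
    using lift_jp [OF y] by (simp add: compose_assoc)
  also have "\<dots> = (adj ?X o\<^sub>L jp k) o\<^sub>L y" by (simp add: yj compose_assoc)
  also have "\<dots> = (adj x o\<^sub>L jp k) o\<^sub>L y" by (simp add: Xj jX xj)
  also have "\<dots> = adj x o\<^sub>L y o\<^sub>L jp k" by (simp add: yj compose_assoc)
  finally show "adj ?X o\<^sub>L ?Y o\<^sub>L jp k = adj x o\<^sub>L y o\<^sub>L jp k" .
qed

lemma lifts_adj_mult:
  "\<lbrakk>x \<in> V k; y \<in> V k\<rbrakk> \<Longrightarrow> I.lifts j k (adj x o\<^sub>L y) = adj (lifts j k x) o\<^sub>L lifts j k y"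
  by (induction j arbitrary: k x y) (simp_all add: lift_adj_mult lift_V)

text \<open>For \<open>\<theta> = id\<close> this acts on the centre of \<open>B 0\<close>, that is, on functions on the vertices of the Bratteli diagram
  at level \<open>0\<close>. It is positive and unital: two steps of a random walk on the diagram.\<close>

definition transition :: "'h operator \<Rightarrow> 'h operator" where
  "transition x = E 0 (lift 0 x)"

lemma transition_V: "x \<in> V 0 \<Longrightarrow> transition x \<in> V 0"
  unfolding transition_def by (intro V_E' [OF lift_V]) auto

lemma transition_add: "\<lbrakk>x \<in> V 0; y \<in> V 0\<rbrakk> \<Longrightarrow> transition (x + y) = transition x + transition y"
  by (simp add: transition_def lift_add A.cexp_add)

lemma transition_scale: "x \<in> V 0 \<Longrightarrow> transition (scalar_op c o\<^sub>L x) = scalar_op c o\<^sub>L transition x"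
  by (simp add: transition_def lift_scale A.cexp_scale)

lemma lifts_transition: "x \<in> V 0 \<Longrightarrow> lifts j 0 (transition x) = E (2 * j) (lifts (Suc j) 0 x)"
  using E_lifts2 [OF lift_V, of x 0 j] by (simp add: transition_def)

lemma V_form: "positive_form (V k) A.L2"
  by unfold_locales
    (auto simp: V_subspace blinfun.add_left cinner_add_left cinner_scaleC_left cinner_self
      intro: cinner_commute)

lemma V_finite_dim: obtains F where "finite F" "V k \<subseteq> op.span F"
proof -
  obtain F where "finite F" "B k \<subseteq> op.span F" by (rule finite_dim_span [OF B_fd])
  then show thesis using that V_B by blast
qed

lemma V_basis: obtains G where "orthonormal_basis A.L2 (V k) G"
proof -
  obtain F where F: "finite F" "V k \<subseteq> op.span F" by (rule V_finite_dim)
  have "x = 0" if "x \<in> V k" "A.L2 x x = 0" for x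
    using that V_B by (intro A.separating [of x k]) auto
  then show thesis
    using that by (rule positive_form.exists_orthonormal_basis [OF V_form F])
qed

end

context tower_automorphism
begin

lemma Z_B: "z \<in> Z k \<Longrightarrow> z \<in> B k"
  by (rule I.V_B)

lemma Z_commute: "\<lbrakk>z \<in> Z k; y \<in> B k\<rbrakk> \<Longrightarrow> z o\<^sub>L y = y o\<^sub>L z"
  by (rule I.V_commute)

lemma Z_id: "id_blinfun \<in> Z k"
  by (simp add: I.V_def A.id_in)

lemma Z_adj: "z \<in> Z k \<Longrightarrow> adj z \<in> Z k"
  using I.V_adj_mult [OF _ Z_id] by simp

lemma Z_mult: "\<lbrakk>x \<in> Z k; y \<in> Z k\<rbrakk> \<Longrightarrow> x o\<^sub>L y \<in> Z k"
  using I.V_adj_mult [OF Z_adj] A.clinear [OF Z_B] by simp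

lemmas Z_add = op.subspace_add [OF I.V_subspace] and Z_diff = op.subspace_diff [OF I.V_subspace]
  and Z_scale = op.subspace_scale [OF I.V_subspace] and Z_zero = op.subspace_0 [OF I.V_subspace]

lemma Z_alg: "star_subalgebra (Z k)"
  unfolding star_subalgebra_def
  using A.clinear [OF Z_B] by (auto intro: Z_id Z_add Z_mult Z_adj Z_scale)

lemma Z_lifts: "z \<in> Z k \<Longrightarrow> I.lifts j k z \<in> Z (k + 2 * j)"
  by (rule I.lifts_V)

lemma lifts_id: "I.lifts j k id_blinfun = id_blinfun"
proof (induction j arbitrary: k)
  case (Suc j)
  have "I.lift k id_blinfun = id_blinfun" by (rule I.lift_unique [OF Z_id refl])
  then show ?case using Suc by simp
qed simp

lemma lifts_adj: "z \<in> Z k \<Longrightarrow> I.lifts j k (adj z) = adj (I.lifts j k z)"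
  using I.lifts_adj_mult [OF _ Z_id] by (simp add: lifts_id)

lemma lifts_mult:
  assumes x: "x \<in> Z k" and y: "y \<in> Z k"
  shows "I.lifts j k (x o\<^sub>L y) = I.lifts j k x o\<^sub>L I.lifts j k y"
  using I.lifts_adj_mult [OF Z_adj [OF x] y, of j] A.clinear [OF Z_B [OF x]]
    A.clinear [OF Z_B [OF Z_lifts [OF x]], of j]
  by (simp add: lifts_adj x)

lemma lifts_diff:
  assumes "x \<in> Z k" "y \<in> Z k"
  shows "I.lifts j k (x - y) = I.lifts j k x - I.lifts j k y"
  using I.lifts_add [OF Z_diff [OF assms] assms(2), of j] by simp

text \<open>The distribution of the random walk: \<open>state j\<close> is the trace of level \<open>2 j\<close>, read on the centre of \<open>B 0\<close>.\<close>

definition state :: "nat \<Rightarrow> 'h operator \<Rightarrow> complex" where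
  "state j z = trace (I.lifts j 0 z)"

lemma state_add: "\<lbrakk>x \<in> Z 0; y \<in> Z 0\<rbrakk> \<Longrightarrow> state j (x + y) = state j x + state j y"
  by (simp add: state_def I.lifts_add blinfun.add_left cinner_add_left)

lemma state_scale: "x \<in> Z 0 \<Longrightarrow> state j (scalar_op c o\<^sub>L x) = c * state j x"
  by (simp add: state_def I.lifts_scale cinner_scaleC_left)

lemma state_id: "state j id_blinfun = 1"
  by (simp add: state_def lifts_id cinner_self step.norm_\<Omega>)

lemma state_transition: "z \<in> Z 0 \<Longrightarrow> state j (I.transition z) = state (Suc j) z"
  by (simp add: state_def I.lifts_transition A.cexp_trace del: I.lifts.simps)

lemma state_adj: "z \<in> Z 0 \<Longrightarrow> state j (adj z) = cnj (state j z)"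
  using cinner_adj_left [OF A.clinear [OF Z_B [OF Z_lifts]]]
  by (simp add: state_def lifts_adj) (metis cinner_commute)

lemma state_adj_mult: "v \<in> V 0 \<Longrightarrow> state j (adj v o\<^sub>L v) = complex_of_real ((norm (lifts j 0 v \<Omega>))\<^sup>2)"
  using cinner_adj_left [OF A.clinear [OF V_B [OF lifts_V]]]
  by (simp add: state_def lifts_adj_mult cinner_self)

end

context tower_automorphism
begin

lemma E_adj: assumes T: "T \<in> B j" and "i \<le> j" shows "E i (adj T) = adj (E i T)"
proof (rule A.cexp_unique)
  show "adj (E i T) \<in> B i" by (intro A.adj_in) simp
  fix a assume a: "a \<in> B i"
  then have aj: "a \<in> B j" using \<open>i \<le> j\<close> B_mono by blast
  have "cinner (adj T \<Omega>) (a \<Omega>) = cinner (adj a \<Omega>) (T \<Omega>)"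
    using A.inner_adj [OF A.adj_in [OF T] aj] adj_adj [OF A.clinear [OF T]] by simp
  also have "\<dots> = cinner (adj a \<Omega>) (E i T \<Omega>)"
    using A.cexp_inner [OF A.adj_in [OF a], of T] by (metis cinner_commute)
  also have "\<dots> = cinner (adj (E i T) \<Omega>) (a \<Omega>)"
    using A.inner_adj [OF A.adj_in [OF A.cexp_in] a, of T] adj_adj [OF A.clinear [OF A.cexp_in]] by simp
  finally show "cinner (adj T \<Omega>) (a \<Omega>) = cinner (adj (E i T) \<Omega>) (a \<Omega>)" .
qed

text \<open>The identity behind the Kadison-Schwarz inequality for a conditional expectation.\<close>

lemma E_variance:
  assumes X: "X \<in> B j" and ij: "i \<le> j"
  shows "E i (adj (X - E i X) o\<^sub>L (X - E i X)) = E i (adj X o\<^sub>L X) - (adj (E i X) o\<^sub>L E i X)"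
proof -
  let ?Y = "E i X"
  have Y: "?Y \<in> B i" by simp
  have Yj: "?Y \<in> B j" using Y ij B_mono by blast
  have 1: "E i (adj X o\<^sub>L ?Y) = adj ?Y o\<^sub>L ?Y"
    using E_right [OF _ Y, of "adj X"] U_B_inf [of "adj X"] A.adj_in [OF X] E_adj [OF X ij] by auto
  have 2: "E i (adj ?Y o\<^sub>L X) = adj ?Y o\<^sub>L ?Y" by (intro A.cexp_left A.adj_in Y)
  have 3: "E i (adj ?Y o\<^sub>L ?Y) = adj ?Y o\<^sub>L ?Y" by (intro A.cexp_id A.mult_in A.adj_in Y)
  have "adj (X - ?Y) o\<^sub>L (X - ?Y)
      = (adj X o\<^sub>L X) - (adj X o\<^sub>L ?Y) - ((adj ?Y o\<^sub>L X) - (adj ?Y o\<^sub>L ?Y))"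
    using A.clinear [OF X] A.clinear [OF Y]
    by (simp add: adj_diff blinfun_compose.diff_left blinfun_compose.diff_right)
  then show ?thesis by (simp add: A.cexp_diff 1 2 3)
qed

lemma trace_product_nonneg:
  assumes W: "W \<in> B m" and D: "D \<in> B m"
  shows "0 \<le> Re (trace ((adj W o\<^sub>L W) o\<^sub>L (adj D o\<^sub>L D)))"
proof -
  have "trace ((adj W o\<^sub>L W) o\<^sub>L (adj D o\<^sub>L D)) = cinner (adj W ((W o\<^sub>L adj D o\<^sub>L D) \<Omega>)) \<Omega>"
    by simp
  also have "\<dots> = cinner ((W o\<^sub>L adj D o\<^sub>L D) (adj W \<Omega>)) \<Omega>"
    using W D by (intro B_trace A.mult_in A.adj_in)
  also have "\<dots> = cinner (D (adj W \<Omega>)) (D (adj W \<Omega>))"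
    using cinner_adj_left [OF A.clinear [OF D]] cinner_adj_right [OF A.clinear [OF W], symmetric] by simp
  finally show ?thesis by (simp add: cinner_self)
qed

text \<open>The defect in the Kadison-Schwarz inequality for the transition operator, an element of the centre.\<close>

definition variance :: "'h operator \<Rightarrow> 'h operator" where
  "variance v = I.transition (adj v o\<^sub>L v) - (adj (transition v) o\<^sub>L transition v)"

lemma variance_Z: "v \<in> V 0 \<Longrightarrow> variance v \<in> Z 0"
  unfolding variance_def by (intro Z_diff I.transition_V V_adj_mult transition_V)

lemma transition_adj: "z \<in> Z 0 \<Longrightarrow> I.transition (adj z) = adj (I.transition z)"
  using lifts_adj [of z 0 1] E_adj [OF Z_B [OF I.lift_V]] by (simp add: I.transition_def)

lemma adj_adj_mult: "v \<in> V k \<Longrightarrow> adj (adj v o\<^sub>L v) = adj v o\<^sub>L v"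
  using A.clinear [OF V_B] by (simp add: adj_compose clinear_ops_adj)

lemma variance_adj: "v \<in> V 0 \<Longrightarrow> adj (variance v) = variance v"
  using A.clinear [OF Z_B [OF I.transition_V [OF V_adj_mult [of v 0 v]]]]
    A.clinear [OF Z_B [OF V_adj_mult [of "transition v" 0 "transition v"]]]
    transition_adj [OF V_adj_mult [of v 0 v]] transition_V [of v]
  by (simp add: variance_def adj_diff adj_adj_mult)

lemma state_square_nonneg:
  assumes v: "v \<in> V 0" and w: "w \<in> Z 0"
  shows "0 \<le> Re (state j ((adj w o\<^sub>L w) o\<^sub>L (adj v o\<^sub>L v)))"
proof -
  have "I.lifts j 0 ((adj w o\<^sub>L w) o\<^sub>L (adj v o\<^sub>L v))
      = (adj (I.lifts j 0 w) o\<^sub>L I.lifts j 0 w) o\<^sub>L (adj (lifts j 0 v) o\<^sub>L lifts j 0 v)"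
    using v w by (simp add: lifts_mult lifts_adj lifts_adj_mult Z_mult Z_adj V_adj_mult)
  then show ?thesis
    unfolding state_def
    using trace_product_nonneg [OF Z_B [OF Z_lifts [OF w]] V_B [OF lifts_V [OF v]]] by simp
qed

text \<open>The lift of \<open>variance v\<close> to level \<open>2 j\<close> is \<open>E (D\<^sup>* D)\<close>, where \<open>D\<close> is the difference of the lift of \<open>v\<close> to level
  \<open>2 j + 2\<close> and its expectation. The weight \<open>w\<^sup>* w\<close> is there because later \<open>variance v\<close> itself must be recovered
  from the values of a state, and it is not known to have a square root in the centre.\<close>

lemma state_variance_nonneg:
  assumes v: "v \<in> V 0" and w: "w \<in> Z 0"
  shows "0 \<le> Re (state j ((adj w o\<^sub>L w) o\<^sub>L variance v))"
proof -
  let ?W = "I.lifts j 0 w" and ?X = "lifts (Suc j) 0 v"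
  let ?Y = "E (2 * j) ?X"
  have W: "?W \<in> B (2 * j)" using Z_B [OF Z_lifts [OF w, of j]] by simp
  have X: "?X \<in> B (2 * Suc j)" using V_B [OF lifts_V [OF v, of "Suc j"]] by simp
  have W': "?W \<in> B (2 * Suc j)" using B_mono [OF W] by simp
  have "?Y \<in> B (2 * j)" by simp
  then have Y': "?Y \<in> B (2 * Suc j)" by (rule B_mono) simp
  have WW: "adj ?W o\<^sub>L ?W \<in> B (2 * j)" using W by (intro A.mult_in A.adj_in)
  have "I.lifts j 0 (variance v) = E (2 * j) (adj ?X o\<^sub>L ?X) - (adj ?Y o\<^sub>L ?Y)"
    unfolding variance_def
    using v by (simp add: lifts_diff I.transition_V V_adj_mult transition_V I.lifts_transition
        lifts_transition lifts_adj_mult del: lifts.simps I.lifts.simps)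
  also have "\<dots> = E (2 * j) (adj (?X - ?Y) o\<^sub>L (?X - ?Y))"
    by (rule E_variance [OF X, symmetric]) simp
  finally have "I.lifts j 0 ((adj w o\<^sub>L w) o\<^sub>L variance v)
      = E (2 * j) ((adj ?W o\<^sub>L ?W) o\<^sub>L (adj (?X - ?Y) o\<^sub>L (?X - ?Y)))"
    using v w A.cexp_left [OF WW]
    by (simp add: lifts_mult lifts_adj Z_mult Z_adj variance_Z del: lifts.simps I.lifts.simps)
  then have "state j ((adj w o\<^sub>L w) o\<^sub>L variance v)
      = trace ((adj ?W o\<^sub>L ?W) o\<^sub>L (adj (?X - ?Y) o\<^sub>L (?X - ?Y)))"
    unfolding state_def by (simp only: A.cexp_trace)
  then show ?thesis
    using trace_product_nonneg [OF W' A.diff_in [OF X Y']] by simp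
qed

lemma L2_le: "cmod (A.L2 x g) \<le> norm x * norm (g \<Omega>)"
proof -
  have "cmod (A.L2 x g) \<le> norm (x \<Omega>) * norm (g \<Omega>)" by (rule norm_cinner_le)
  also have "norm (x \<Omega>) \<le> norm x" using norm_blinfun [of x \<Omega>] by (simp add: step.norm_\<Omega>)
  finally show ?thesis by (simp add: mult_right_mono)
qed

lemma state_sum:
  assumes "finite G" "\<And>g. g \<in> G \<Longrightarrow> g \<in> Z 0"
  shows "state j (\<Sum>g\<in>G. scalar_op (a g) o\<^sub>L g) = (\<Sum>g\<in>G. a g * state j g)"
  using assms
proof (induction G)
  case empty
  show ?case using state_scale [OF Z_id, of j 0] by simp
next
  case (insert g G)
  then show ?case by (simp add: state_add state_scale Z_scale I.V_sum)
qed

text \<open>A state is bounded by some constant times the norm because the centre is finite-dimensional. The constant is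
  removed by \<open>\<bar>\<phi> z\<bar>\<^sup>2 \<le> \<phi> (z\<^sup>* z)\<close>, applied repeatedly. The point is that the resulting bound does not depend on \<open>j\<close>.\<close>

lemma state_bound:
  assumes z: "z \<in> Z 0"
  shows "cmod (state j z) \<le> norm z"
proof -
  obtain G where "orthonormal_basis A.L2 (Z 0) G" by (rule I.V_basis)
  note G = orthonormal_basisD(1,3) [OF this] and ex = orthonormal_basisD(5) [OF this]
  define K where "K = (\<Sum>g\<in>G. norm (blinfun_apply g \<Omega>) * cmod (state j g))"
  have base: "cmod (state j z) \<le> K * norm z" if z: "z \<in> Z 0" for z
  proof -
    define a where "a = A.L2 z"
    have "z = (\<Sum>g\<in>G. scalar_op (a g) o\<^sub>L g)" unfolding a_def by (rule ex [OF z])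
    then have "state j z = (\<Sum>g\<in>G. a g * state j g)" using state_sum [of G j a] G by simp
    also have "cmod \<dots> \<le> (\<Sum>g\<in>G. (norm z * norm (blinfun_apply g \<Omega>)) * cmod (state j g))"
      unfolding a_def by (rule sum_norm_le) (simp add: norm_mult L2_le mult_right_mono)
    also have "\<dots> = K * norm z" by (simp add: K_def sum_distrib_left mult_ac)
    finally show ?thesis .
  qed
  have square: "(cmod (state j z))\<^sup>2 \<le> cmod (state j (adj z o\<^sub>L z))" if z: "z \<in> Z 0" for z
  proof -
    have "cmod (state j z) \<le> norm (I.lifts j 0 z \<Omega>)"
      using norm_cinner_le [of "I.lifts j 0 z \<Omega>" \<Omega>] by (simp add: state_def step.norm_\<Omega>)
    then have "(cmod (state j z))\<^sup>2 \<le> (norm (I.lifts j 0 z \<Omega>))\<^sup>2" by (intro power_mono) auto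
    also have "\<dots> = cmod (state j (adj z o\<^sub>L z))"
      using z by (simp add: I.state_adj_mult norm_power)
    finally show ?thesis .
  qed
  have "K \<ge> 0" unfolding K_def by (intro sum_nonneg) auto
  have powers: "cmod (state j z) ^ (2 ^ n) \<le> K * norm z ^ (2 ^ n)" if "z \<in> Z 0" for n z
    using that
  proof (induction n arbitrary: z)
    case 0
    then show ?case using base by simp
  next
    case (Suc n)
    have "cmod (state j z) ^ (2 ^ Suc n) = ((cmod (state j z))\<^sup>2) ^ (2 ^ n)" by (simp add: power_mult)
    also have "\<dots> \<le> cmod (state j (adj z o\<^sub>L z)) ^ (2 ^ n)"
      using Suc.prems by (intro power_mono square) auto
    also have "\<dots> \<le> K * norm (adj z o\<^sub>L z) ^ (2 ^ n)"
      using Suc.prems by (intro Suc.IH Z_mult Z_adj)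
    also have "\<dots> \<le> K * ((norm z)\<^sup>2) ^ (2 ^ n)"
    proof (intro mult_left_mono power_mono \<open>K \<ge> 0\<close>)
      have "norm (adj z o\<^sub>L z) \<le> norm (adj z) * norm z" by (rule norm_blinfun_compose)
      also have "\<dots> \<le> norm z * norm z"
        using A.clinear [OF Z_B [OF Suc.prems]] by (intro mult_right_mono norm_adj_le) auto
      finally show "norm (adj z o\<^sub>L z) \<le> (norm z)\<^sup>2" by (simp add: power2_eq_square)
    qed simp
    finally show ?case by (simp add: power_mult)
  qed
  show ?thesis by (rule le_of_power_le [OF norm_ge_zero norm_ge_zero powers [OF z]])
qed

text \<open>Cesaro means, whose limit points are invariant under the transition operator.\<close>

definition average :: "nat \<Rightarrow> 'h operator \<Rightarrow> complex" where
  "average n z = (\<Sum>j<Suc n. state j z) / of_nat (Suc n)"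

lemma average_bound: "z \<in> Z 0 \<Longrightarrow> cmod (average n z) \<le> norm z"
proof -
  assume z: "z \<in> Z 0"
  have "cmod (\<Sum>j<Suc n. state j z) \<le> of_nat (card {..<Suc n}) * norm z"
    using state_bound [OF z] by (intro sum_norm_bound)
  then show ?thesis by (simp add: average_def norm_divide divide_le_eq mult.commute del: of_nat_Suc)
qed

lemma average_scale: "x \<in> Z 0 \<Longrightarrow> average n (scalar_op c o\<^sub>L x) = c * average n x"
  by (simp add: average_def state_scale sum_distrib_left[symmetric] del: sum.lessThan_Suc)

lemma average_add: "\<lbrakk>x \<in> Z 0; y \<in> Z 0\<rbrakk> \<Longrightarrow> average n (x + y) = average n x + average n y"
  by (simp add: average_def state_add sum.distrib add_divide_distrib del: sum.lessThan_Suc)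

lemma average_limit_exists: "\<exists>\<psi> r. strict_mono r \<and> (\<forall>z\<in>Z 0. (\<lambda>m. average (r m) z) \<longlonglongrightarrow> \<psi> z)"
proof -
  obtain G where "orthonormal_basis A.L2 (Z 0) G" by (rule I.V_basis)
  note G = orthonormal_basisD(1,3) [OF this] and ex = orthonormal_basisD(5) [OF this]
  have "\<exists>r. strict_mono r \<and> (\<forall>g\<in>G. convergent (\<lambda>n. average (r n) g))"
    using G average_bound by (intro common_convergent_subsequence [where a = "\<lambda>g n. average n g" and K = norm]) auto
  then obtain r where r: "strict_mono r" "\<And>g. g \<in> G \<Longrightarrow> convergent (\<lambda>n. average (r n) g)" by blast
  have "convergent (\<lambda>m. average (r m) z)" if z: "z \<in> Z 0" for z
  proof -
    define a where "a = A.L2 z"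
    have z: "z = (\<Sum>g\<in>G. scalar_op (a g) o\<^sub>L g)" unfolding a_def by (rule ex [OF z])
    have "average n z = (\<Sum>g\<in>G. a g * average n g)" for n
    proof -
      have "(\<Sum>j<Suc n. state j z) = (\<Sum>j<Suc n. \<Sum>g\<in>G. a g * state j g)"
        unfolding z by (intro sum.cong refl state_sum G)
      also have "\<dots> = (\<Sum>g\<in>G. a g * (\<Sum>j<Suc n. state j g))"
        unfolding sum_distrib_left by (rule sum.swap)
      finally have "average n z = (\<Sum>g\<in>G. a g * (\<Sum>j<Suc n. state j g)) / of_nat (Suc n)"
        by (simp only: average_def)
      then show ?thesis
        by (simp add: average_def sum_divide_distrib [of _ G] del: sum.lessThan_Suc of_nat_Suc)
    qed
    then show ?thesis using r(2) by (auto intro!: convergent_sum convergent_mult convergent_const)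
  qed
  then have "\<forall>z\<in>Z 0. (\<lambda>m. average (r m) z) \<longlonglongrightarrow> lim (\<lambda>m. average (r m) z)"
    by (simp add: convergent_LIMSEQ_iff)
  then show ?thesis using r(1) by (intro exI conjI)
qed

definition limit_state :: "'h operator \<Rightarrow> complex" where
  "limit_state = (SOME \<psi>. \<exists>r. strict_mono r \<and> (\<forall>z\<in>Z 0. (\<lambda>m. average (r m) z) \<longlonglongrightarrow> \<psi> z))"

lemma limit_state_converges:
  obtains r where "strict_mono r" "\<And>z. z \<in> Z 0 \<Longrightarrow> (\<lambda>m. average (r m) z) \<longlonglongrightarrow> limit_state z"
proof -
  have "\<exists>r. strict_mono r \<and> (\<forall>z\<in>Z 0. (\<lambda>m. average (r m) z) \<longlonglongrightarrow> limit_state z)"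
    unfolding limit_state_def by (rule someI_ex [OF average_limit_exists])
  then show thesis using that by blast
qed

lemma limit_state_add: "\<lbrakk>x \<in> Z 0; y \<in> Z 0\<rbrakk> \<Longrightarrow> limit_state (x + y) = limit_state x + limit_state y"
proof -
  assume xy: "x \<in> Z 0" "y \<in> Z 0"
  obtain r where r: "\<And>z. z \<in> Z 0 \<Longrightarrow> (\<lambda>m. average (r m) z) \<longlonglongrightarrow> limit_state z"
    using limit_state_converges by blast
  have "(\<lambda>m. average (r m) (x + y)) \<longlonglongrightarrow> limit_state x + limit_state y"
    using tendsto_add [OF r r] xy by (simp add: average_add)
  then show ?thesis using r [OF Z_add [OF xy]] LIMSEQ_unique by blast
qed

lemma limit_state_scale: "x \<in> Z 0 \<Longrightarrow> limit_state (scalar_op c o\<^sub>L x) = c * limit_state x"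
proof -
  assume x: "x \<in> Z 0"
  obtain r where r: "\<And>z. z \<in> Z 0 \<Longrightarrow> (\<lambda>m. average (r m) z) \<longlonglongrightarrow> limit_state z"
    using limit_state_converges by blast
  have "(\<lambda>m. average (r m) (scalar_op c o\<^sub>L x)) \<longlonglongrightarrow> c * limit_state x"
    using tendsto_mult [OF tendsto_const r, of x c] x by (simp add: average_scale)
  then show ?thesis using r [OF Z_scale [OF x]] LIMSEQ_unique by blast
qed

lemma limit_state_diff: "\<lbrakk>x \<in> Z 0; y \<in> Z 0\<rbrakk> \<Longrightarrow> limit_state (x - y) = limit_state x - limit_state y"
  using limit_state_add [OF Z_diff, of x y y] by simp

lemma limit_state_zero: "limit_state 0 = 0"
  using limit_state_scale [OF Z_id, of 0] by simp

lemma limit_state_id: "limit_state id_blinfun = 1"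
proof -
  obtain r where r: "\<And>z. z \<in> Z 0 \<Longrightarrow> (\<lambda>m. average (r m) z) \<longlonglongrightarrow> limit_state z"
    using limit_state_converges by blast
  have "average n id_blinfun = 1" for n
    by (simp add: average_def state_id del: sum.lessThan_Suc of_nat_Suc)
  then show ?thesis using LIMSEQ_unique [OF r [OF Z_id]] by simp
qed

lemma limit_state_adj: "z \<in> Z 0 \<Longrightarrow> limit_state (adj z) = cnj (limit_state z)"
proof -
  assume z: "z \<in> Z 0"
  obtain r where r: "\<And>z. z \<in> Z 0 \<Longrightarrow> (\<lambda>m. average (r m) z) \<longlonglongrightarrow> limit_state z"
    using limit_state_converges by blast
  have "average n (adj z) = cnj (average n z)" for n
    using z by (simp add: average_def state_adj del: sum.lessThan_Suc)
  then have "(\<lambda>m. average (r m) (adj z)) \<longlonglongrightarrow> cnj (limit_state z)"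
    using tendsto_cnj [OF r [OF z]] by simp
  then show ?thesis using r [OF Z_adj [OF z]] LIMSEQ_unique by blast
qed

lemma limit_state_bound: "z \<in> Z 0 \<Longrightarrow> cmod (limit_state z) \<le> norm z"
proof -
  assume z: "z \<in> Z 0"
  obtain r where r: "\<And>z. z \<in> Z 0 \<Longrightarrow> (\<lambda>m. average (r m) z) \<longlonglongrightarrow> limit_state z"
    using limit_state_converges by blast
  show ?thesis
    using tendsto_norm [OF r [OF z]] by (rule LIMSEQ_le_const2) (use average_bound [OF z] in blast)
qed

lemma limit_state_nonneg:
  assumes z: "z \<in> Z 0" and "\<And>j. 0 \<le> Re (state j z)"
  shows "0 \<le> Re (limit_state z)"
proof -
  obtain r where r: "\<And>z. z \<in> Z 0 \<Longrightarrow> (\<lambda>m. average (r m) z) \<longlonglongrightarrow> limit_state z"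
    using limit_state_converges by blast
  have "0 \<le> Re (average n z)" for n
    unfolding average_def of_nat_Suc
    using assms(2) by (auto simp: Re_divide_of_nat sum_nonneg simp flip: of_nat_Suc intro!: divide_nonneg_nonneg)
  then show ?thesis
    using tendsto_Re [OF r [OF z]] by (intro LIMSEQ_le_const) auto
qed

text \<open>The transition operator shifts \<open>state j\<close> to \<open>state (j + 1)\<close>, so the Cesaro sums change by two terms only.\<close>

lemma limit_state_invariant: "z \<in> Z 0 \<Longrightarrow> limit_state (I.transition z) = limit_state z"
proof -
  assume z: "z \<in> Z 0"
  have Sz: "I.transition z \<in> Z 0" by (rule I.transition_V [OF z])
  obtain r where mono: "strict_mono r" and r: "\<And>z. z \<in> Z 0 \<Longrightarrow> (\<lambda>m. average (r m) z) \<longlonglongrightarrow> limit_state z"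
    using limit_state_converges by blast
  have diff: "average n (I.transition z) - average n z = (state (Suc n) z - state 0 z) / of_nat (Suc n)" for n
  proof -
    have "(\<Sum>j<Suc n. state j (I.transition z)) - (\<Sum>j<Suc n. state j z) = state (Suc n) z - state 0 z"
      using z sum_lessThan_telescope [of "\<lambda>j. state j z" "Suc n"]
      by (simp add: state_transition sum_subtractf [symmetric] del: sum.lessThan_Suc)
    then show ?thesis by (simp add: average_def diff_divide_distrib [symmetric] del: sum.lessThan_Suc)
  qed
  have "(\<lambda>m. average (r m) (I.transition z) - average (r m) z) \<longlonglongrightarrow> 0"
  proof (rule Lim_null_comparison)
    show "\<forall>\<^sub>F m in sequentially. norm (average (r m) (I.transition z) - average (r m) z) \<le> 2 * norm z * inverse (of_nat (Suc (r m)))"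
    proof (rule always_eventually, rule allI)
      fix m
      have "cmod (state (Suc (r m)) z - state 0 z) \<le> 2 * norm z"
        using norm_triangle_ineq4 [of "state (Suc (r m)) z" "state 0 z"] state_bound [OF z, of "Suc (r m)"] state_bound [OF z, of 0]
        by linarith
      then show "norm (average (r m) (I.transition z) - average (r m) z) \<le> 2 * norm z * inverse (of_nat (Suc (r m)))"
        unfolding diff divide_inverse norm_mult norm_inverse norm_of_nat by (intro mult_right_mono) auto
    qed
    have "(\<lambda>n. 2 * norm z * inverse (real (Suc n))) \<longlonglongrightarrow> 2 * norm z * 0"
      by (intro tendsto_intros LIMSEQ_inverse_real_of_nat)
    from LIMSEQ_subseq_LIMSEQ [OF this mono]
    show "(\<lambda>m. 2 * norm z * inverse (of_nat (Suc (r m)))) \<longlonglongrightarrow> 0" by (simp add: o_def)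
  qed
  moreover have "(\<lambda>m. average (r m) (I.transition z) - average (r m) z) \<longlonglongrightarrow> limit_state (I.transition z) - limit_state z"
    by (intro tendsto_diff r z Sz)
  ultimately show ?thesis using LIMSEQ_unique by fastforce
qed

end

section \<open>Connectedness and the inner implementation\<close>

text \<open>Connectedness enters twice: in the faithfulness of the invariant state and in the last step, where a fixed
  intertwiner is shown to be a multiple of a unitary.\<close>

locale connected_tower_automorphism = tower_automorphism +
  assumes connected: "connected_inclusion (B 0) (B 1)"
begin

lemma central_scalar:
  assumes x: "x \<in> B 0" and "\<And>y. y \<in> B 1 \<Longrightarrow> x o\<^sub>L y = y o\<^sub>L x"
  obtains c where "x = scalar_op c"
proof -
  have "x \<in> commutant (B 1)" using assms A.clinear [OF x] by (simp add: commutant_def)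
  then have "x \<in> range scalar_op" using x connected unfolding connected_inclusion_def by blast
  then show thesis using that by blast
qed

text \<open>The form of the functional with density \<open>z\<close>. Positivity of \<open>z\<close> enters through the values of the state, which is
  how it is known for variances.\<close>

lemma limit_state_form:
  assumes z: "z \<in> Z 0" and adj: "adj z = z"
    and pos: "\<And>w. w \<in> Z 0 \<Longrightarrow> 0 \<le> Re (limit_state ((adj w o\<^sub>L w) o\<^sub>L z))"
  shows "positive_form (Z 0) (\<lambda>a b. limit_state ((adj b o\<^sub>L a) o\<^sub>L z))"
proof
  show "op.subspace (Z 0)" by (rule I.V_subspace)
  show "limit_state ((adj c o\<^sub>L (a + b)) o\<^sub>L z) = limit_state ((adj c o\<^sub>L a) o\<^sub>L z) + limit_state ((adj c o\<^sub>L b) o\<^sub>L z)"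
    if "a \<in> Z 0" "b \<in> Z 0" "c \<in> Z 0" for a b c
    using that z limit_state_add [OF Z_mult [OF Z_mult [OF Z_adj]] Z_mult [OF Z_mult [OF Z_adj]], of c a z c b z]
    by (simp add: blinfun_compose.add_left blinfun_compose.add_right)
  show "limit_state ((adj b o\<^sub>L (scalar_op c o\<^sub>L a)) o\<^sub>L z) = c * limit_state ((adj b o\<^sub>L a) o\<^sub>L z)"
    if "a \<in> Z 0" "b \<in> Z 0" for a b c
    using that z A.clinear [OF Z_B [OF Z_adj]] limit_state_scale [OF Z_mult [OF Z_mult [OF Z_adj]], of b a z c]
    by (simp add: op_scale_right op_scale_left)
  show "limit_state ((adj a o\<^sub>L b) o\<^sub>L z) = cnj (limit_state ((adj b o\<^sub>L a) o\<^sub>L z))"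
    if a: "a \<in> Z 0" and b: "b \<in> Z 0" for a b
  proof -
    have "adj ((adj b o\<^sub>L a) o\<^sub>L z) = z o\<^sub>L (adj a o\<^sub>L b)"
      using A.clinear [OF Z_B [OF a]] A.clinear [OF Z_B [OF b]] A.clinear [OF Z_B [OF z]]
      by (simp add: adj_compose clinear_ops_adj clinear_ops_compose adj)
    also have "\<dots> = (adj a o\<^sub>L b) o\<^sub>L z" using a b z by (intro Z_commute Z_B [OF Z_mult] Z_adj)
    finally show ?thesis
      using limit_state_adj [OF Z_mult [OF Z_mult [OF Z_adj [OF b] a] z]] by simp
  qed
  show "0 \<le> Re (limit_state ((adj w o\<^sub>L w) o\<^sub>L z))" if "w \<in> Z 0" for w using pos that .
qed

lemma limit_state_square_nonneg:
  assumes "v \<in> V 0" "w \<in> Z 0"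
  shows "0 \<le> Re (limit_state ((adj w o\<^sub>L w) o\<^sub>L (adj v o\<^sub>L v)))"
  using assms by (intro limit_state_nonneg state_square_nonneg Z_mult Z_adj V_adj_mult)

lemma limit_state_variance_nonneg:
  assumes "v \<in> V 0" "w \<in> Z 0"
  shows "0 \<le> Re (limit_state ((adj w o\<^sub>L w) o\<^sub>L variance v))"
  using assms by (intro limit_state_nonneg state_variance_nonneg Z_mult Z_adj variance_Z)

lemma Z_positive_nonneg: "w \<in> Z 0 \<Longrightarrow> 0 \<le> Re (limit_state ((adj w o\<^sub>L w) o\<^sub>L id_blinfun))"
  using I.state_square_nonneg [OF _ Z_id, of w] by (intro limit_state_nonneg) (simp_all add: Z_mult Z_adj)

text \<open>The null ideal of the invariant state is generated by a projection \<open>p\<close>. Invariance gives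
  \<open>transition p = p transition p\<close>, hence the lift of \<open>p\<close> lies under \<open>p\<close>. Then the complement of \<open>p\<close> commutes
  with \<open>B 1\<close>, and connectedness leaves only \<open>p = 0\<close>.\<close>

lemma null_ideal_trivial:
  assumes z: "z \<in> Z 0" and null: "\<And>y. y \<in> Z 0 \<Longrightarrow> limit_state (y o\<^sub>L z) = 0"
  shows "z = 0"
proof -
  define J where "J = {z \<in> Z 0. \<forall>y\<in>Z 0. limit_state (y o\<^sub>L z) = 0}"
  have JZ: "J \<subseteq> Z 0" by (auto simp: J_def)
  have subJ: "op.subspace J"
  proof (rule op.subspaceI)
    show "0 \<in> J" by (simp add: J_def Z_zero limit_state_zero)
    show "x + y \<in> J" if "x \<in> J" "y \<in> J" for x y
      using that by (auto simp: J_def Z_add Z_mult blinfun_compose.add_right limit_state_add)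
    show "scalar_op c o\<^sub>L x \<in> J" if "x \<in> J" for c x
      using that A.clinear [OF Z_B] by (auto simp: J_def Z_scale Z_mult op_scale_right limit_state_scale)
  qed
  have leftJ: "a o\<^sub>L x \<in> J" if "a \<in> Z 0" "x \<in> J" for a x
    using that Z_mult unfolding J_def by (auto simp flip: compose_assoc)
  have starJ: "adj x \<in> J" if x: "x \<in> J" for x
  proof -
    have xZ: "x \<in> Z 0" using x JZ by blast
    have "limit_state (y o\<^sub>L adj x) = 0" if y: "y \<in> Z 0" for y
    proof -
      have "y o\<^sub>L adj x = adj (x o\<^sub>L adj y)"
        using A.clinear [OF Z_B [OF y]] A.clinear [OF Z_B [OF xZ]] by (simp add: adj_compose clinear_ops_adj)
      also have "x o\<^sub>L adj y = adj y o\<^sub>L x" using xZ y by (intro Z_commute Z_B Z_adj)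
      finally have "limit_state (y o\<^sub>L adj x) = cnj (limit_state (adj y o\<^sub>L x))"
        using limit_state_adj [OF Z_mult [OF Z_adj [OF y] xZ]] by simp
      then show ?thesis using x Z_adj [OF y] by (simp add: J_def)
    qed
    then show ?thesis using Z_adj [OF xZ] by (simp add: J_def)
  qed
  obtain F where F: "finite F" "Z 0 \<subseteq> op.span F" by (rule I.V_finite_dim)
  have definite: "x = 0" if "x \<in> Z 0" "A.L2 x x = 0" for x
    using that by (intro A.separating [OF Z_B]) auto
  have adjoint: "A.L2 (a o\<^sub>L x) y = A.L2 x (adj a o\<^sub>L y)" if "a \<in> Z 0" "x \<in> Z 0" "y \<in> Z 0" for a x y
    using A.clinear [OF Z_B [OF that(1)]] by (simp add: cinner_adj_right)
  obtain p where p: "p \<in> J" "\<forall>x\<in>J. x o\<^sub>L p = x" "adj p = p" "p o\<^sub>L p = p"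
    by (rule ideal_unit [OF Z_alg I.V_form definite F adjoint JZ subJ leftJ starJ])
  have pZ: "p \<in> Z 0" using p(1) JZ by blast
  have \<psi>p: "limit_state p = 0" using p(1) Z_id [of 0] by (auto simp: J_def)
  interpret f: positive_form "Z 0" "\<lambda>a b. limit_state ((adj b o\<^sub>L a) o\<^sub>L id_blinfun)"
    using Z_positive_nonneg by (intro limit_state_form Z_id) auto
  let ?T = "I.transition p" and ?P = "I.lift 0 p"
  have TZ: "?T \<in> Z 0" by (rule I.transition_V [OF pZ])
  have T_adj: "adj ?T = ?T" using transition_adj [OF pZ] p(3) by simp
  have TJ: "?T \<in> J"
  proof -
    have "limit_state (I.variance p) = limit_state ?T - limit_state (adj ?T o\<^sub>L ?T)"
      using p(3,4) TZ pZ by (simp add: I.variance_def limit_state_diff Z_mult T_adj)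
    moreover have "0 \<le> Re (limit_state (I.variance p))"
      using limit_state_nonneg [OF I.variance_Z [OF pZ]] I.state_variance_nonneg [OF pZ Z_id] by simp
    moreover have "limit_state ?T = 0" using limit_state_invariant [OF pZ] \<psi>p by simp
    ultimately have "Re (limit_state (adj ?T o\<^sub>L ?T)) \<le> 0" by simp
    then have "limit_state ((adj ?T o\<^sub>L ?T) o\<^sub>L id_blinfun) = 0"
      using f.positive [OF TZ] f.self_real [OF TZ] by (simp add: complex_eq_iff)
    then have T0: "limit_state (?T o\<^sub>L y) = 0" if "y \<in> Z 0" for y
      using f.null_right [OF TZ that] by (simp add: T_adj)
    have "limit_state (y o\<^sub>L ?T) = 0" if "y \<in> Z 0" for y
      using T0 [OF that] Z_commute [OF TZ Z_B [OF that]] by simp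
    then show ?thesis using TZ by (simp add: J_def)
  qed
  define r where "r = id_blinfun - p"
  have rZ: "r \<in> Z 0" unfolding r_def by (intro Z_diff Z_id pZ)
  have r_adj: "adj r = r" using A.clinear [OF Z_B [OF pZ]] by (simp add: r_def adj_diff p(3))
  have rr: "r o\<^sub>L r = r" by (simp add: r_def blinfun_compose.diff_left blinfun_compose.diff_right p(4))
  have PZ: "?P \<in> Z (Suc (Suc 0))" by (rule I.lift_V [OF pZ])
  have P_adj: "adj ?P = ?P" using lifts_adj [OF pZ, of 1] p(3) by simp
  have PP: "?P o\<^sub>L ?P = ?P" using lifts_mult [OF pZ pZ, of 1] p(4) by simp
  have rB2: "r \<in> B (Suc (Suc 0))" using B_mono [OF Z_B [OF rZ]] by simp
  have rP: "r o\<^sub>L ?P = 0"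
  proof -
    have "r o\<^sub>L ?T = 0"
    proof -
      have "?T o\<^sub>L p = ?T" using p(2) TJ by blast
      then have "p o\<^sub>L ?T = ?T" using Z_commute [OF pZ Z_B [OF TZ]] by simp
      then show ?thesis by (simp add: r_def blinfun_compose.diff_left)
    qed
    then have "E 0 (r o\<^sub>L ?P) = 0"
      using A.cexp_left [OF Z_B [OF rZ], of ?P] by (simp add: I.transition_def)
    then have tr0: "trace (r o\<^sub>L ?P) = 0" using A.cexp_trace [of 0 "r o\<^sub>L ?P"] by simp
    have "adj (r o\<^sub>L ?P) o\<^sub>L (r o\<^sub>L ?P) = ?P o\<^sub>L (r o\<^sub>L r) o\<^sub>L ?P"
      using A.clinear [OF Z_B [OF rZ]] A.clinear [OF Z_B [OF PZ]]
      by (simp add: adj_compose r_adj P_adj compose_assoc)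
    also have "\<dots> = r o\<^sub>L (?P o\<^sub>L ?P)"
      unfolding rr using Z_commute [OF PZ rB2] by (simp add: compose_assoc)
    finally have sq: "adj (r o\<^sub>L ?P) o\<^sub>L (r o\<^sub>L ?P) = r o\<^sub>L ?P" unfolding PP .
    have rPB: "r o\<^sub>L ?P \<in> B (Suc (Suc 0))" by (intro A.mult_in rB2 Z_B PZ)
    have "cinner ((r o\<^sub>L ?P) \<Omega>) ((r o\<^sub>L ?P) \<Omega>) = trace (adj (r o\<^sub>L ?P) o\<^sub>L (r o\<^sub>L ?P))"
      using cinner_adj_left [OF A.clinear [OF rPB]] by simp
    then have "(r o\<^sub>L ?P) \<Omega> = 0" using tr0 unfolding sq by simp
    then show ?thesis by (rule A.separating [OF rPB])
  qed
  have jp: "jp 0 o\<^sub>L ?P = jp 0 o\<^sub>L p"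
    using I.lift_jp [OF pZ] I.V_jp [OF PZ] step.e_commute [OF Z_B [OF pZ]] by simp
  have rxr: "x o\<^sub>L r = r o\<^sub>L (x o\<^sub>L r)" if x: "x \<in> B 1" for x
  proof -
    have x2: "x \<in> B (Suc (Suc 0))" using B_mono [OF x] by simp
    have pB1: "p \<in> B (Suc 0)" and rB1: "r \<in> B (Suc 0)" using B_mono [OF Z_B [OF pZ]] B_mono [OF Z_B [OF rZ]] by auto
    have "?P o\<^sub>L (x o\<^sub>L r) = x o\<^sub>L (r o\<^sub>L ?P)"
      using Z_commute [OF PZ x2] Z_commute [OF PZ rB2] by (metis compose_assoc)
    then have "?P o\<^sub>L (x o\<^sub>L r) = 0" by (simp add: rP)
    then have "jp 0 o\<^sub>L (p o\<^sub>L (x o\<^sub>L r)) = 0" using jp by (metis compose_assoc blinfun_compose.zero_right)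
    moreover have "p o\<^sub>L (x o\<^sub>L r) \<in> B (Suc 0)" using x pB1 rB1 by (auto intro: A.mult_in)
    ultimately have "p o\<^sub>L (x o\<^sub>L r) = 0" by (rule step.e_compose_eq_0 [rotated])
    then show ?thesis by (simp add: r_def blinfun_compose.diff_left)
  qed
  have "r o\<^sub>L x = x o\<^sub>L r" if x: "x \<in> B 1" for x
  proof -
    have "adj (adj x o\<^sub>L r) = adj (r o\<^sub>L (adj x o\<^sub>L r))" using rxr [OF A.adj_in [OF x]] by simp
    then have "r o\<^sub>L x = r o\<^sub>L (x o\<^sub>L r)"
      using A.clinear [OF Z_B [OF rZ]] A.clinear [OF x]
      by (simp add: adj_compose r_adj clinear_ops_adj clinear_ops_compose compose_assoc)
    then show ?thesis using rxr [OF x] by simp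
  qed
  then obtain c where c: "r = scalar_op c" using central_scalar [OF Z_B [OF rZ]] by blast
  have "limit_state r = 1" using \<psi>p by (simp add: r_def limit_state_diff Z_id pZ limit_state_id)
  moreover have "limit_state r = c" using limit_state_scale [OF Z_id, of c] by (simp add: c limit_state_id)
  ultimately have "p = 0" using c by (simp add: r_def)
  moreover have "z \<in> J" using z null by (simp add: J_def)
  ultimately show ?thesis using p(2) by force
qed

text \<open>The identity is a null vector of the form with density \<open>z\<close>, hence \<open>z\<close> lies in the null ideal.\<close>

lemma limit_state_faithful:
  assumes z: "z \<in> Z 0" "adj z = z"
    and pos: "\<And>w. w \<in> Z 0 \<Longrightarrow> 0 \<le> Re (limit_state ((adj w o\<^sub>L w) o\<^sub>L z))"
    and null: "limit_state z = 0"
  shows "z = 0"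
proof (rule null_ideal_trivial [OF z(1)])
  interpret f: positive_form "Z 0" "\<lambda>a b. limit_state ((adj b o\<^sub>L a) o\<^sub>L z)"
    using z pos by (rule limit_state_form)
  fix y assume "y \<in> Z 0"
  then show "limit_state (y o\<^sub>L z) = 0"
    using f.null_right [OF Z_id, of y] null by simp
qed

definition energy :: "'a operator \<Rightarrow> real" where
  "energy v = Re (limit_state (adj v o\<^sub>L v))"

lemma limit_state_energy: "v \<in> V 0 \<Longrightarrow> limit_state (adj v o\<^sub>L v) = complex_of_real (energy v)"
  using limit_state_adj [OF V_adj_mult [of v 0 v]] adj_adj_mult [of v 0]
  by (simp add: energy_def complex_eq_iff)

lemma energy_nonneg: "v \<in> V 0 \<Longrightarrow> 0 \<le> energy v"
  using limit_state_square_nonneg [OF _ Z_id, of v] by (simp add: energy_def)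

lemma energy_eq_0: assumes v: "v \<in> V 0" and "energy v = 0" shows "v = 0"
proof -
  have "adj v o\<^sub>L v = 0"
    using assms limit_state_energy [OF v]
    by (intro limit_state_faithful V_adj_mult adj_adj_mult limit_state_square_nonneg) auto
  then have "cinner (v \<Omega>) (v \<Omega>) = 0"
    using cinner_adj_left [OF A.clinear [OF V_B [OF v]], of "v \<Omega>" \<Omega>]
    by (metis blinfun_apply_blinfun_compose blinfun.zero_left cinner_zero_left)
  then show ?thesis using A.separating [OF V_B [OF v]] by simp
qed

lemma limit_state_variance: "v \<in> V 0 \<Longrightarrow> limit_state (variance v) = complex_of_real (energy v - energy (transition v))"
  using limit_state_diff [OF I.transition_V [OF V_adj_mult [of v 0 v]] V_adj_mult [of "transition v" 0 "transition v"]]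
    limit_state_invariant [OF V_adj_mult [of v 0 v]] limit_state_energy transition_V
  by (simp add: variance_def)

lemma energy_transition_le: assumes v: "v \<in> V 0" shows "energy (transition v) \<le> energy v"
  using limit_state_variance_nonneg [OF v Z_id] limit_state_variance [OF v] by simp

text \<open>If no energy is lost, then \<open>variance v = 0\<close>. This is the expectation of \<open>D\<^sup>* D\<close> for the difference \<open>D\<close> of both
  sides.\<close>

lemma lift_fixed:
  assumes v: "v \<in> V 0" and eq: "energy (transition v) = energy v"
  shows "lift 0 v = transition v"
proof -
  let ?X = "lift 0 v" and ?Y = "transition v"
  have XB: "?X \<in> B (Suc (Suc 0))" by (rule V_B [OF lift_V [OF v]])
  have YB: "?Y \<in> B (Suc (Suc 0))" using B_mono [OF V_B [OF transition_V [OF v]]] by simp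
  have D: "?X - ?Y \<in> B (Suc (Suc 0))" by (intro A.diff_in XB YB)
  have "variance v = 0"
    using v eq limit_state_variance [OF v]
    by (intro limit_state_faithful variance_Z variance_adj limit_state_variance_nonneg) auto
  moreover have "variance v = E 0 (adj (?X - ?Y) o\<^sub>L (?X - ?Y))"
    using E_variance [OF XB, of 0] lift_adj_mult [OF v v]
    by (simp add: variance_def transition_def I.transition_def)
  ultimately have "trace (adj (?X - ?Y) o\<^sub>L (?X - ?Y)) = 0"
    using A.cexp_trace [of 0 "adj (?X - ?Y) o\<^sub>L (?X - ?Y)"] by simp
  then have "(?X - ?Y) \<Omega> = 0"
    using cinner_adj_left [OF A.clinear [OF D], of "(?X - ?Y) \<Omega>" \<Omega>] by simp
  then have "?X - ?Y = 0" by (rule A.separating [OF D])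
  then show ?thesis by simp
qed

lemma transition_sum:
  assumes "finite G" "\<And>g. g \<in> G \<Longrightarrow> g \<in> V 0"
  shows "transition (\<Sum>g\<in>G. scalar_op (a g) o\<^sub>L g) = (\<Sum>g\<in>G. scalar_op (a g) o\<^sub>L transition g)"
  using assms
proof (induction G)
  case empty
  show ?case using transition_scale [OF op.subspace_0 [OF V_subspace], of 0] by simp
next
  case (insert g G)
  then show ?case by (simp add: transition_add transition_scale V_sum op.subspace_scale [OF V_subspace])
qed

lemma energy_tendsto:
  assumes x: "\<And>m. x m \<in> V 0" and l: "l \<in> V 0" and lim: "x \<longlonglongrightarrow> l"
  shows "(\<lambda>m. energy (x m)) \<longlonglongrightarrow> energy l"
proof -
  have cl: "y \<in> clinear_ops" if "y \<in> V 0" for y using A.clinear V_B that by blast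
  have n1: "(\<lambda>m. norm (x m - l)) \<longlonglongrightarrow> 0" using lim by (simp add: LIM_zero_iff tendsto_norm_zero_iff)
  have n2: "norm (adj (x m) - adj l) \<le> norm (x m - l)" for m
    using norm_adj_le [of "x m - l"] cl [OF op.subspace_diff [OF V_subspace x l]] cl [OF x] cl [OF l]
    by (simp add: adj_diff)
  have "(\<lambda>m. adj (x m) - adj l) \<longlonglongrightarrow> 0"
    by (rule Lim_null_comparison [OF always_eventually [OF allI [OF n2]] n1])
  then have "(\<lambda>m. adj (x m)) \<longlonglongrightarrow> adj l" by (simp add: LIM_zero_iff)
  then have "(\<lambda>m. adj (x m) o\<^sub>L x m) \<longlonglongrightarrow> (adj l o\<^sub>L l)"
    using lim by (intro blinfun_compose.tendsto)
  then have e1: "(\<lambda>m. norm ((adj (x m) o\<^sub>L x m) - (adj l o\<^sub>L l))) \<longlonglongrightarrow> 0"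
    by (simp add: LIM_zero_iff tendsto_norm_zero_iff)
  have e2: "norm (energy (x m) - energy l) \<le> norm ((adj (x m) o\<^sub>L x m) - (adj l o\<^sub>L l))" for m
  proof -
    have "energy (x m) - energy l = Re (limit_state ((adj (x m) o\<^sub>L x m) - (adj l o\<^sub>L l)))"
      using x l by (simp add: energy_def limit_state_diff V_adj_mult)
    also have "\<bar>\<dots>\<bar> \<le> cmod (limit_state ((adj (x m) o\<^sub>L x m) - (adj l o\<^sub>L l)))" by (rule abs_Re_le_cmod)
    also have "\<dots> \<le> norm ((adj (x m) o\<^sub>L x m) - (adj l o\<^sub>L l))"
      using x l by (intro limit_state_bound Z_diff V_adj_mult)
    finally show ?thesis by simp
  qed
  have "(\<lambda>m. energy (x m) - energy l) \<longlonglongrightarrow> 0"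
    by (rule Lim_null_comparison [OF always_eventually [OF allI [OF e2]] e1])
  then show ?thesis by (simp add: LIM_zero_iff)
qed

lemma energy_le: assumes v: "v \<in> V 0" shows "energy v \<le> (norm v)\<^sup>2"
proof -
  have "energy v \<le> cmod (limit_state (adj v o\<^sub>L v))" unfolding energy_def by (rule complex_Re_le_cmod)
  also have "\<dots> \<le> norm (adj v o\<^sub>L v)" by (intro limit_state_bound V_adj_mult v)
  also have "\<dots> \<le> norm (adj v) * norm v" by (rule norm_blinfun_compose)
  also have "\<dots> \<le> norm v * norm v"
    using A.clinear [OF V_B [OF v]] by (intro mult_right_mono norm_adj_le) auto
  finally show ?thesis by (simp add: power2_eq_square)
qed

text \<open>Energy increases along a backward orbit of the transition operator, and a limit point of a bounded
  backward orbit loses none.\<close>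

lemma bounded_backward_orbit:
  assumes c: "\<And>j. c j \<in> V 0" and backward: "\<And>j. transition (c (Suc j)) = c j"
    and bounded: "\<And>j. norm (c j \<Omega>) \<le> 1" and nonzero: "c J \<noteq> 0"
  obtains v where "v \<in> V 0" "lift 0 v = transition v" "transition v \<noteq> 0"
proof -
  obtain G where "orthonormal_basis A.L2 (V 0) G" by (rule V_basis)
  note G = orthonormal_basisD(1,3) [OF this] and ex = orthonormal_basisD(5) [OF this]
  have coeff: "cmod (A.L2 (c n) g) \<le> norm (blinfun_apply g \<Omega>)" for n g
  proof -
    have "cmod (A.L2 (c n) g) \<le> norm (c n \<Omega>) * norm (blinfun_apply g \<Omega>)" by (rule norm_cinner_le)
    also have "\<dots> \<le> 1 * norm (blinfun_apply g \<Omega>)" by (intro mult_right_mono bounded) simp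
    finally show ?thesis by simp
  qed
  define K where "K = (\<Sum>g\<in>G. norm (blinfun_apply g \<Omega>) * norm g)"
  have c_norm: "norm (c n) \<le> K" for n
  proof -
    have "norm (c n) = norm (\<Sum>g\<in>G. scalar_op (A.L2 (c n) g) o\<^sub>L g)" by (rule arg_cong [OF ex [OF c]])
    also have "\<dots> \<le> K"
      unfolding K_def
      by (intro sum_norm_le order_trans [OF norm_op_scale_le] mult_right_mono coeff) simp
    finally show ?thesis .
  qed
  have mono: "incseq (\<lambda>n. energy (c n))"
    using energy_transition_le [OF c] backward by (intro incseq_SucI) metis
  have "energy (c n) \<le> K\<^sup>2" for n
    using energy_le [OF c, of n] power_mono [OF c_norm [of n], of 2] by simp
  then obtain L where L: "(\<lambda>n. energy (c n)) \<longlonglongrightarrow> L" "\<And>n. energy (c n) \<le> L"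
    using incseq_convergent [OF mono] by blast
  have "0 < energy (c J)" using energy_nonneg [OF c] energy_eq_0 [OF c] nonzero by (metis less_eq_real_def)
  then have "0 < L" using L(2) [of J] by linarith
  have "\<exists>r. strict_mono r \<and> (\<forall>g\<in>G. convergent (\<lambda>n. A.L2 (c (Suc (r n))) g))"
    using G coeff by (intro common_convergent_subsequence
        [where a = "\<lambda>g n. A.L2 (c (Suc n)) g" and K = "\<lambda>g. norm (blinfun_apply g \<Omega>)"])
  then obtain r where r: "strict_mono r" "\<forall>g\<in>G. convergent (\<lambda>n. A.L2 (c (Suc (r n))) g)" by blast
  define t where "t g = lim (\<lambda>n. A.L2 (c (Suc (r n))) g)" for g
  have t: "(\<lambda>n. A.L2 (c (Suc (r n))) g) \<longlonglongrightarrow> t g" if "g \<in> G" for g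
    using r(2) that by (simp add: t_def convergent_LIMSEQ_iff)
  define v where "v = (\<Sum>g\<in>G. scalar_op (t g) o\<^sub>L g)"
  have v: "v \<in> V 0" unfolding v_def by (intro V_sum G)
  have sub: "strict_mono (\<lambda>n. Suc (r n))" using r(1) by (simp add: strict_mono_def)
  have lim_v: "(\<lambda>n. c (Suc (r n))) \<longlonglongrightarrow> v"
  proof -
    have "(\<lambda>n. \<Sum>g\<in>G. scalar_op (A.L2 (c (Suc (r n))) g) o\<^sub>L g) \<longlonglongrightarrow> v"
      unfolding v_def by (intro tendsto_sum tendsto_op_scale t)
    then show ?thesis unfolding ex [OF c, symmetric] .
  qed
  have lim_Tv: "(\<lambda>n. c (r n)) \<longlonglongrightarrow> transition v"
  proof -
    have "c (r n) = (\<Sum>g\<in>G. scalar_op (A.L2 (c (Suc (r n))) g) o\<^sub>L transition g)" for n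
    proof -
      have "c (r n) = transition (\<Sum>g\<in>G. scalar_op (A.L2 (c (Suc (r n))) g) o\<^sub>L g)"
        unfolding ex [OF c, symmetric] by (rule backward [symmetric])
      then show ?thesis by (simp only: transition_sum [OF G])
    qed
    moreover have "(\<lambda>n. \<Sum>g\<in>G. scalar_op (A.L2 (c (Suc (r n))) g) o\<^sub>L transition g) \<longlonglongrightarrow> transition v"
    proof -
      have "transition v = (\<Sum>g\<in>G. scalar_op (t g) o\<^sub>L transition g)"
        unfolding v_def by (rule transition_sum [OF G])
      then show ?thesis by (simp only:) (intro tendsto_sum tendsto_op_scale t)
    qed
    ultimately show ?thesis by presburger
  qed
  have "energy v = L"
    using LIMSEQ_subseq_LIMSEQ [OF L(1) sub] energy_tendsto [OF c v lim_v] LIMSEQ_unique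
    by (fastforce simp: o_def)
  moreover have "energy (transition v) = L"
    using LIMSEQ_subseq_LIMSEQ [OF L(1) r(1)] energy_tendsto [OF c transition_V [OF v] lim_Tv] LIMSEQ_unique
    by (fastforce simp: o_def)
  moreover have "energy 0 = 0" by (simp add: energy_def limit_state_zero)
  ultimately show thesis
    using that [OF v] lift_fixed [OF v] \<open>0 < L\<close> by force
qed

text \<open>Both \<open>Y\<^sup>* Y\<close> and \<open>Y Y\<^sup>*\<close> lie in \<open>B 0\<close> and commute with \<open>B 1\<close>, so they are scalars.\<close>

lemma unitary_from_fixed:
  assumes Y: "Y \<in> V (Suc (Suc 0))" and Y0: "Y \<in> B 0" and "Y \<noteq> 0"
  obtains u where "u \<in> B 0" "unitary_op u" "\<And>x. x \<in> B 1 \<Longrightarrow> \<theta> x = Ad u x"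
proof -
  have cl: "Y \<in> clinear_ops" by (rule A.clinear [OF Y0])
  have commute: "Y o\<^sub>L x = \<theta> x o\<^sub>L Y" if "x \<in> B 1" for x
    using V_commute [OF Y] B_mono [OF that] by simp
  have "(adj Y o\<^sub>L Y) o\<^sub>L x = x o\<^sub>L (adj Y o\<^sub>L Y)" if "x \<in> B 1" for x
    using Z_commute [OF V_adj_mult [OF Y Y]] B_mono [OF that] by simp
  then obtain c where c: "adj Y o\<^sub>L Y = scalar_op c"
    using central_scalar [OF A.mult_in [OF A.adj_in [OF Y0] Y0]] by blast
  have "(Y o\<^sub>L adj Y) o\<^sub>L y = y o\<^sub>L (Y o\<^sub>L adj Y)" if y: "y \<in> B 1" for y
  proof -
    obtain x where x: "x \<in> B 1" "y = \<theta> x" using y by (rule \<theta>_surj)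
    have "adj (Y o\<^sub>L adj x) = adj (\<theta> (adj x) o\<^sub>L Y)" using commute [OF A.adj_in [OF x(1)]] by simp
    then have "x o\<^sub>L adj Y = adj Y o\<^sub>L \<theta> x"
      using cl A.clinear [OF x(1)] \<theta>_clinear [OF x(1)]
      by (simp add: adj_compose \<theta>_adj [OF x(1)] clinear_ops_adj)
    then show ?thesis unfolding x(2) using commute [OF x(1)] by (metis compose_assoc)
  qed
  then obtain d where d: "Y o\<^sub>L adj Y = scalar_op d"
    using central_scalar [OF A.mult_in [OF Y0 A.adj_in [OF Y0]]] by blast
  have "scalar_op d o\<^sub>L Y = Y o\<^sub>L scalar_op c" unfolding c [symmetric] d [symmetric] by (rule compose_assoc)
  then have "d = c"
    using \<open>Y \<noteq> 0\<close> op.scale_cancel_right by (simp add: scalar_op_commute [OF cl])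
  define s where "s = (norm (Y \<Omega>))\<^sup>2"
  have "c = complex_of_real s"
  proof -
    have "cinner (Y \<Omega>) (Y \<Omega>) = cinner ((adj Y o\<^sub>L Y) \<Omega>) \<Omega>" by (simp add: cinner_adj_left [OF cl])
    also have "\<dots> = c" unfolding c by (simp add: cinner_scaleC_left cinner_self step.norm_\<Omega>)
    finally show ?thesis by (simp add: cinner_self s_def)
  qed
  moreover have "s > 0"
    using \<open>Y \<noteq> 0\<close> A.separating [OF Y0] by (auto simp: s_def)
  ultimately have norm1: "complex_of_real (1 / sqrt s) * (complex_of_real (1 / sqrt s) * c) = 1"
    by (simp flip: of_real_mult)
  define k where "k = complex_of_real (1 / sqrt s)"
  define u where "u = scalar_op k o\<^sub>L Y"
  have u0: "u \<in> B 0" unfolding u_def by (rule A.scale_in [OF Y0])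
  have adj_u: "adj u = scalar_op k o\<^sub>L adj Y" unfolding u_def adj_scale [OF cl] by (simp add: k_def)
  have kk: "scalar_op k o\<^sub>L (scalar_op k o\<^sub>L scalar_op c) = id_blinfun"
    using norm1 [folded k_def] by (intro blinfun_eqI) (simp add: scaleC_scaleC mult.assoc)
  have uu: "adj u o\<^sub>L u = id_blinfun"
    unfolding adj_u unfolding u_def op_scale_left op_scale_right [OF clinear_ops_adj [OF cl]] c by (rule kk)
  have uu': "u o\<^sub>L adj u = id_blinfun"
    unfolding adj_u unfolding u_def op_scale_left op_scale_right [OF cl] d \<open>d = c\<close> by (rule kk)
  have "\<theta> x = Ad u x" if x: "x \<in> B 1" for x
  proof -
    have "u o\<^sub>L x = \<theta> x o\<^sub>L u"
      unfolding u_def op_scale_left commute [OF x] op_scale_right [OF \<theta>_clinear [OF x]] ..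
    then have "Ad u x = \<theta> x o\<^sub>L (u o\<^sub>L adj u)" by (simp add: Ad_def compose_assoc)
    then show ?thesis by (simp add: uu')
  qed
  moreover have "unitary_op u" using A.clinear [OF u0] uu uu' by (simp add: unitary_op_def)
  ultimately show thesis using that u0 by blast
qed

text \<open>The expectations of \<open>w\<close> onto the even levels descend to a backward orbit \<open>c\<close> of the transition operator in \<open>V 0\<close>.
  It is bounded because \<open>w\<close> is a contraction, and not zero because \<open>w \<Omega> \<noteq> 0\<close> cannot be
  orthogonal to \<open>B i \<Omega>\<close> for all \<open>i\<close>.\<close>

lemma inner_implemented_in_B0:
  assumes w: "w \<in> B_inf" "unitary_op w" and Ad: "\<And>x. x \<in> U \<Longrightarrow> \<theta> x = Ad w x"
  obtains u where "u \<in> B 0" "unitary_op u" "\<And>x. x \<in> B 1 \<Longrightarrow> \<theta> x = Ad u x"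
proof -
  have ww: "adj w o\<^sub>L w = id_blinfun" and w_cl: "w \<in> clinear_ops" using w(2) by (auto simp: unitary_op_def)
  have w_norm: "norm (w x) = norm x" for x
  proof -
    have "cinner (w x) (w x) = cinner ((adj w o\<^sub>L w) x) x" by (simp add: cinner_adj_left [OF w_cl])
    then have "(norm (w x))\<^sup>2 = (norm x)\<^sup>2" by (simp add: ww cinner_self flip: of_real_power)
    then show ?thesis by (simp add: power2_eq_iff_nonneg)
  qed
  have commute: "w o\<^sub>L x = \<theta> x o\<^sub>L w" if "x \<in> U" for x
    using Ad [OF that] ww by (simp add: Ad_def compose_assoc)
  have wV: "E k w \<in> V k" for k
  proof -
    have "E k w o\<^sub>L y = \<theta> y o\<^sub>L E k w" if y: "y \<in> B k" for y
    proof -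
      have "E k w o\<^sub>L y = E k (w o\<^sub>L y)" by (rule E_right [OF w(1) y, symmetric])
      also have "w o\<^sub>L y = \<theta> y o\<^sub>L w" using y by (intro commute) auto
      also have "E k \<dots> = \<theta> y o\<^sub>L E k w" using y by (intro A.cexp_left) simp
      finally show ?thesis .
    qed
    then show ?thesis by (simp add: V_def)
  qed
  have contr: "norm (E k w (y \<Omega>)) \<le> norm (y \<Omega>)" if y: "y \<in> B k" for k y
  proof -
    have "norm (E k w (y \<Omega>)) = norm (E k (w o\<^sub>L y) \<Omega>)" using E_right [OF w(1) y] by simp
    also have "\<dots> \<le> norm ((w o\<^sub>L y) \<Omega>)" by (rule A.norm_cexp_le)
    finally show ?thesis by (simp add: w_norm)
  qed
  have "\<forall>j. \<exists>x\<in>V 0. lifts j 0 x = E (2 * j) w"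
    using lifts_surj [of _ 0] wV by simp
  then obtain c where c: "\<And>j. c j \<in> V 0" "\<And>j. lifts j 0 (c j) = E (2 * j) w" by metis
  have backward: "transition (c (Suc j)) = c j" for j
  proof (rule lifts_inj [OF transition_V [OF c(1)] c(1)])
    have "lifts j 0 (transition (c (Suc j))) = E (2 * j) (E (2 * Suc j) w)"
      using lifts_transition [OF c(1), of j "Suc j"] c(2) [of "Suc j"] by simp
    also have "\<dots> = lifts j 0 (c j)" unfolding c(2) by (rule E_E) simp
    finally show "lifts j 0 (transition (c (Suc j))) = lifts j 0 (c j)" .
  qed
  have bounded: "norm (c j \<Omega>) \<le> 1" for j
  proof -
    have "norm (c j (id_blinfun \<Omega>)) \<le> norm (id_blinfun \<Omega>)"
      by (rule contraction_lifts_descends [OF c(1) _ A.id_in, of j]) (simp add: c(2) contr)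
    then show ?thesis by (simp add: step.norm_\<Omega>)
  qed
  have "\<exists>J. c J \<noteq> 0"
  proof (rule ccontr)
    assume "\<nexists>J. c J \<noteq> 0"
    then have zero: "E (2 * j) w = 0" for j
      using c(2) [of j] lifts_scale [OF c(1), where c = 0 and j = j] by simp
    have "w \<Omega> = 0"
    proof (rule orthogonal_U)
      fix y assume "y \<in> U"
      then obtain i where "y \<in> B i" by blast
      then have "y \<in> B (2 * i)" by (rule B_mono) simp
      from A.cexp_inner [OF this, of w] show "cinner (w \<Omega>) (y \<Omega>) = 0" by (simp add: zero)
    qed
    then show False using w_norm [of \<Omega>] step.norm_\<Omega> by simp
  qed
  then obtain J where "c J \<noteq> 0" by blast
  from bounded_backward_orbit [OF c(1) backward bounded this]
  obtain v where v: "v \<in> V 0" "lift 0 v = transition v" "transition v \<noteq> 0" by blast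
  have "transition v \<in> V (Suc (Suc 0))" using lift_V [OF v(1)] v(2) by simp
  then show thesis
    using unitary_from_fixed V_B [OF transition_V [OF v(1)]] v(3) that by blast
qed

end

text \<open>Once \<open>\<theta>\<close> and \<open>Ad u\<close> agree on the tower they agree on the closure: both preserve the inner products of
  \<open>T \<Omega>\<close> with the dense set of vectors \<open>y \<Omega>\<close>.\<close>

lemma (in tower_automorphism) implemented_on_closure:
  assumes u: "u \<in> B 0" "unitary_op u" and U: "\<And>x. x \<in> U \<Longrightarrow> \<theta> x = Ad u x"
    and closed: "\<And>T. T \<in> B_inf \<Longrightarrow> \<theta> T \<in> B_inf"
    and mult: "\<And>S T. \<lbrakk>S \<in> B_inf; T \<in> B_inf\<rbrakk> \<Longrightarrow> \<theta> (S o\<^sub>L T) = \<theta> S o\<^sub>L \<theta> T"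
    and tr: "\<And>T. T \<in> B_inf \<Longrightarrow> trace (\<theta> T) = trace T"
    and T: "T \<in> B_inf"
  shows "\<theta> T = Ad u T"
proof -
  have uU: "u \<in> U" "adj u \<in> U" using u(1) A.adj_in by blast+
  have u_cl: "u \<in> clinear_ops" and uu: "adj u o\<^sub>L u = id_blinfun" using u(2) by (auto simp: unitary_op_def)
  have Ad_in: "Ad u S \<in> B_inf" if "S \<in> B_inf" for S
    unfolding Ad_def using that uU by (intro B_inf_left B_inf_right)
  have trace_Ad: "trace (Ad u S) = trace S" if S: "S \<in> B_inf" for S
  proof -
    have "trace (Ad u S) = cinner (u ((S o\<^sub>L adj u) \<Omega>)) \<Omega>" by (simp add: Ad_def)
    also have "\<dots> = cinner ((S o\<^sub>L adj u) (u \<Omega>)) \<Omega>"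
      using S uU by (intro B_inf_trace [symmetric] B_inf_right)
    also have "\<dots> = trace (S o\<^sub>L (adj u o\<^sub>L u))" by simp
    finally show ?thesis by (simp add: uu)
  qed
  have "(\<theta> T - Ad u T) \<Omega> = 0"
  proof (rule orthogonal_U)
    fix y assume "y \<in> U"
    then obtain i where "y \<in> B i" by blast
    then obtain x where x: "x \<in> B i" "y = \<theta> x" by (rule \<theta>_surj)
    have xU: "x \<in> U" "adj x \<in> U" using x(1) A.adj_in by blast+
    have y_cl: "y \<in> clinear_ops" using \<open>y \<in> B i\<close> A.clinear by blast
    have adj_y: "adj y = \<theta> (adj x)" using x by (simp add: \<theta>_adj)
    have "cinner (\<theta> T \<Omega>) (y \<Omega>) = trace (\<theta> (adj x) o\<^sub>L \<theta> T)"
      using cinner_adj_left [OF y_cl, of "\<theta> T \<Omega>" \<Omega>] by (simp add: adj_y)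
    also have "\<dots> = trace (\<theta> (adj x o\<^sub>L T))" using mult [OF U_B_inf [OF xU(2)] T] by simp
    also have "\<dots> = trace (adj x o\<^sub>L T)" by (intro tr B_inf_left xU T)
    also have "\<dots> = trace (Ad u (adj x o\<^sub>L T))" by (intro trace_Ad [symmetric] B_inf_left xU T)
    also have "Ad u (adj x o\<^sub>L T) = adj y o\<^sub>L Ad u T"
    proof -
      have "adj y o\<^sub>L Ad u T = u o\<^sub>L adj x o\<^sub>L (adj u o\<^sub>L u) o\<^sub>L T o\<^sub>L adj u"
        unfolding adj_y U [OF xU(2)] Ad_def by (simp only: compose_assoc)
      then show ?thesis by (simp add: uu Ad_def compose_assoc)
    qed
    also have "trace \<dots> = cinner (Ad u T \<Omega>) (y \<Omega>)" using cinner_adj_left [OF y_cl] by simp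
    finally show "cinner ((\<theta> T - Ad u T) \<Omega>) (y \<Omega>) = 0"
      by (simp add: blinfun.diff_left cinner_diff_left)
  qed
  then have "\<theta> T - Ad u T = 0"
    by (rule separating_B_inf [OF B_inf_diff [OF closed [OF T] Ad_in [OF T]]])
  then show ?thesis by simp
qed

theorem theorem2p3:
  fixes B :: "nat \<Rightarrow> 'h::complex_hilbert_space operator set"
    and e :: "nat \<Rightarrow> 'h operator"
    and \<Omega> :: 'h
    and \<tau> :: real
    and \<alpha> :: "'h operator \<Rightarrow> 'h operator"
  assumes "connected_inclusion (B 0) (B 1)"
    and "jones_tower (vector_state \<Omega>) B e"
    and "markov_trace \<tau> (vector_state \<Omega>) B e"
    and "cyclic_vector (\<Union>i. B i) \<Omega>"
    and "compatible_automorphism (vector_state \<Omega>) B e \<alpha>"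
  shows "inner_automorphism (tower_closure B) \<alpha> \<longleftrightarrow>
         (\<exists>u\<in>B 0. unitary_op u \<and> (\<forall>x\<in>B 1. \<alpha> x = Ad u x))"
proof -
  interpret markov_tower B e \<Omega> \<tau>
    using assms(2-4) by unfold_locales
  have \<alpha>: "trace_automorphism (vector_state \<Omega>) B_inf \<alpha>" "\<forall>i\<ge>2. \<alpha> (e i) = e i" "\<forall>i. \<alpha> ` B i = B i"
    using assms(5) by (auto simp: compatible_automorphism_def)
  have \<alpha>_inf: "\<alpha> T \<in> B_inf" if "T \<in> B_inf" for T
    using \<alpha>(1) that by (auto simp: trace_automorphism_def bij_betw_def)
  have \<alpha>_hom: "\<alpha> (S + T) = \<alpha> S + \<alpha> T" "\<alpha> (S o\<^sub>L T) = \<alpha> S o\<^sub>L \<alpha> T" if "S \<in> B_inf" "T \<in> B_inf" for S T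
    using \<alpha>(1) that by (auto simp: trace_automorphism_def)
  have \<alpha>_star: "\<alpha> (adj T) = adj (\<alpha> T)" "trace (\<alpha> T) = trace T" "\<alpha> (scalar_op c o\<^sub>L T) = scalar_op c o\<^sub>L \<alpha> T"
    if "T \<in> B_inf" for T c
    using \<alpha>(1) that by (auto simp: trace_automorphism_def vector_state_def)
  have inf: "x \<in> B_inf" if "x \<in> B i" for x i using that by (intro U_B_inf) blast
  interpret connected_tower_automorphism B e \<Omega> \<tau> \<alpha>
    using assms(1) \<alpha>(2,3) \<alpha>_hom \<alpha>_star inf by unfold_locales auto
  show ?thesis
  proof
    assume "inner_automorphism B_inf \<alpha>"
    then obtain w where w: "w \<in> B_inf" "unitary_op w" "\<forall>x\<in>B_inf. \<alpha> x = Ad w x"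
      by (auto simp: inner_automorphism_def)
    obtain u where "u \<in> B 0" "unitary_op u" "\<And>x. x \<in> B 1 \<Longrightarrow> \<alpha> x = Ad u x"
      using inner_implemented_in_B0 [OF w(1,2)] w(3) U_B_inf by metis
    then show "\<exists>u\<in>B 0. unitary_op u \<and> (\<forall>x\<in>B 1. \<alpha> x = Ad u x)" by blast
  next
    assume "\<exists>u\<in>B 0. unitary_op u \<and> (\<forall>x\<in>B 1. \<alpha> x = Ad u x)"
    then obtain u where u: "u \<in> B 0" "unitary_op u" and 1: "\<And>x. x \<in> B 1 \<Longrightarrow> \<alpha> x = Ad u x" by blast
    have "\<alpha> T = Ad u T" if "T \<in> B_inf" for T
      using implemented_on_closure [OF u implemented_climbs [OF u 1] \<alpha>_inf \<alpha>_hom(2) \<alpha>_star(2) that] .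
    then show "inner_automorphism B_inf \<alpha>"
      unfolding inner_automorphism_def using u inf by blast
  qed
qed

end
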